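(* Let $(\tau,Y)\in\mathcal A$ and let $X$ denote the resulting inventory process. Then there exists an admissible ordering policy $(\theta,Z)\in\mathcal A_2$ with resulting inventory process $\tilde X$, such that (pathwise) for each $t\ge0$, $$\int_0^tc_0(\tilde X(s))\,ds+\sum_{j=1}^\infty c_1(\tilde X(\theta_j-),\tilde X(\theta_j))I_{\{\theta_j\le t\}}\le\int_0^tc_0(X(s))\,ds+\sum_{k=1}^\infty c_1(X(\tau_k-),X(\tau_k))I_{\{\tau_k\le t\}}.$$ Consequently, $J(\theta,Z)\le J(\tau,Y)$.
   Context: Geometric Brownian motion inventory model. Let $\mu,\sigma>0$, $W$ a standard Brownian motion; the inventory without ordering satisfies $dX_0(t)=-\mu X_0(t)\,dt+\sigma X_0(t)\,dW(t)$, $X_0(0)=x_0\in(0,\infty)$; $\{\mathcal F_t\}$ is the filtration generated by $X_0$, augmented to satisfy the usual conditions. Costs: $c_0(x)=k_3x+k_4x^\beta$ with $k_3,k_4>0$, $\beta<0$; $c_1(y,z)=k_1+k_2(z^\eta-y^\eta)$ for $0<y\le z$ with $k_1,k_2>0$ and $0<\eta\le1$. An ordering policy $(\tau,Y)=\{(\tau_k,Y_k):k\in\mathbb N\}$ is admissible (class $\mathcal A$) if $\{\tau_k\}$ is an increasing sequence of $\{\mathcal F_t\}$-stopping times and each $Y_k$ is nonnegative, $\mathcal F_{\tau_k}$-measurable, with $X(\tau_k)\in(0,\infty)$, where $X(t)=X(0-)-\int_0^t\mu X(s)\,ds+\int_0^t\sigma X(s)\,dW(s)+\sum_{k\ge1}I_{\{\tau_k\le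 t\}}Y_k$, $X(0-)=x_0$. The cost is $$J(\tau,Y)=\limsup_{t\to\infty}t^{-1}\,\mathbb E\Big[\int_0^tc_0(X(s))\,ds+\sum_{k=1}^\infty I_{\{\tau_k\le t\}}c_1(X(\tau_k-),X(\tau_k))\Big].$$ $\mathcal A_2$ is the set of $(\tau,Y)\in\mathcal A$ whose post-order inventory levels $\{X(\tau_k):k\in\mathbb N\}$ are uniformly bounded above (by a constant). *)

theory Defs
  imports "HOL-Probability.Probability"
begin

section \<open>Filtrations and Brownian motion\<close>

text \<open>
  Processes are functions \<open>X :: real \<Rightarrow> 'a \<Rightarrow> real\<close> of which only the times \<open>t \<ge> 0\<close> matter.
  Filtrations are indexed by \<open>ennreal\<close>, i.e. by \<open>[0, \<infinity>]\<close>, so that the library notions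
  \<^const>\<open>stopping_time\<close> and \<^const>\<open>filtration.pre_sigma\<close> cover stopping times that may be
  infinite.
\<close>

definition generated_sigma :: "'a measure \<Rightarrow> (real \<Rightarrow> 'a \<Rightarrow> real) \<Rightarrow> ennreal \<Rightarrow> 'a measure" where
  "generated_sigma M X u = sigma (space M)
     ({X s -` B \<inter> space M | s B. 0 \<le> s \<and> ennreal s \<le> u \<and> B \<in> sets borel} \<union> null_sets M)"

text \<open>
  The usual augmentation: at a finite time \<open>t\<close> this is the intersection over \<open>u > t\<close> of the
  sigma-algebras generated by \<open>X\<close> up to \<open>u\<close> and the null sets (of a complete measure); at
  \<open>t = \<infinity>\<close> it is the sigma-algebra generated by the whole path and the null sets.
\<close>

definition augmented_filtration ::
    "'a measure \<Rightarrow> (real \<Rightarrow> 'a \<Rightarrow> real) \<Rightarrow> ennreal \<Rightarrow> 'a measure" where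
  "augmented_filtration M X t =
     sigma (space M) (\<Inter>u\<in>{u. t < u \<or> u = \<infinity>}. sets (generated_sigma M X u))"

lemma filtration_augmented: "filtration (space M) (augmented_filtration M X)"
proof
  have sp: "A \<subseteq> space M" if "A \<in> sets (generated_sigma M X u)" for A u
    using sets.sets_into_space[OF that]
    by (auto simp: generated_sigma_def space_measure_of_conv split: if_splits)
  show "space (augmented_filtration M X t) = space M" for t
    by (simp add: augmented_filtration_def space_measure_of_conv)
  show "sets (augmented_filtration M X s) \<le> sets (augmented_filtration M X t)" if "s \<le> t" for s t
  proof -
    have sub: "(\<Inter>u\<in>{u. r < u \<or> u = \<infinity>}. sets (generated_sigma M X u)) \<subseteq> Pow (space M)" for r
      using sp by blast
    show ?thesis
      unfolding augmented_filtration_def sets_measure_of[OF sub]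
      by (rule sigma_sets_mono') (use that in \<open>auto\<close>)
  qed
qed

definition adapted :: "(ennreal \<Rightarrow> 'a measure) \<Rightarrow> (real \<Rightarrow> 'a \<Rightarrow> real) \<Rightarrow> bool" where
  "adapted F X \<longleftrightarrow> (\<forall>t\<ge>0. X t \<in> borel_measurable (F (ennreal t)))"

definition standard_brownian_motion :: "'a measure \<Rightarrow> (real \<Rightarrow> 'a \<Rightarrow> real) \<Rightarrow> bool" where
  "standard_brownian_motion M W \<longleftrightarrow>
     (\<forall>t\<ge>0. W t \<in> borel_measurable M) \<and>
     (AE \<omega> in M. W 0 \<omega> = 0) \<and>
     (AE \<omega> in M. continuous_on {0..} (\<lambda>t. W t \<omega>)) \<and>
     (\<forall>s t. 0 \<le> s \<and> s < t \<longrightarrow>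
        distributed M lborel (\<lambda>\<omega>. W t \<omega> - W s \<omega>) (normal_density 0 (sqrt (t - s)))) \<and>
     (\<forall>(n::nat) u. 0 \<le> u 0 \<and> mono u \<longrightarrow>
        prob_space.indep_vars M (\<lambda>_. borel) (\<lambda>i \<omega>. W (u (Suc i)) \<omega> - W (u i) \<omega>) {..<n})"

section \<open>The Ito integral\<close>

text \<open>
  A simple predictable integrand is \<open>\<Sum>i<n. \<xi> i * indicator {T i <.. T (Suc i)}\<close> with
  nondecreasing stopping times \<open>T i\<close> and \<open>\<F>\<close>-at-\<open>T i\<close>-measurable \<open>\<xi> i\<close>; it is represented by
  \<open>(n, T, \<xi>)\<close>.
\<close>

type_synonym 'a simple_integrand = "nat \<times> (nat \<Rightarrow> 'a \<Rightarrow> ennreal) \<times> (nat \<Rightarrow> 'a \<Rightarrow> real)"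

definition simple_predictable ::
    "'a measure \<Rightarrow> (ennreal \<Rightarrow> 'a measure) \<Rightarrow> 'a simple_integrand \<Rightarrow> bool" where
  "simple_predictable M F = (\<lambda>(n, T, \<xi>).
     (\<forall>i\<le>n. stopping_time F (T i)) \<and>
     (\<forall>i<n. \<forall>\<omega>\<in>space M. T i \<omega> \<le> T (Suc i) \<omega>) \<and>
     (\<forall>i<n. \<xi> i \<in> borel_measurable (filtration.pre_sigma (space M) F (T i))))"

definition simple_value :: "'a simple_integrand \<Rightarrow> real \<Rightarrow> 'a \<Rightarrow> real" where
  "simple_value = (\<lambda>(n, T, \<xi>) t \<omega>.
     \<Sum>i<n. if T i \<omega> < ennreal t \<and> ennreal t \<le> T (Suc i) \<omega> then \<xi> i \<omega> else 0)"

definition stopped :: "(real \<Rightarrow> 'a \<Rightarrow> real) \<Rightarrow> ('a \<Rightarrow> ennreal) \<Rightarrow> real \<Rightarrow> 'a \<Rightarrow> real" where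
  "stopped W T t \<omega> = W (enn2real (min (T \<omega>) (ennreal t))) \<omega>"

definition simple_integral ::
    "(real \<Rightarrow> 'a \<Rightarrow> real) \<Rightarrow> 'a simple_integrand \<Rightarrow> real \<Rightarrow> 'a \<Rightarrow> real" where
  "simple_integral W = (\<lambda>(n, T, \<xi>) t \<omega>.
     \<Sum>i<n. \<xi> i \<omega> * (stopped W (T (Suc i)) t \<omega> - stopped W (T i) t \<omega>))"

text \<open>
  \<open>I\<close> is (a version of) the Ito integral process \<open>\<integral> H dW\<close>: there are simple integrands
  converging to \<open>H\<close> in \<open>L\<^sup>2[0, t]\<close> whose integrals converge to \<open>I\<close> uniformly on \<open>[0, t]\<close>, for every
  \<open>t\<close>.  Both convergences are almost sure, as in McKean's construction; asking for them in
  probability gives the same integral, because a subsequence converges almost surely.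
\<close>

definition ito_integral ::
    "'a measure \<Rightarrow> (ennreal \<Rightarrow> 'a measure) \<Rightarrow> (real \<Rightarrow> 'a \<Rightarrow> real) \<Rightarrow>
     (real \<Rightarrow> 'a \<Rightarrow> real) \<Rightarrow> (real \<Rightarrow> 'a \<Rightarrow> real) \<Rightarrow> bool" where
  "ito_integral M F W H I \<longleftrightarrow>
     adapted F H \<and> adapted F I \<and>
     (AE \<omega> in M. set_borel_measurable lborel {0..} (\<lambda>s. H s \<omega>)) \<and>
     (\<exists>S. (\<forall>m. simple_predictable M F (S m)) \<and>
        (AE \<omega> in M. \<forall>t\<ge>0.
           (\<lambda>m. \<integral>\<^sup>+ s\<in>{0..t}. ennreal ((simple_value (S m) s \<omega> - H s \<omega>)\<^sup>2) \<partial>lborel)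
             \<longlonglongrightarrow> 0 \<and>
           uniform_limit {0..t} (\<lambda>m s. simple_integral W (S m) s \<omega>) (\<lambda>s. I s \<omega>) sequentially))"

section \<open>The inventory model\<close>

text \<open>
  \<open>X(t) = x\<^sub>0 - \<integral>\<^sub>0\<^sup>t \<mu> X(s) ds + \<integral>\<^sub>0\<^sup>t \<sigma> X(s) dW(s) + A(t)\<close> for all \<open>t \<ge> 0\<close>, almost surely.
\<close>

definition gbm_equation ::
    "'a measure \<Rightarrow> (ennreal \<Rightarrow> 'a measure) \<Rightarrow> (real \<Rightarrow> 'a \<Rightarrow> real) \<Rightarrow> real \<Rightarrow> real \<Rightarrow> real \<Rightarrow>
     (real \<Rightarrow> 'a \<Rightarrow> real) \<Rightarrow> (real \<Rightarrow> 'a \<Rightarrow> real) \<Rightarrow> bool" where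
  "gbm_equation M F W \<mu> \<sigma> x\<^sub>0 A X \<longleftrightarrow>
     adapted F X \<and>
     (\<exists>I. ito_integral M F W (\<lambda>s \<omega>. \<sigma> * X s \<omega>) I \<and>
        (AE \<omega> in M. \<forall>t\<ge>0.
           set_integrable lborel {0..t} (\<lambda>s. X s \<omega>) \<and>
           X t \<omega> = x\<^sub>0 - (LINT s:{0..t}|lborel. \<mu> * X s \<omega>) + I t \<omega> + A t \<omega>))"

definition left_limit :: "real \<Rightarrow> (real \<Rightarrow> 'a \<Rightarrow> real) \<Rightarrow> real \<Rightarrow> 'a \<Rightarrow> real" where
  "left_limit x\<^sub>0 X t \<omega> = (if t = 0 then x\<^sub>0 else Lim (at_left t) (\<lambda>s. X s \<omega>))"

definition ordered_amount ::
    "(nat \<Rightarrow> 'a \<Rightarrow> ennreal) \<Rightarrow> (nat \<Rightarrow> 'a \<Rightarrow> real) \<Rightarrow> real \<Rightarrow> 'a \<Rightarrow> real" where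
  "ordered_amount \<tau> Y t \<omega> = (\<Sum>k. if \<tau> k \<omega> \<le> ennreal t then Y k \<omega> else 0)"

text \<open>
  \<open>admissible M F W \<mu> \<sigma> x\<^sub>0 \<tau> Y X\<close>: the policy \<open>(\<tau>, Y)\<close> is in the class \<open>\<A>\<close>, and \<open>X\<close> is its
  inventory process.  Order number \<open>k\<close> is never placed when \<open>\<tau> k \<omega> = \<infinity>\<close>.  Order times may
  coincide or accumulate, but the total amount ordered by any finite time is finite, as the
  equation for \<open>X\<close> requires; the summability condition keeps \<^const>\<open>suminf\<close> from taking a default
  value.
\<close>

definition admissible ::
    "'a measure \<Rightarrow> (ennreal \<Rightarrow> 'a measure) \<Rightarrow> (real \<Rightarrow> 'a \<Rightarrow> real) \<Rightarrow> real \<Rightarrow> real \<Rightarrow> real \<Rightarrow>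
     (nat \<Rightarrow> 'a \<Rightarrow> ennreal) \<Rightarrow> (nat \<Rightarrow> 'a \<Rightarrow> real) \<Rightarrow> (real \<Rightarrow> 'a \<Rightarrow> real) \<Rightarrow> bool" where
  "admissible M F W \<mu> \<sigma> x\<^sub>0 \<tau> Y X \<longleftrightarrow>
     (\<forall>k. stopping_time F (\<tau> k)) \<and>
     (\<forall>\<omega>\<in>space M. incseq (\<lambda>k. \<tau> k \<omega>)) \<and>
     (\<forall>k. Y k \<in> borel_measurable (filtration.pre_sigma (space M) F (\<tau> k))) \<and>
     (\<forall>k. \<forall>\<omega>\<in>space M. 0 \<le> Y k \<omega>) \<and>
     (AE \<omega> in M. \<forall>t\<ge>0. summable (\<lambda>k. if \<tau> k \<omega> \<le> ennreal t then Y k \<omega> else 0)) \<and>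
     gbm_equation M F W \<mu> \<sigma> x\<^sub>0 (ordered_amount \<tau> Y) X \<and>
     (AE \<omega> in M. \<forall>k. \<tau> k \<omega> < \<infinity> \<longrightarrow> 0 < X (enn2real (\<tau> k \<omega>)) \<omega>)"

text \<open>The class \<open>\<A>\<^sub>2\<close>.\<close>

definition admissible_bounded ::
    "'a measure \<Rightarrow> (ennreal \<Rightarrow> 'a measure) \<Rightarrow> (real \<Rightarrow> 'a \<Rightarrow> real) \<Rightarrow> real \<Rightarrow> real \<Rightarrow> real \<Rightarrow>
     (nat \<Rightarrow> 'a \<Rightarrow> ennreal) \<Rightarrow> (nat \<Rightarrow> 'a \<Rightarrow> real) \<Rightarrow> (real \<Rightarrow> 'a \<Rightarrow> real) \<Rightarrow> bool" where
  "admissible_bounded M F W \<mu> \<sigma> x\<^sub>0 \<tau> Y X \<longleftrightarrow>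
     admissible M F W \<mu> \<sigma> x\<^sub>0 \<tau> Y X \<and>
     (\<exists>B. AE \<omega> in M. \<forall>k. \<tau> k \<omega> < \<infinity> \<longrightarrow> X (enn2real (\<tau> k \<omega>)) \<omega> \<le> B)"

definition holding_cost :: "real \<Rightarrow> real \<Rightarrow> real \<Rightarrow> real \<Rightarrow> real" where
  "holding_cost k\<^sub>3 k\<^sub>4 \<beta> x = k\<^sub>3 * x + k\<^sub>4 * x powr \<beta>"

definition ordering_cost :: "real \<Rightarrow> real \<Rightarrow> real \<Rightarrow> real \<Rightarrow> real \<Rightarrow> real" where
  "ordering_cost k\<^sub>1 k\<^sub>2 \<eta> y z = k\<^sub>1 + k\<^sub>2 * (z powr \<eta> - y powr \<eta>)"

text \<open>
  Almost surely the arguments of the cost functions below are in \<open>(0, \<infinity>)\<close> and the costs are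
  nonnegative, so \<^const>\<open>ennreal\<close> does not truncate them.
\<close>

definition accumulated_cost ::
    "(real \<Rightarrow> real) \<Rightarrow> (real \<Rightarrow> real \<Rightarrow> real) \<Rightarrow> real \<Rightarrow> (nat \<Rightarrow> 'a \<Rightarrow> ennreal) \<Rightarrow>
     (real \<Rightarrow> 'a \<Rightarrow> real) \<Rightarrow> real \<Rightarrow> 'a \<Rightarrow> ennreal" where
  "accumulated_cost c\<^sub>0 c\<^sub>1 x\<^sub>0 \<tau> X t \<omega> =
     (\<integral>\<^sup>+ s\<in>{0..t}. ennreal (c\<^sub>0 (X s \<omega>)) \<partial>lborel) +
     (\<Sum>k. if \<tau> k \<omega> \<le> ennreal t
           then ennreal (c\<^sub>1 (left_limit x\<^sub>0 X (enn2real (\<tau> k \<omega>)) \<omega>) (X (enn2real (\<tau> k \<omega>)) \<omega>))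
           else 0)"

definition average_cost ::
    "'a measure \<Rightarrow> (real \<Rightarrow> real) \<Rightarrow> (real \<Rightarrow> real \<Rightarrow> real) \<Rightarrow> real \<Rightarrow> (nat \<Rightarrow> 'a \<Rightarrow> ennreal) \<Rightarrow>
     (real \<Rightarrow> 'a \<Rightarrow> real) \<Rightarrow> ennreal" where
  "average_cost M c\<^sub>0 c\<^sub>1 x\<^sub>0 \<tau> X =
     Limsup at_top (\<lambda>t. (\<integral>\<^sup>+ \<omega>. accumulated_cost c\<^sub>0 c\<^sub>1 x\<^sub>0 \<tau> X t \<omega> \<partial>M) / ennreal t)"

end

theory Submission
  imports Defs
begin

text \<open>
  Write \<open>X' = R * X\<close> for the modified inventory.  As both processes solve the same linear equation
  between orders, \<open>R\<close> is piecewise constant, and the idea is to keep \<open>0 < R \<le> 1\<close> and to keep \<open>X'\<close>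
  above a level \<open>a\<close> to the right of the minimum of the holding cost whenever \<open>R < 1\<close>; then the
  holding cost of \<open>X'\<close> never exceeds that of \<open>X\<close>.  The modified policy ignores the orders of the
  original one while \<open>X' > a\<close>.  When \<open>X'\<close> is at most \<open>a\<close> and below the current original level, it
  orders up to that level if this is at most a large bound \<open>B\<close>, and up to \<open>2 * a\<close> otherwise.  Part of
  the amount saved so far is a function \<open>k\<^sub>1 + k\<^sub>2 * a powr \<eta> * (R powr (- \<eta>) - 1)\<close> of \<open>R\<close>, and for
  large \<open>B\<close> this pays for all further orders.

  The argument is pathwise, apart from the linearity of the Ito integral.  It does not even need that
  \<open>X\<close> stays positive: the modified inventory may be absorbed at zero, where the formal holding cost
  is \<open>0\<close> because \<open>0 powr \<beta> = 0\<close>.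
\<close>

section \<open>Filtrations satisfying the usual conditions\<close>

text \<open>The potential is a prepaid order. With ratio \<open>R < 1\<close> and modified level
  \<open>a\<close>, the original level is \<open>a / R\<close>, and the potential equals
  \<open>ordering_cost k\<^sub>1 k\<^sub>2 \<eta> a (a / R)\<close>: returning to the original level
  is already paid for. The partial order goes to \<open>2 * a\<close>, not \<open>a\<close>, so that
  the level is strictly above the trigger afterwards and the next change comes strictly later. The
  obstacle is that order times may accumulate. A recursion over changes of state stops short of an
  accumulation point, yet the new policy must be admissible beyond it. The remedy is a bound on the
  variation of the ratio: a decrease is at most the size of the original order divided by
  \<open>a\<close>, and the ratio stays in (0, 1], so its jumps are absolutely summable on bounded
  intervals. Hence the ratio is defined at all times as a series, and the equation can be rescaled
  by infinitely many jumps. The cost comparison is trivial beyond an accumulation point: a change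
  without an original order lowers the potential by at least \<open>k\<^sub>1\<close>, so infinitely
  many changes include infinitely many original orders, and the original cost is infinite.\<close>

locale usual_filtration = filtration "space M" F
  for M :: "'a measure" and F :: "ennreal \<Rightarrow> 'a measure" +
  assumes complete: "complete_measure M"
    and null_sets_F: "null_sets M \<subseteq> sets (F t)"
    \<comment> \<open>At \<open>t = \<infinity>\<close> there is no later \<open>u\<close>, and the
      implication would put every set into \<open>F \<infinity>\<close>; hence the restriction to
      finite times.\<close>
    and right_continuous: "t < \<infinity> \<Longrightarrow> (\<And>u. t < u \<Longrightarrow> A \<in> sets (F u)) \<Longrightarrow> A \<in> sets (F t)"

section \<open>The augmented filtration satisfies the usual conditions\<close>

lemma sets_generated_sigma_bounds:
  "null_sets M \<subseteq> sets (generated_sigma M X u)" "sets (generated_sigma M X u) \<subseteq> Pow (space M)"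
proof -
  have "{X s -` B \<inter> space M | s B. 0 \<le> s \<and> ennreal s \<le> u \<and> B \<in> sets borel} \<union> null_sets M \<subseteq> Pow (space M)"
    using sets.sets_into_space by auto
  then have *: "sets (generated_sigma M X u) =
      sigma_sets (space M) ({X s -` B \<inter> space M | s B. 0 \<le> s \<and> ennreal s \<le> u \<and> B \<in> sets borel} \<union> null_sets M)"
    and sub: "{X s -` B \<inter> space M | s B. 0 \<le> s \<and> ennreal s \<le> u \<and> B \<in> sets borel} \<union> null_sets M \<subseteq> Pow (space M)"
    unfolding generated_sigma_def by auto
  show "null_sets M \<subseteq> sets (generated_sigma M X u)"
    unfolding * by auto
  show "sets (generated_sigma M X u) \<subseteq> Pow (space M)"
    using sigma_sets_into_sp[OF sub] unfolding * by auto
qed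

lemma space_generated_sigma [simp]: "space (generated_sigma M X u) = space M"
  by (simp add: generated_sigma_def space_measure_of_conv)

text \<open>An intersection of sigma-algebras on one space is a sigma-algebra, so the closure in the
  definition adds nothing and membership can be tested one \<open>u\<close> at a time. The index
  \<open>\<infinity>\<close> keeps the family nonempty.\<close>

lemma sets_augmented_filtration:
  "sets (augmented_filtration M X t) = (\<Inter>u\<in>{u. t < u \<or> u = \<infinity>}. sets (generated_sigma M X u))"
proof -
  let ?I = "\<Inter>u\<in>{u. t < u \<or> u = \<infinity>}. sets (generated_sigma M X u)"
  have sub: "?I \<subseteq> Pow (space M)"
    using sets_generated_sigma_bounds(2)[of M X \<infinity>] by blast
  have "sigma_algebra (space M) ?I"
    unfolding sigma_algebra_iff2
  proof (intro conjI ballI allI impI)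
    fix A assume "A \<in> ?I" 
    then show "space M - A \<in> ?I"
      using sets.compl_sets[of A "generated_sigma M X _"] by auto
  next
    fix A :: "nat \<Rightarrow> 'a set" assume "range A \<subseteq> ?I"
    then show "\<Union>(range A) \<in> ?I"
      by (intro INT_I sets.countable_UN) (rule subset_trans, assumption, rule INT_lower)
  qed (use sub in auto)
  then show ?thesis
    unfolding augmented_filtration_def by (rule sigma_algebra.sets_measure_of_eq)
qed

lemma usual_filtration_augmented:
  assumes "complete_measure M"
  shows "usual_filtration M (augmented_filtration M X)"
proof -
  interpret filtration "space M" "augmented_filtration M X" by (rule filtration_augmented)
  show ?thesis
  proof (intro usual_filtration.intro usual_filtration_axioms.intro)
    show "filtration (space M) (augmented_filtration M X)" by (rule filtration_augmented)
    show "complete_measure M" by fact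
    show "null_sets M \<subseteq> sets (augmented_filtration M X t)" for t
      unfolding sets_augmented_filtration using sets_generated_sigma_bounds(1) by blast
    fix t :: ennreal and A assume t: "t < \<infinity>" and A: "\<And>u. t < u \<Longrightarrow> A \<in> sets (augmented_filtration M X u)"
    show "A \<in> sets (augmented_filtration M X t)"
      unfolding sets_augmented_filtration
    proof (intro INT_I)
      fix u assume "u \<in> {u. t < u \<or> u = \<infinity>}"
      then have u: "t < u" using t by auto
      then obtain v where "t < v" "v < u" using dense by blast
      then show "A \<in> sets (generated_sigma M X u)"
        using A[of v] unfolding sets_augmented_filtration by auto
    qed
  qed
qed

context usual_filtration
begin

section \<open>Measurability up to fixed times and stopping times\<close>

lemma measurable_F_mono: "s \<le> t \<Longrightarrow> f \<in> measurable (F s) N \<Longrightarrow> f \<in> measurable (F t) N"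
  using sets_F_mono[of s t] unfolding measurable_def by (auto simp: space_F)

text \<open>By completeness every subset of a null set lies in \<open>F t\<close>, so paths can be
  altered on a null set without losing adaptedness.\<close>

lemma measurable_F_AE_cong:
  fixes f g :: "'a \<Rightarrow> 'b"
  assumes f: "f \<in> measurable (F t) N" and AE: "AE \<omega> in M. f \<omega> = g \<omega>"
    and g: "\<And>\<omega>. \<omega> \<in> space M \<Longrightarrow> g \<omega> \<in> space N"
  shows "g \<in> measurable (F t) N"
proof (rule measurableI)
  show "g x \<in> space N" if "x \<in> space (F t)" for x
    using that g by (simp add: space_F)
  fix B assume B: "B \<in> sets N"
  obtain Z where Z: "Z \<in> null_sets M" "{\<omega>\<in>space M. f \<omega> \<noteq> g \<omega>} \<subseteq> Z"
    using AE by (auto elim!: AE_E)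
  have "g -` B \<inter> space (F t) = (f -` B \<inter> space (F t) - Z) \<union> (g -` B \<inter> space M \<inter> Z)"
    using Z(2) by (auto simp: space_F)
  moreover have "g -` B \<inter> space M \<inter> Z \<in> null_sets M"
    using Z(1) complete_measure.complete2[OF complete, of "g -` B \<inter> space M \<inter> Z" Z] by auto
  ultimately show "g -` B \<inter> space (F t) \<in> sets (F t)"
    using null_sets_F[of t] measurable_sets[OF f B] Z(1) by (metis sets.Diff sets.Un subsetD)
qed

lemma pred_F_mono: "s \<le> t \<Longrightarrow> Measurable.pred (F s) P \<Longrightarrow> Measurable.pred (F t) P"
  by (rule measurable_F_mono)

text \<open>This trades the sigma-algebra at a stopping time for the members of the filtration. The
  default value 0 is harmless because the event \<open>T \<omega> \<le> t\<close> itself belongs to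
  \<open>F t\<close>.\<close>

lemma borel_measurable_pre_sigma_iff:
  fixes Y :: "'a \<Rightarrow> real"
  assumes T: "stopping_time F T"
  shows "Y \<in> borel_measurable (pre_sigma T) \<longleftrightarrow>
    (\<forall>t. (\<lambda>\<omega>. if T \<omega> \<le> t then Y \<omega> else 0) \<in> borel_measurable (F t))"
proof safe
  fix t assume Y: "Y \<in> borel_measurable (pre_sigma T)"
  note [measurable] = stopping_timeD[OF T]
  show "(\<lambda>\<omega>. if T \<omega> \<le> t then Y \<omega> else 0) \<in> borel_measurable (F t)"
  proof (rule measurableI)
    fix B :: "real set" assume B: "B \<in> sets borel"
    have 1: "{\<omega>\<in>Y -` B \<inter> space M. T \<omega> \<le> t} \<in> sets (F t)"
      using sets_pre_sigmaD[OF T measurable_sets[OF Y B], of t] by (simp add: space_pre_sigma)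
    have 2: "{\<omega>\<in>space (F t). \<not> T \<omega> \<le> t} \<in> sets (F t)" by measurable
    have "(\<lambda>\<omega>. if T \<omega> \<le> t then Y \<omega> else 0) -` B \<inter> space (F t) =
        {\<omega>\<in>Y -` B \<inter> space M. T \<omega> \<le> t} \<union> (if 0 \<in> B then {\<omega>\<in>space (F t). \<not> T \<omega> \<le> t} else {})"
      by (auto simp: space_F split: if_splits)
    then show "(\<lambda>\<omega>. if T \<omega> \<le> t then Y \<omega> else 0) -` B \<inter> space (F t) \<in> sets (F t)"
      using 1 2 by auto
  qed simp
next
  assume *: "\<forall>t. (\<lambda>\<omega>. if T \<omega> \<le> t then Y \<omega> else 0) \<in> borel_measurable (F t)"
  show "Y \<in> borel_measurable (pre_sigma T)"
  proof (rule measurableI)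
    fix B :: "real set" assume B: "B \<in> sets borel"
    show "Y -` B \<inter> space (pre_sigma T) \<in> sets (pre_sigma T)"
    proof (rule sets_pre_sigmaI[OF T])
      fix t
      have "{\<omega> \<in> Y -` B \<inter> space (pre_sigma T). T \<omega> \<le> t} =
         ((\<lambda>\<omega>. if T \<omega> \<le> t then Y \<omega> else 0) -` B \<inter> space (F t)) \<inter> {\<omega>\<in>space (F t). T \<omega> \<le> t}"
        by (auto simp: space_F space_pre_sigma)
      also have "\<dots> \<in> sets (F t)"
        using *[rule_format, of t] B stopping_timeD[OF T, of t] by (auto simp: pred_def)
      finally show "{\<omega> \<in> Y -` B \<inter> space (pre_sigma T). T \<omega> \<le> t} \<in> sets (F t)" .
    qed
  qed simp
qed

lemma pre_sigma_measurableD: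
  fixes Y :: "'a \<Rightarrow> real"
  assumes "stopping_time F T" "Y \<in> borel_measurable (pre_sigma T)"
  shows "(\<lambda>\<omega>. if T \<omega> \<le> t then Y \<omega> else 0) \<in> borel_measurable (F t)"
  using assms borel_measurable_pre_sigma_iff by blast

lemma measurable_pre_sigma_mono:
  assumes T: "stopping_time F T" and S: "stopping_time F S"
    and le: "\<And>\<omega>. \<omega> \<in> space M \<Longrightarrow> T \<omega> \<le> S \<omega>" and f: "f \<in> measurable (pre_sigma T) N"
  shows "f \<in> measurable (pre_sigma S) N"
  using f mono_pre_sigma[OF T S le] unfolding measurable_def by (auto simp: space_pre_sigma)

lemma measurable_min_stopping_time:
  assumes T: "stopping_time F T"
  shows "(\<lambda>\<omega>. min (T \<omega>) t) \<in> borel_measurable (F t)"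
proof (rule borel_measurableI_le)
  fix u
  show "{\<omega> \<in> space (F t). min (T \<omega>) t \<le> u} \<in> sets (F t)"
  proof (cases "t \<le> u")
    case False
    then have "Measurable.pred (F t) (\<lambda>\<omega>. T \<omega> \<le> u)"
      by (intro stopping_time_le_const[OF T]) auto
    then show ?thesis using False by (auto simp: pred_def min_le_iff_disj)
  qed (auto simp: min_le_iff_disj)
qed

lemma adaptedD: "adapted F X \<Longrightarrow> 0 \<le> s \<Longrightarrow> ennreal s \<le> t \<Longrightarrow> X s \<in> borel_measurable (F t)"
  unfolding adapted_def using measurable_F_mono by blast

lemma measurable_sample:
  assumes X: "adapted F X" and T: "stopping_time F T"
    and rc: "\<And>\<omega> s. \<omega> \<in> space M \<Longrightarrow> 0 \<le> s \<Longrightarrow> continuous (at s within {s..}) (\<lambda>s. X s \<omega>)"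
    and t: "0 \<le> t"
  shows "(\<lambda>\<omega>. X (enn2real (min (T \<omega>) (ennreal t))) \<omega>) \<in> borel_measurable (F (ennreal t))"
proof -
  define s where "s = (\<lambda>\<omega>. enn2real (min (T \<omega>) (ennreal t)))"
  define k where "k m \<omega> = \<lfloor>2 ^ m * s \<omega>\<rfloor>" for m :: nat and \<omega>
  \<comment> \<open>\<open>r m\<close> rounds \<open>s\<close> up to a dyadic time, so that right
    continuity applies, and caps it at \<open>t\<close>, so that the sampled values are known by
    time \<open>t\<close>. With \<open>max 0\<close> the time is nonnegative for every integer
    index, as the countable composition requires.\<close>
  define r where "r m \<omega> = max 0 (min t (of_int (k m \<omega> + 1) / 2 ^ m))" for m :: nat and \<omega>
  have [measurable]: "s \<in> borel_measurable (F (ennreal t))"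
    unfolding s_def using measurable_min_stopping_time[OF T] by measurable
  have s: "0 \<le> s \<omega>" "s \<omega> \<le> t" for \<omega>
    using t by (auto simp: s_def intro!: enn2real_leI)
  have [measurable]: "k m \<in> measurable (F (ennreal t)) (count_space UNIV)" for m
    unfolding k_def by measurable
  have meas: "(\<lambda>\<omega>. X (r m \<omega>) \<omega>) \<in> borel_measurable (F (ennreal t))" for m
    unfolding r_def
    by (rule measurable_compose_countable[where f="\<lambda>i \<omega>. X (max 0 (min t (of_int (i + 1) / 2 ^ m))) \<omega>" and g="k m"])
       (use X t in \<open>auto intro!: adaptedD ennreal_leI\<close>)
  have lim: "(\<lambda>m. X (r m \<omega>) \<omega>) \<longlonglongrightarrow> X (s \<omega>) \<omega>" if \<omega>: "\<omega> \<in> space M" for \<omega>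
  proof -
    have ge: "r m \<omega> \<ge> s \<omega>" for m
    proof -
      have "2 ^ m * s \<omega> \<le> of_int (k m \<omega> + 1)" unfolding k_def by linarith
      then have "s \<omega> \<le> of_int (k m \<omega> + 1) / 2 ^ m" by (simp add: field_simps)
      then show ?thesis using s[of \<omega>] unfolding r_def by auto
    qed
    have le: "r m \<omega> \<le> s \<omega> + (1/2) ^ m" for m
    proof -
      have "of_int (k m \<omega> + 1) \<le> 2 ^ m * s \<omega> + 1" unfolding k_def by simp
      then have "of_int (k m \<omega> + 1) / 2 ^ m \<le> s \<omega> + (1/2) ^ m" by (simp add: field_simps)
      then show ?thesis using s[of \<omega>] unfolding r_def by (simp add: min.coboundedI2)
    qed
    have "(\<lambda>m. s \<omega> + (1/2) ^ m) \<longlonglongrightarrow> s \<omega> + 0"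
      by (intro tendsto_intros LIMSEQ_power_zero) auto
    then have "(\<lambda>m. r m \<omega>) \<longlonglongrightarrow> s \<omega>"
      by (intro tendsto_sandwich[OF _ _ tendsto_const[of "s \<omega>"], of "\<lambda>m. r m \<omega>"]) (use ge le in auto)
    moreover have "\<forall>m. r m \<omega> \<in> {s \<omega>..}" using ge by auto
    ultimately show ?thesis
      using rc[OF \<omega> s(1)[of \<omega>]] unfolding continuous_within_sequentially by (auto simp: o_def)
  qed
  have "(\<lambda>\<omega>. X (s \<omega>) \<omega>) \<in> borel_measurable (F (ennreal t))"
    by (rule borel_measurable_LIMSEQ_real[OF _ meas]) (use lim in \<open>auto simp: space_F\<close>)
  then show ?thesis by (simp add: s_def)
qed

lemma pre_sigma_sample:
  assumes X: "adapted F X" and T: "stopping_time F T"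
    and rc: "\<And>\<omega> s. \<omega> \<in> space M \<Longrightarrow> 0 \<le> s \<Longrightarrow> continuous (at s within {s..}) (\<lambda>s. X s \<omega>)"
  shows "(\<lambda>\<omega>. X (enn2real (T \<omega>)) \<omega>) \<in> borel_measurable (pre_sigma T)"
  unfolding borel_measurable_pre_sigma_iff[OF T]
proof
  fix t
  have fin: "(\<lambda>\<omega>. if T \<omega> \<le> ennreal t then X (enn2real (T \<omega>)) \<omega> else 0) \<in> borel_measurable (F (ennreal t))"
    if t: "0 \<le> t" for t
  proof -
    note [measurable] = stopping_timeD[OF T] measurable_sample[OF X T rc t]
    have "(\<lambda>\<omega>. if T \<omega> \<le> ennreal t then X (enn2real (min (T \<omega>) (ennreal t))) \<omega> else 0)
        \<in> borel_measurable (F (ennreal t))" by measurable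
    also have "?this \<longleftrightarrow> ?thesis"
      by (intro arg_cong2[where f="\<lambda>x y. x \<in> y"] refl ext) (auto simp: min_def)
    finally show ?thesis .
  qed
  show "(\<lambda>\<omega>. if T \<omega> \<le> t then X (enn2real (T \<omega>)) \<omega> else 0) \<in> borel_measurable (F t)"
  proof (cases t)
    case (real r)
    then show ?thesis using fin[of r] by simp
  next
    case top
    have meas: "(\<lambda>\<omega>. if T \<omega> \<le> ennreal (real n) then X (enn2real (T \<omega>)) \<omega> else 0) \<in> borel_measurable (F \<infinity>)" for n
      using fin[of "real n"] by (rule measurable_F_mono[rotated]) auto
    \<comment> \<open>\<open>enn2real \<infinity>\<close> is 0, so the sampled value is
      \<open>X 0\<close> wherever \<open>T\<close> is infinite.\<close>
    have X0: "X 0 \<in> borel_measurable (F \<infinity>)"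
      using X by (rule adaptedD) auto
    have "(\<lambda>\<omega>. X (enn2real (T \<omega>)) \<omega>) \<in> borel_measurable (F \<infinity>)"
    proof (rule borel_measurable_LIMSEQ_real)
      show "(\<lambda>\<omega>. if T \<omega> = \<top> then X 0 \<omega> else if T \<omega> \<le> ennreal (real n) then X (enn2real (T \<omega>)) \<omega> else 0)
          \<in> borel_measurable (F \<infinity>)" for n
        using stopping_time_eq_const[OF T, of \<infinity>]
        by (intro measurable_If[OF X0 meas]) (auto simp: pred_def)
      fix \<omega> assume "\<omega> \<in> space (F \<infinity>)"
      show "(\<lambda>n. if T \<omega> = \<top> then X 0 \<omega> else if T \<omega> \<le> ennreal (real n) then X (enn2real (T \<omega>)) \<omega> else 0)
          \<longlonglongrightarrow> X (enn2real (T \<omega>)) \<omega>"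
      proof (cases "T \<omega>")
        case (real r)
        then have "eventually (\<lambda>n. T \<omega> \<le> ennreal (real n)) sequentially"
          using eventually_ge_at_top[of "nat \<lceil>r\<rceil>"]
          by (auto elim!: eventually_mono intro!: ennreal_leI simp: nat_le_iff ceiling_le_iff)
        then show ?thesis
          by (intro tendsto_eventually, elim eventually_mono) (use real in auto)
      qed simp
    qed
    then show ?thesis using top by simp
  qed
qed

text \<open>A condition that persists for a short while to the right holds at some rational time
  whenever it holds at all, so the event that the infimum is below \<open>u\<close> is a countable
  union of events in \<open>F u\<close>. Right continuity of the filtration then turns the strict
  inequality into a weak one. Measurability of \<open>Q\<close> is asked only together with
  \<open>\<rho> \<omega> \<le> ennreal t\<close>, because the states inserted for \<open>Q\<close>
  are known only from \<open>\<rho>\<close> on.\<close>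

lemma stopping_time_debut:
  assumes \<rho>: "stopping_time F \<rho>"
    and Q: "\<And>t. 0 \<le> t \<Longrightarrow> Measurable.pred (F (ennreal t)) (\<lambda>\<omega>. \<rho> \<omega> \<le> ennreal t \<and> Q t \<omega>)"
    and right_open: "\<And>\<omega> t. \<omega> \<in> space M \<Longrightarrow> 0 \<le> t \<Longrightarrow> Q t \<omega> \<Longrightarrow> \<exists>\<epsilon>>0. \<forall>s. t \<le> s \<and> s < t + \<epsilon> \<longrightarrow> Q s \<omega>"
  shows "stopping_time F (\<lambda>\<omega>. Inf {ennreal t |t. 0 \<le> t \<and> \<rho> \<omega> \<le> ennreal t \<and> Q t \<omega>})"
proof -
  let ?T = "\<lambda>\<omega>. Inf {ennreal t |t. 0 \<le> t \<and> \<rho> \<omega> \<le> ennreal t \<and> Q t \<omega>}"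
  have less: "Measurable.pred (F u) (\<lambda>\<omega>. ?T \<omega> < u)" for u
  proof (rule measurable_cong[THEN iffD2])
    let ?D = "{q::rat. 0 \<le> q \<and> ennreal (of_rat q) < u}"
    show "Measurable.pred (F u) (\<lambda>\<omega>. \<exists>q\<in>?D. \<rho> \<omega> \<le> ennreal (of_rat q) \<and> Q (of_rat q) \<omega>)"
    proof (rule measurable_pred_countable)
      fix q assume "q \<in> ?D"
      then show "Measurable.pred (F u) (\<lambda>\<omega>. \<rho> \<omega> \<le> ennreal (of_rat q) \<and> Q (of_rat q) \<omega>)"
        using Q[of "of_rat q"] by (intro pred_F_mono[of "ennreal (of_rat q)" u]) (auto intro: less_imp_le)
    qed auto
    fix \<omega> assume "\<omega> \<in> space (F u)"
    then have \<omega>: "\<omega> \<in> space M" by (simp add: space_F)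
    show "(?T \<omega> < u) = (\<exists>q\<in>?D. \<rho> \<omega> \<le> ennreal (of_rat q) \<and> Q (of_rat q) \<omega>)"
    proof
      assume "?T \<omega> < u"
      then obtain t where t: "0 \<le> t" "\<rho> \<omega> \<le> ennreal t" "Q t \<omega>" "ennreal t < u"
        unfolding Inf_less_iff by auto
      obtain \<epsilon> where e: "\<epsilon> > 0" "\<And>s. t \<le> s \<Longrightarrow> s < t + \<epsilon> \<Longrightarrow> Q s \<omega>"
        using right_open[OF \<omega> t(1,3)] by blast
      obtain v where v: "t < v" "ennreal v \<le> u"
      proof (cases u)
        case (real r)
        then show ?thesis using t that[of r] by (simp add: ennreal_less_iff)
      next
        case top
        then show ?thesis using that[of "t + 1"] by simp
      qed
      obtain q where q: "t < of_rat q" "of_rat q < min v (t + \<epsilon>)"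
        using of_rat_dense[of t "min v (t + \<epsilon>)"] v e(1) by auto
      have q0: "0 \<le> q" using q(1) t(1) by (metis less_eq_real_def order.trans zero_le_of_rat_iff)
      have "ennreal (of_rat q) < ennreal v" using q q0 by (simp add: ennreal_less_iff)
      then have "ennreal (of_rat q) < u" using v by auto
      moreover have "\<rho> \<omega> \<le> ennreal (of_rat q)"
        using t(2) q(1) by (meson ennreal_leI less_imp_le order.trans)
      moreover have "Q (of_rat q) \<omega>" using e(2) q by auto
      ultimately show "\<exists>q\<in>?D. \<rho> \<omega> \<le> ennreal (of_rat q) \<and> Q (of_rat q) \<omega>" using q0 by auto
    next
      assume "\<exists>q\<in>?D. \<rho> \<omega> \<le> ennreal (of_rat q) \<and> Q (of_rat q) \<omega>"
      then show "?T \<omega> < u"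
        unfolding Inf_less_iff by (auto intro!: exI[of _ "of_rat _"])
    qed
  qed
  show ?thesis
  proof (rule stopping_timeI)
    fix t
    show "Measurable.pred (F t) (\<lambda>\<omega>. ?T \<omega> \<le> t)"
    proof (cases "t = \<infinity>")
      case False
      then have t: "t < \<infinity>" by (simp add: top.not_eq_extremum)
      have "{\<omega>\<in>space M. ?T \<omega> \<le> t} \<in> sets (F t)"
      proof (rule right_continuous[OF t])
        fix u assume u: "t < u"
        obtain r where r: "0 \<le> r" "t = ennreal r" using t by (cases t) auto
        define v where "v n = ennreal (r + 1 / real (Suc n))" for n
        have v_gt: "t < v n" for n using r by (simp add: v_def ennreal_less_iff)
        have "v \<longlonglongrightarrow> ennreal (r + 0)"
          unfolding v_def by (intro tendsto_intros LIMSEQ_Suc[OF lim_1_over_n])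
        then have v_lim: "v \<longlonglongrightarrow> t" using r by simp
        \<comment> \<open>Only the bounds \<open>v n\<close> below \<open>u\<close> yield events in
          \<open>F u\<close>. All but finitely many are of this kind, so dropping the others does
          not change the intersection.\<close>
        have "{\<omega>\<in>space M. ?T \<omega> \<le> t} = {\<omega>\<in>space (F u). \<forall>n\<in>{n. v n < u}. ?T \<omega> < v n}"
        proof (intro Collect_cong conj_cong iffI)
          fix \<omega> assume *: "\<forall>n\<in>{n. v n < u}. ?T \<omega> < v n"
          have "eventually (\<lambda>n. ?T \<omega> \<le> v n) sequentially"
            using order_tendstoD(2)[OF v_lim u] by eventually_elim (use * in \<open>auto intro: less_imp_le\<close>)
          with v_lim show "?T \<omega> \<le> t" by (intro tendsto_lowerbound) auto
        qed (use v_gt in \<open>auto simp: space_F intro: le_less_trans\<close>)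
        also have "\<dots> \<in> sets (F u)"
          unfolding pred_def[symmetric]
        proof (rule measurable_pred_countable)
          show "Measurable.pred (F u) (\<lambda>\<omega>. ?T \<omega> < v n)" if "n \<in> {n. v n < u}" for n
            using that by (intro pred_F_mono[OF _ less]) auto
        qed auto
        finally show "{\<omega>\<in>space M. ?T \<omega> \<le> t} \<in> sets (F u)" .
      qed
      then show ?thesis by (simp add: pred_def space_F)
    qed simp
  qed
qed

end

section \<open>Rescaling a solution at stopping times\<close>

lemma sum_lessThan_add:
  fixes f :: "nat \<Rightarrow> 'b::comm_monoid_add"
  shows "(\<Sum>i<n + m. f i) = (\<Sum>i<n. f i) + (\<Sum>i<m. f (n + i))"
  by (induction m) (simp_all add: ac_simps)

definition min_time :: "ennreal \<Rightarrow> real \<Rightarrow> real" where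
  "min_time r t = enn2real (min r (ennreal t))"

lemma min_time_eq: "0 \<le> t \<Longrightarrow> min_time r t = (if r \<le> ennreal t then enn2real r else t)"
  by (auto simp: min_time_def min_def)

lemma ennreal_min_time: "0 \<le> t \<Longrightarrow> ennreal (min_time r t) = min r (ennreal t)"
  using order_le_less_trans[of r "ennreal t" \<top>] by (simp add: min_time_def min_def)

lemma min_time_bounds: "0 \<le> t \<Longrightarrow> 0 \<le> min_time r t" "0 \<le> t \<Longrightarrow> min_time r t \<le> t"
  by (auto simp: min_time_def intro!: enn2real_leI)

text \<open>The integrand \<open>S\<close> on \<open>(0, \<rho>]\<close>, followed by \<open>d * S'\<close> on \<open>(\<rho>, \<infinity>)\<close>.\<close>

definition paste_simple ::
    "('a \<Rightarrow> ennreal) \<Rightarrow> ('a \<Rightarrow> real) \<Rightarrow> 'a simple_integrand \<Rightarrow> 'a simple_integrand \<Rightarrow> 'a simple_integrand" where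
  "paste_simple \<rho> d = (\<lambda>(n, T, \<xi>) (n', T', \<xi>').
     (Suc n + n',
      \<lambda>i \<omega>. if i \<le> n then min (T i \<omega>) (\<rho> \<omega>) else max (T' (i - Suc n) \<omega>) (\<rho> \<omega>),
      \<lambda>i \<omega>. if i < n then if T i \<omega> < \<rho> \<omega> then \<xi> i \<omega> else 0
            else if i = n then 0 else d \<omega> * \<xi>' (i - Suc n) \<omega>))"

lemma simple_value_paste_simple:
  "simple_value (paste_simple \<rho> d S S') t \<omega> =
    (if ennreal t \<le> \<rho> \<omega> then simple_value S t \<omega> else d \<omega> * simple_value S' t \<omega>)"
proof -
  obtain n T \<xi> n' T' \<xi>' where S: "S = (n, T, \<xi>)" "S' = (n', T', \<xi>')" by (cases S, cases S') auto
  define T'' where "T'' i \<omega> = (if i \<le> n then min (T i \<omega>) (\<rho> \<omega>) else max (T' (i - Suc n) \<omega>) (\<rho> \<omega>))" for i \<omega>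
  define \<xi>'' where "\<xi>'' i \<omega> = (if i < n then if T i \<omega> < \<rho> \<omega> then \<xi> i \<omega> else 0
            else if i = n then 0 else d \<omega> * \<xi>' (i - Suc n) \<omega>)" for i \<omega>
  let ?t = "ennreal t"
  have 1: "(\<Sum>i<n. if T'' i \<omega> < ?t \<and> ?t \<le> T'' (Suc i) \<omega> then \<xi>'' i \<omega> else 0) =
      (if ?t \<le> \<rho> \<omega> then simple_value S t \<omega> else 0)"
    by (cases "?t \<le> \<rho> \<omega>") (auto simp: T''_def \<xi>''_def S simple_value_def intro!: sum.cong sum.neutral)
  have 2: "(\<Sum>i<n'. if T'' (Suc n + i) \<omega> < ?t \<and> ?t \<le> T'' (Suc (Suc n + i)) \<omega> then \<xi>'' (Suc n + i) \<omega> else 0) =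
      (if ?t \<le> \<rho> \<omega> then 0 else d \<omega> * simple_value S' t \<omega>)"
    by (cases "?t \<le> \<rho> \<omega>")
       (auto simp: T''_def \<xi>''_def S simple_value_def sum_distrib_left le_max_iff_disj intro!: sum.cong sum.neutral)
  \<comment> \<open>Index \<open>n\<close> is the gap between the last time of the first integrand
    and the first time of the second; its coefficient is 0.\<close>
  have 3: "\<xi>'' n \<omega> = 0" by (simp add: \<xi>''_def)
  have "simple_value (paste_simple \<rho> d S S') t \<omega> =
      (\<Sum>i<Suc n + n'. if T'' i \<omega> < ?t \<and> ?t \<le> T'' (Suc i) \<omega> then \<xi>'' i \<omega> else 0)"
    unfolding S paste_simple_def simple_value_def prod.case T''_def \<xi>''_def ..
  then show ?thesis
    unfolding sum_lessThan_add sum.lessThan_Suc 1 2 3 by simp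
qed

lemma simple_integral_paste_simple:
  assumes mono: "simple_predictable M F S" and \<omega>: "\<omega> \<in> space M" and t: "0 \<le> t"
  shows "simple_integral W (paste_simple \<rho> d S S') t \<omega> =
    simple_integral W S (min_time (\<rho> \<omega>) t) \<omega> +
    d \<omega> * (simple_integral W S' t \<omega> - simple_integral W S' (min_time (\<rho> \<omega>) t) \<omega>)"
proof -
  obtain n T \<xi> n' T' \<xi>' where S: "S = (n, T, \<xi>)" "S' = (n', T', \<xi>')" by (cases S, cases S') auto
  have T: "T i \<omega> \<le> T (Suc i) \<omega>" if "i < n" for i
    using mono \<omega> that unfolding S simple_predictable_def by auto
  let ?r = "\<rho> \<omega>"
  have 1: "stopped W (\<lambda>\<omega>. min (T i \<omega>) (\<rho> \<omega>)) t \<omega> = stopped W (T i) (min_time ?r t) \<omega>" for i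
    using t by (simp add: stopped_def ennreal_min_time min.assoc)
  \<comment> \<open>The last summand is the same for all indices and cancels in the
    increments.\<close>
  have 2: "stopped W (\<lambda>\<omega>. max (T' i \<omega>) (\<rho> \<omega>)) t \<omega> =
      stopped W (T' i) t \<omega> - stopped W (T' i) (min_time ?r t) \<omega> + W (min_time ?r t) \<omega>" for i
    unfolding stopped_def ennreal_min_time[OF t] unfolding min_time_def
    by (cases "T' i \<omega> \<le> \<rho> \<omega>") (auto simp: max_def min_def)
  define T'' where "T'' i \<omega> = (if i \<le> n then min (T i \<omega>) (\<rho> \<omega>) else max (T' (i - Suc n) \<omega>) (\<rho> \<omega>))" for i \<omega>
  define \<xi>'' where "\<xi>'' i \<omega> = (if i < n then if T i \<omega> < \<rho> \<omega> then \<xi> i \<omega> else 0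
            else if i = n then 0 else d \<omega> * \<xi>' (i - Suc n) \<omega>)" for i \<omega>
  have head: "\<xi>'' i \<omega> * (stopped W (T'' (Suc i)) t \<omega> - stopped W (T'' i) t \<omega>) =
      \<xi> i \<omega> * (stopped W (T (Suc i)) (min_time ?r t) \<omega> - stopped W (T i) (min_time ?r t) \<omega>)"
    if i: "i < n" for i
  proof (cases "T i \<omega> < ?r")
    case False
    then show ?thesis using T[OF i] t i by (simp add: stopped_def ennreal_min_time \<xi>''_def min_absorb2 min.assoc[symmetric])
  qed (use i 1 in \<open>simp add: T''_def[abs_def] \<xi>''_def\<close>)
  have tail: "\<xi>'' (Suc n + i) \<omega> * (stopped W (T'' (Suc (Suc n + i))) t \<omega> - stopped W (T'' (Suc n + i)) t \<omega>) =
      d \<omega> * (\<xi>' i \<omega> * (stopped W (T' (Suc i)) t \<omega> - stopped W (T' i) t \<omega>) -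
        \<xi>' i \<omega> * (stopped W (T' (Suc i)) (min_time ?r t) \<omega> - stopped W (T' i) (min_time ?r t) \<omega>))" for i
    by (simp add: T''_def[abs_def] \<xi>''_def 2) (simp add: algebra_simps)
  have gap: "\<xi>'' n \<omega> = 0" by (simp add: \<xi>''_def)
  have "simple_integral W (paste_simple \<rho> d S S') t \<omega> =
      (\<Sum>i<Suc n + n'. \<xi>'' i \<omega> * (stopped W (T'' (Suc i)) t \<omega> - stopped W (T'' i) t \<omega>))"
    unfolding S paste_simple_def simple_integral_def prod.case T''_def[abs_def] \<xi>''_def ..
  also have "\<dots> = (\<Sum>i<n. \<xi> i \<omega> * (stopped W (T (Suc i)) (min_time ?r t) \<omega> - stopped W (T i) (min_time ?r t) \<omega>)) +
      (\<Sum>i<n'. d \<omega> * (\<xi>' i \<omega> * (stopped W (T' (Suc i)) t \<omega> - stopped W (T' i) t \<omega>) -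
        \<xi>' i \<omega> * (stopped W (T' (Suc i)) (min_time ?r t) \<omega> - stopped W (T' i) (min_time ?r t) \<omega>)))"
    unfolding sum_lessThan_add sum.lessThan_Suc gap tail by (simp add: head)
  finally show ?thesis
    by (simp add: S simple_integral_def sum_distrib_left sum_subtractf[symmetric] right_diff_distrib)
qed

lemma (in usual_filtration) simple_predictable_paste_simple:
  assumes S: "simple_predictable M F S" and S': "simple_predictable M F S'"
    and \<rho>: "stopping_time F \<rho>" and d: "d \<in> borel_measurable (pre_sigma \<rho>)"
  shows "simple_predictable M F (paste_simple \<rho> d S S')"
proof -
  obtain n T \<xi> n' T' \<xi>' where eq: "S = (n, T, \<xi>)" "S' = (n', T', \<xi>')" by (cases S, cases S') auto
  have T: "\<And>i. i \<le> n \<Longrightarrow> stopping_time F (T i)" "\<And>i \<omega>. i < n \<Longrightarrow> \<omega> \<in> space M \<Longrightarrow> T i \<omega> \<le> T (Suc i) \<omega>"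
    and \<xi>: "\<And>i. i < n \<Longrightarrow> \<xi> i \<in> borel_measurable (pre_sigma (T i))"
    using S unfolding eq simple_predictable_def by auto
  have T': "\<And>i. i \<le> n' \<Longrightarrow> stopping_time F (T' i)" "\<And>i \<omega>. i < n' \<Longrightarrow> \<omega> \<in> space M \<Longrightarrow> T' i \<omega> \<le> T' (Suc i) \<omega>"
    and \<xi>': "\<And>i. i < n' \<Longrightarrow> \<xi>' i \<in> borel_measurable (pre_sigma (T' i))"
    using S' unfolding eq simple_predictable_def by auto
  \<comment> \<open>\<open>\<xi> i\<close> is known only at \<open>T i\<close>, but the shortened
    interval may begin earlier, at \<open>\<rho>\<close>. In that case the interval is empty, and
    replacing the coefficient by 0 restores measurability.\<close>
  have head: "(\<lambda>\<omega>. if T i \<omega> < \<rho> \<omega> then \<xi> i \<omega> else 0) \<in> borel_measurable (pre_sigma (\<lambda>\<omega>. min (T i \<omega>) (\<rho> \<omega>)))"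
    if i: "i < n" for i
  proof -
    have Ti: "stopping_time F (T i)" using T i by simp
    have "(\<lambda>\<omega>. if T i \<omega> < \<rho> \<omega> then \<xi> i \<omega> else 0) \<in> borel_measurable (pre_sigma (T i))"
      using stopping_time_less[OF Ti \<rho>] \<xi>[OF i] by measurable
    note meas = pre_sigma_measurableD[OF Ti this]
    have "(\<lambda>\<omega>. if T i \<omega> \<le> t then if T i \<omega> < \<rho> \<omega> then \<xi> i \<omega> else 0 else 0) =
        (\<lambda>\<omega>. if min (T i \<omega>) (\<rho> \<omega>) \<le> t then if T i \<omega> < \<rho> \<omega> then \<xi> i \<omega> else 0 else 0)" for t
      by (auto simp: fun_eq_iff min_le_iff_disj)
    with meas show ?thesis
      unfolding borel_measurable_pre_sigma_iff[OF stopping_time_min[OF Ti \<rho>]] by simp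
  qed
  have tail: "(\<lambda>\<omega>. d \<omega> * \<xi>' i \<omega>) \<in> borel_measurable (pre_sigma (\<lambda>\<omega>. max (T' i \<omega>) (\<rho> \<omega>)))"
    if i: "i < n'" for i
  proof -
    have Ti: "stopping_time F (T' i)" using T' i by simp
    note st = stopping_time_max[OF Ti \<rho>]
    show ?thesis
      using measurable_pre_sigma_mono[OF Ti st _ \<xi>'[OF i]] measurable_pre_sigma_mono[OF \<rho> st _ d]
      by (intro borel_measurable_times) auto
  qed
  have order: "(if i \<le> n then min (T i \<omega>) (\<rho> \<omega>) else max (T' (i - Suc n) \<omega>) (\<rho> \<omega>)) \<le>
      (if Suc i \<le> n then min (T (Suc i) \<omega>) (\<rho> \<omega>) else max (T' (Suc i - Suc n) \<omega>) (\<rho> \<omega>))"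
    if i: "i < Suc n + n'" and \<omega>: "\<omega> \<in> space M" for i \<omega>
  proof -
    consider "i < n" | "i = n" | j where "i = Suc n + j" "j < n'"
      using i by (metis add_less_cancel_left less_Suc_eq_le less_imp_Suc_add linorder_neqE_nat add_Suc)
    then show ?thesis
    proof cases
      case 1 then show ?thesis using T(2)[OF 1 \<omega>] by (auto simp: min_le_iff_disj)
    next
      case 2 then show ?thesis by (auto simp: min_le_iff_disj le_max_iff_disj)
    next
      case 3 then show ?thesis using T'(2)[OF 3(2) \<omega>] by (auto simp: le_max_iff_disj)
    qed
  qed
  show ?thesis
    unfolding eq paste_simple_def simple_predictable_def prod.case
  proof (intro conjI allI impI ballI)
    fix i assume "i \<le> Suc n + n'"
    then show "stopping_time F (\<lambda>\<omega>. if i \<le> n then min (T i \<omega>) (\<rho> \<omega>) else max (T' (i - Suc n) \<omega>) (\<rho> \<omega>))"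
      using T(1)[of i] T'(1)[of "i - Suc n"] \<rho>
      by (cases "i \<le> n") (auto intro!: stopping_time_min stopping_time_max)
  next
    fix i assume i: "i < Suc n + n'"
    show "(\<lambda>\<omega>. if i < n then if T i \<omega> < \<rho> \<omega> then \<xi> i \<omega> else 0
            else if i = n then 0 else d \<omega> * \<xi>' (i - Suc n) \<omega>)
      \<in> borel_measurable (pre_sigma (\<lambda>\<omega>. if i \<le> n then min (T i \<omega>) (\<rho> \<omega>) else max (T' (i - Suc n) \<omega>) (\<rho> \<omega>)))"
    proof (cases "i \<le> n")
      case True
      then show ?thesis using head[of i] by (cases "i < n") auto
    next
      case False
      then show ?thesis using tail[of "i - Suc n"] i by auto
    qed
  qed (use order in auto)
qed

text \<open>A simple integrand admits only finitely many changes of the factor, so stage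
  \<open>m\<close> performs the first \<open>m\<close> of them. Later the diagonal sequence
  \<open>rescale_simple \<rho> d (S k) k\<close> lets the number of changes grow with the accuracy
  of \<open>S k\<close>.\<close>

primrec rescale_simple ::
    "(nat \<Rightarrow> 'a \<Rightarrow> ennreal) \<Rightarrow> (nat \<Rightarrow> 'a \<Rightarrow> real) \<Rightarrow> 'a simple_integrand \<Rightarrow> nat \<Rightarrow> 'a simple_integrand" where
  "rescale_simple \<rho> d S 0 = S"
| "rescale_simple \<rho> d S (Suc m) =
     paste_simple (\<rho> m) (\<lambda>\<omega>. 1 + (\<Sum>j\<le>m. d j \<omega>)) (rescale_simple \<rho> d S m) S"

lemma (in usual_filtration) simple_predictable_rescale_simple:
  assumes S: "simple_predictable M F S" and \<rho>: "\<And>n. stopping_time F (\<rho> n)"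
    and inc: "\<And>\<omega>. \<omega> \<in> space M \<Longrightarrow> incseq (\<lambda>n. \<rho> n \<omega>)"
    and d: "\<And>n. d n \<in> borel_measurable (pre_sigma (\<rho> n))"
  shows "simple_predictable M F (rescale_simple \<rho> d S m)"
proof (induction m)
  case (Suc m)
  have "d j \<in> borel_measurable (pre_sigma (\<rho> m))" if "j \<le> m" for j
    using that incseqD[OF inc, of _ j m] by (intro measurable_pre_sigma_mono[OF \<rho> \<rho> _ d]) auto
  then show ?case
    by (simp, intro simple_predictable_paste_simple Suc S \<rho> borel_measurable_add borel_measurable_const borel_measurable_sum) auto
qed (simp add: S)

lemma simple_value_rescale_simple:
  assumes inc: "incseq (\<lambda>n. \<rho> n \<omega>)"
  shows "simple_value (rescale_simple \<rho> d S m) t \<omega> =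
    (1 + (\<Sum>j<m. if \<rho> j \<omega> < ennreal t then d j \<omega> else 0)) * simple_value S t \<omega>"
proof (induction m)
  case (Suc m)
  have "\<rho> j \<omega> < ennreal t" if "\<rho> m \<omega> < ennreal t" "j < m" for j
    using incseqD[OF inc, of j m] that by auto
  then have "(\<Sum>j<m. if \<rho> j \<omega> < ennreal t then d j \<omega> else 0) = (\<Sum>j<m. d j \<omega>)" if "\<rho> m \<omega> < ennreal t"
    using that by (intro sum.cong) auto
  then show ?case
    by (simp add: simple_value_paste_simple Suc not_le[symmetric] lessThan_Suc_atMost[symmetric])
qed simp

lemma simple_integral_rescale_simple:
  assumes S: "\<And>m. simple_predictable M F (rescale_simple \<rho> d S m)"
    and inc: "incseq (\<lambda>n. \<rho> n \<omega>)" and \<omega>: "\<omega> \<in> space M" and t: "0 \<le> t"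
  shows "simple_integral W (rescale_simple \<rho> d S m) t \<omega> = simple_integral W S t \<omega> +
    (\<Sum>j<m. d j \<omega> * (simple_integral W S t \<omega> - simple_integral W S (min_time (\<rho> j \<omega>) t) \<omega>))"
  using t
proof (induction m arbitrary: t)
  case (Suc m)
  have *: "min_time (\<rho> j \<omega>) (min_time (\<rho> m \<omega>) t) = min_time (\<rho> j \<omega>) t" if "j < m" for j
  proof -
    have "min (\<rho> j \<omega>) (ennreal (min_time (\<rho> m \<omega>) t)) = min (\<rho> j \<omega>) (ennreal t)"
      using incseqD[OF inc, of j m] that Suc.prems
      by (auto simp: ennreal_min_time min.assoc[symmetric] min_absorb1)
    then show ?thesis by (simp add: min_time_def)
  qed
  show ?case
    using min_time_bounds[OF Suc.prems, of "\<rho> m \<omega>"]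
    by (simp add: simple_integral_paste_simple[OF S \<omega> Suc.prems] Suc.IH Suc.prems * 
        lessThan_Suc_atMost[symmetric] algebra_simps sum.distrib sum_subtractf sum_distrib_left sum_distrib_right)
qed simp

section \<open>Convergence of the rescaled approximations along a path\<close>

lemma uniform_limit_rescale:
  fixes J :: "nat \<Rightarrow> real \<Rightarrow> real" and I :: "real \<Rightarrow> real" and r :: "nat \<Rightarrow> ennreal" and d :: "nat \<Rightarrow> real"
  assumes J: "uniform_limit {0..t} J I sequentially" and cont: "continuous_on {0..t} I"
    and d: "summable (\<lambda>n. if r n \<le> ennreal t then \<bar>d n\<bar> else 0)" and t: "0 \<le> t"
  shows "uniform_limit {0..t} (\<lambda>m s. J m s + (\<Sum>j<m. d j * (J m s - J m (min_time (r j) s))))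
    (\<lambda>s. I s + (\<Sum>j. d j * (I s - I (min_time (r j) s)))) sequentially"
proof -
  define e where "e n = (if r n \<le> ennreal t then \<bar>d n\<bar> else 0)" for n
  have e: "summable e" "\<And>n. 0 \<le> e n" using d by (auto simp: e_def[abs_def])
  obtain B where B: "\<And>s. s \<in> {0..t} \<Longrightarrow> \<bar>I s\<bar> \<le> B"
    using compact_imp_bounded[OF compact_continuous_image[OF cont compact_Icc]]
    unfolding bounded_iff real_norm_def by blast
  have B0: "0 \<le> B" using B[of 0] t by (auto intro: order.trans[OF abs_ge_zero])
  define K where "K = suminf e"
  have K0: "0 \<le> K" unfolding K_def using e by (intro suminf_nonneg) auto
  \<comment> \<open>Summability is assumed only for indices with \<open>r j\<close> up to
    \<open>t\<close>; the others contribute nothing on \<open>{0..t}\<close>.\<close>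
  have vanish: "d j * (f s - f (min_time (r j) s)) = 0" if "\<not> r j \<le> ennreal t" "s \<in> {0..t}" for j s and f :: "real \<Rightarrow> real"
  proof -
    have "ennreal s \<le> ennreal t" using that(2) by (auto intro: ennreal_leI)
    then have "\<not> r j \<le> ennreal s" using that(1) by (meson order.trans)
    then show ?thesis using that by (simp add: min_time_eq)
  qed
  have bound: "\<bar>d j * (f s - f (min_time (r j) s))\<bar> \<le> e j * (2 * c)"
    if "\<And>s. s \<in> {0..t} \<Longrightarrow> \<bar>f s\<bar> \<le> c" "s \<in> {0..t}" for f :: "real \<Rightarrow> real" and c s j
  proof (cases "r j \<le> ennreal t")
    case True
    have "min_time (r j) s \<in> {0..t}" using min_time_bounds[of s "r j"] that(2) by auto
    then have "\<bar>f s - f (min_time (r j) s)\<bar> \<le> 2 * c" using that(1)[of s] that(1)[of "min_time (r j) s"] that(2) by auto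
    then show ?thesis using True by (simp add: e_def abs_mult mult_left_mono)
  next
    case False
    then show ?thesis using vanish[OF False that(2), of f] by (simp add: e_def)
  qed
  show ?thesis
  proof (rule uniform_limitI)
    fix \<epsilon> :: real assume \<epsilon>: "0 < \<epsilon>"
    \<comment> \<open>The leading term and the first \<open>m\<close> summands together err by at
      most \<open>\<delta> * (1 + 2 * K)\<close>, half of \<open>\<epsilon>\<close>; the other half
      is left for the tail of the series.\<close>
    define \<delta> where "\<delta> = \<epsilon> / 2 / (1 + 2 * K)"
    have \<delta>: "0 < \<delta>" using \<epsilon> K0 by (simp add: \<delta>_def)
    have ev1: "\<forall>\<^sub>F m in sequentially. \<forall>s\<in>{0..t}. dist (J m s) (I s) < \<delta>"
      using J \<delta> by (auto simp: uniform_limit_iff)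
    have "(\<lambda>m. (\<Sum>n. e (n + m)) * (2 * B)) \<longlonglongrightarrow> 0 * (2 * B)"
      by (intro tendsto_mult suminf_exist_split2[OF e(1)] tendsto_const)
    then have ev2: "\<forall>\<^sub>F m in sequentially. (\<Sum>n. e (n + m)) * (2 * B) < \<epsilon> / 2"
      using \<epsilon> by (intro order_tendstoD(2)[of _ "0 * (2 * B)"]) auto
    show "\<forall>\<^sub>F m in sequentially. \<forall>s\<in>{0..t}.
        dist (J m s + (\<Sum>j<m. d j * (J m s - J m (min_time (r j) s))))
          (I s + (\<Sum>j. d j * (I s - I (min_time (r j) s)))) < \<epsilon>"
      using ev1 ev2
    proof eventually_elim
      case (elim m)
      show ?case
      proof
        fix s assume s: "s \<in> {0..t}"
        define u where "u j = d j * (I s - I (min_time (r j) s))" for j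
        define v where "v j = d j * (J m s - J m (min_time (r j) s))" for j
        have su: "summable (\<lambda>j. \<bar>u j\<bar>)"
          by (rule summable_comparison_test'[of "\<lambda>j. e j * (2 * B)"])
             (use bound[of I B s, OF B s] e in \<open>auto simp: u_def intro!: summable_mult2\<close>)
        have "suminf u = (\<Sum>j. u (j + m)) + (\<Sum>j<m. u j)"
          by (rule suminf_split_initial_segment[OF summable_rabs_cancel[OF su]])
        moreover have "\<bar>\<Sum>j. u (j + m)\<bar> \<le> (\<Sum>j. e (j + m) * (2 * B))"
        proof -
          have sm: "summable (\<lambda>j. e (j + m) * (2 * B))" by (intro summable_mult2 summable_ignore_initial_segment e)
          have "\<bar>\<Sum>j. u (j + m)\<bar> \<le> (\<Sum>j. \<bar>u (j + m)\<bar>)"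
            by (intro summable_rabs) (rule summable_ignore_initial_segment[OF su])
          also have "\<dots> \<le> (\<Sum>j. e (j + m) * (2 * B))"
            by (intro suminf_le sm summable_ignore_initial_segment[OF su]) (use bound[of I B s, OF B s] in \<open>auto simp: u_def\<close>)
          finally show ?thesis .
        qed
        moreover have "(\<Sum>j. e (j + m) * (2 * B)) = (\<Sum>j. e (j + m)) * (2 * B)"
          by (intro suminf_mult2[symmetric] summable_ignore_initial_segment e)
        moreover have "\<bar>(\<Sum>j<m. v j) - (\<Sum>j<m. u j)\<bar> \<le> K * (2 * \<delta>)"
        proof -
          have "\<bar>v j - u j\<bar> \<le> e j * (2 * \<delta>)" for j
            using bound[of "\<lambda>s. J m s - I s" \<delta> s j] elim(1) s
            by (auto simp: u_def v_def dist_real_def algebra_simps less_imp_le)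
          then have "\<bar>\<Sum>j<m. v j - u j\<bar> \<le> (\<Sum>j<m. e j * (2 * \<delta>))"
            by (intro order.trans[OF sum_abs] sum_mono)
          also have "\<dots> = (\<Sum>j<m. e j) * (2 * \<delta>)" by (simp add: sum_distrib_right)
          also have "\<dots> \<le> K * (2 * \<delta>)"
            unfolding K_def using e \<delta> by (intro mult_right_mono sum_le_suminf) auto
          finally show ?thesis by (simp add: sum_subtractf)
        qed
        moreover have "\<bar>J m s - I s\<bar> < \<delta>" using elim(1) s by (auto simp: dist_real_def)
        ultimately have "\<bar>(J m s + (\<Sum>j<m. v j)) - (I s + suminf u)\<bar> < \<delta> + K * (2 * \<delta>) + \<epsilon> / 2"
          using elim(2) by linarith
        also have "\<delta> + K * (2 * \<delta>) = \<epsilon> / 2"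
        proof -
          have "1 + 2 * K \<noteq> 0" using K0 by simp
          then have "\<delta> * (1 + 2 * K) = \<epsilon> / 2" unfolding \<delta>_def by (rule nonzero_eq_divide_eq[THEN iffD1, OF _ refl])
          then show ?thesis by (simp add: algebra_simps)
        qed
        finally show "dist (J m s + (\<Sum>j<m. d j * (J m s - J m (min_time (r j) s))))
            (I s + (\<Sum>j. d j * (I s - I (min_time (r j) s)))) < \<epsilon>"
          unfolding dist_real_def u_def v_def by simp
      qed
    qed
  qed
qed

lemma simple_value_bounded: "\<exists>C. \<forall>s. \<bar>simple_value S s \<omega>\<bar> \<le> C"
proof -
  obtain n T \<xi> where S: "S = (n, T, \<xi>)" by (cases S)
  have "\<bar>simple_value S s \<omega>\<bar> \<le> (\<Sum>i<n. \<bar>\<xi> i \<omega>\<bar>)" for s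
    unfolding S simple_value_def by (auto intro!: order.trans[OF sum_abs] sum_mono)
  then show ?thesis by blast
qed

lemma measurable_simple_value [measurable]: "(\<lambda>s. simple_value S s \<omega>) \<in> borel_measurable borel"
  by (cases S) (simp add: simple_value_def)

text \<open>The error splits into the factor times \<open>f m - H\<close>, where the factor is
  bounded by \<open>1 + K\<close>, and the error of the factor times \<open>H\<close>, where the
  former is bounded by the tail of the summable jumps and the latter has finite norm on
  \<open>{0..t}\<close>.\<close>

lemma tendsto_L2_rescale:
  fixes f :: "nat \<Rightarrow> real \<Rightarrow> real" and H :: "real \<Rightarrow> real" and r :: "nat \<Rightarrow> ennreal" and d :: "nat \<Rightarrow> real"
  assumes lim: "(\<lambda>m. \<integral>\<^sup>+ s\<in>{0..t}. ennreal ((f m s - H s)\<^sup>2) \<partial>lborel) \<longlonglongrightarrow> 0"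
    and f: "\<And>m. f m \<in> borel_measurable borel" "\<And>m. \<exists>C. \<forall>s. \<bar>f m s\<bar> \<le> C"
    and H: "set_borel_measurable lborel {0..} H"
    and d: "summable (\<lambda>n. if r n \<le> ennreal t then \<bar>d n\<bar> else 0)" and t: "0 \<le> t"
  shows "(\<lambda>m. \<integral>\<^sup>+ s\<in>{0..t}. ennreal (((1 + (\<Sum>j<m. if r j < ennreal s then d j else 0)) * f m s -
      (1 + (\<Sum>j. if r j \<le> ennreal s then d j else 0)) * H s)\<^sup>2) \<partial>lborel) \<longlonglongrightarrow> 0"
proof -
  define G where "G s = indicator {0..} s * H s" for s
  have [measurable]: "G \<in> borel_measurable borel"
    using H unfolding set_borel_measurable_def G_def[abs_def] by simp
  note [measurable] = f(1)
  define e where "e n = (if r n \<le> ennreal t then \<bar>d n\<bar> else 0)" for n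
  have e: "summable e" "\<And>n. 0 \<le> e n" using d by (auto simp: e_def[abs_def])
  define K where "K = suminf e"
  have K0: "0 \<le> K" unfolding K_def using e by (intro suminf_nonneg) auto
  define c where "c m s = 1 + (\<Sum>j<m. if r j < ennreal s then d j else 0)" for m s
  define c' where "c' s = 1 + (\<Sum>j. if r j \<le> ennreal s then d j else 0)" for s
  define D where "D m = (\<integral>\<^sup>+ s\<in>{0..t}. ennreal ((f m s - G s)\<^sup>2) \<partial>lborel)" for m
  have D: "D \<longlonglongrightarrow> 0"
  proof -
    have "D m = (\<integral>\<^sup>+ s\<in>{0..t}. ennreal ((f m s - H s)\<^sup>2) \<partial>lborel)" for m
      unfolding D_def by (intro nn_integral_cong) (auto simp: G_def indicator_def)
    then have "D = (\<lambda>m. \<integral>\<^sup>+ s\<in>{0..t}. ennreal ((f m s - H s)\<^sup>2) \<partial>lborel)" by (rule ext)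
    then show ?thesis using lim by simp
  qed
  define L where "L = (\<integral>\<^sup>+ s\<in>{0..t}. ennreal ((G s)\<^sup>2) \<partial>lborel)"
  \<comment> \<open>Square integrability of the limit is not among the assumptions. It follows
    because some \<open>D m\<close> is finite and \<open>f m\<close> is bounded on a bounded
    interval.\<close>
  have L: "L < \<infinity>"
  proof -
    have "eventually (\<lambda>m. D m < \<infinity>) sequentially" using D by (intro order_tendstoD) auto
    then obtain m where m: "D m < \<infinity>" by (auto simp: eventually_sequentially)
    obtain C where C: "\<And>s. \<bar>f m s\<bar> \<le> C" using f(2) by blast
    have "(G s)\<^sup>2 \<le> 2 * (f m s - G s)\<^sup>2 + 2 * C\<^sup>2" for s
    proof -
      have "(f m s)\<^sup>2 \<le> C\<^sup>2" using C[of s] by (simp add: abs_le_square_iff[symmetric])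
      moreover have "(G s)\<^sup>2 \<le> 2 * (f m s - G s)\<^sup>2 + 2 * (f m s)\<^sup>2"
        using zero_le_power2[of "2 * f m s - G s"] by (simp add: power2_eq_square algebra_simps)
      ultimately show ?thesis by simp
    qed
    then have "L \<le> (\<integral>\<^sup>+ s. 2 * (ennreal ((f m s - G s)\<^sup>2) * indicator {0..t} s) + ennreal (2 * C\<^sup>2) * indicator {0..t} s \<partial>lborel)"
      unfolding L_def by (intro nn_integral_mono)
         (auto simp: indicator_def ennreal_mult[symmetric] ennreal_plus[symmetric] ennreal_numeral[symmetric] simp del: ennreal_plus ennreal_numeral intro!: ennreal_leI)
    also have "\<dots> = 2 * D m + ennreal (2 * C\<^sup>2) * ennreal t"
      unfolding D_def using t by (subst nn_integral_add) (auto simp: nn_integral_cmult nn_integral_cmult_indicator)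
    also have "\<dots> < \<infinity>" using m by (simp add: ennreal_mult_less_top)
    finally show ?thesis .
  qed
  define tail where "tail m = (\<Sum>n. e (n + m))" for m
  have tail0: "0 \<le> tail m" for m unfolding tail_def using e by (intro suminf_nonneg summable_ignore_initial_segment) auto
  have tail: "tail \<longlonglongrightarrow> 0" unfolding tail_def by (rule suminf_exist_split2[OF e(1)])
  \<comment> \<open>Simple integrands are left continuous, so the finite sums test \<open><\<close>,
    whereas the right-continuous factor tests \<open>\<le>\<close>. The two agree off the countable
    set of jump times.\<close>
  have AE: "AE s in lborel. s \<notin> (\<lambda>j. enn2real (r j)) ` UNIV"
    by (intro AE_not_in countable_imp_null_set_lborel) auto
  have est: "((c m s * f m s - c' s * H s)\<^sup>2) \<le> 2 * (1 + K)\<^sup>2 * (f m s - G s)\<^sup>2 + 2 * (tail m)\<^sup>2 * (G s)\<^sup>2"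
    if s: "s \<in> {0..t}" "s \<notin> (\<lambda>j. enn2real (r j)) ` UNIV" for m s
  proof -
    have G: "G s = H s" using s by (auto simp: G_def)
    have rs: "r j < ennreal s \<longleftrightarrow> r j \<le> ennreal s" for j
    proof -
      have "r j \<noteq> ennreal s" using s by (metis atLeastAtMost_iff enn2real_ennreal rangeI)
      then show ?thesis by (simp add: less_le)
    qed
    define u where "u j = (if r j \<le> ennreal s then d j else 0)" for j
    have u: "\<bar>u j\<bar> \<le> e j" for j
    proof -
      have "ennreal s \<le> ennreal t" using s by (auto intro: ennreal_leI)
      then show ?thesis by (auto simp: u_def e_def intro: order.trans)
    qed
    have su: "summable (\<lambda>j. \<bar>u j\<bar>)"
      by (rule summable_comparison_test'[OF e(1)]) (use u in auto)
    have "c' s - c m s = (\<Sum>j. u (j + m))"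
      unfolding c'_def c_def rs u_def[symmetric]
      using suminf_split_initial_segment[OF summable_rabs_cancel[OF su], of m] by simp
    moreover have "\<bar>\<Sum>j. u (j + m)\<bar> \<le> tail m"
    proof -
      have "\<bar>\<Sum>j. u (j + m)\<bar> \<le> (\<Sum>j. \<bar>u (j + m)\<bar>)"
        by (intro summable_rabs) (rule summable_ignore_initial_segment[OF su])
      also have "\<dots> \<le> tail m"
        unfolding tail_def
        by (intro suminf_le summable_ignore_initial_segment[OF su] summable_ignore_initial_segment[OF e(1)] u)
      finally show ?thesis .
    qed
    ultimately have 1: "\<bar>c m s - c' s\<bar> \<le> tail m" by linarith
    have 2: "\<bar>c m s\<bar> \<le> 1 + K"
    proof -
      have "\<bar>\<Sum>j<m. u j\<bar> \<le> (\<Sum>j<m. e j)" by (intro order.trans[OF sum_abs] sum_mono u)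
      also have "\<dots> \<le> K" unfolding K_def using e by (intro sum_le_suminf) auto
      finally show ?thesis unfolding c_def rs u_def[symmetric] by linarith
    qed
    let ?a = "c m s * (f m s - G s)" and ?b = "(c m s - c' s) * G s"
    have "(c m s * f m s - c' s * H s)\<^sup>2 = (?a + ?b)\<^sup>2" by (simp add: G algebra_simps)
    also have "\<dots> \<le> 2 * ?a\<^sup>2 + 2 * ?b\<^sup>2"
      using zero_le_power2[of "?a - ?b"] by (simp add: power2_sum power2_diff)
    also have "?a\<^sup>2 \<le> (1 + K)\<^sup>2 * (f m s - G s)\<^sup>2"
      unfolding power_mult_distrib using 2 by (intro mult_right_mono) (auto simp: abs_le_square_iff[symmetric])
    also have "?b\<^sup>2 \<le> (tail m)\<^sup>2 * (G s)\<^sup>2"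
      unfolding power_mult_distrib using 1 tail0[of m] by (intro mult_right_mono) (auto simp: abs_le_square_iff[symmetric])
    finally show ?thesis by simp
  qed
  have upper: "(\<integral>\<^sup>+ s\<in>{0..t}. ennreal ((c m s * f m s - c' s * H s)\<^sup>2) \<partial>lborel) \<le>
      ennreal (2 * (1 + K)\<^sup>2) * D m + L * ennreal (2 * (tail m)\<^sup>2)" for m
  proof -
    have "(\<integral>\<^sup>+ s\<in>{0..t}. ennreal ((c m s * f m s - c' s * H s)\<^sup>2) \<partial>lborel) \<le>
       (\<integral>\<^sup>+ s. ennreal (2 * (1 + K)\<^sup>2) * (ennreal ((f m s - G s)\<^sup>2) * indicator {0..t} s) +
          ennreal (2 * (tail m)\<^sup>2) * (ennreal ((G s)\<^sup>2) * indicator {0..t} s) \<partial>lborel)"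
      using AE
    proof (intro nn_integral_mono_AE, eventually_elim)
      case (elim s)
      show ?case
      proof (cases "s \<in> {0..t}")
        case True
        from ennreal_leI[OF est[OF True elim(2), of m]] show ?thesis
          using True by (simp add: ennreal_mult)
      qed simp
    qed
    also have "\<dots> = ennreal (2 * (1 + K)\<^sup>2) * D m + L * ennreal (2 * (tail m)\<^sup>2)"
      unfolding D_def L_def by (subst nn_integral_add) (auto simp: nn_integral_cmult mult.commute)
    finally show ?thesis .
  qed
  have "(\<lambda>m. ennreal (2 * (1 + K)\<^sup>2) * D m + L * ennreal (2 * (tail m)\<^sup>2)) \<longlonglongrightarrow>
      ennreal (2 * (1 + K)\<^sup>2) * 0 + L * ennreal (2 * 0\<^sup>2)"
    using L by (intro tendsto_intros ennreal_tendsto_cmult tendsto_ennrealI tail D) auto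
  then have lim: "(\<lambda>m. ennreal (2 * (1 + K)\<^sup>2) * D m + L * ennreal (2 * (tail m)\<^sup>2)) \<longlonglongrightarrow> 0" by simp
  have "(\<lambda>m. \<integral>\<^sup>+ s\<in>{0..t}. ennreal ((c m s * f m s - c' s * H s)\<^sup>2) \<partial>lborel) \<longlonglongrightarrow> 0"
    by (rule tendsto_sandwich[OF _ _ tendsto_const[of 0] lim])
       (intro always_eventually allI zero_le, intro always_eventually allI upper)
  then show ?thesis
    unfolding c_def c'_def .
qed

lemma min_time_alt: "0 \<le> t \<Longrightarrow> min_time r t = (if r = \<top> then t else min (enn2real r) t)"
  by (cases r) (auto simp: min_time_def min_def top_unique)

lemma continuous_on_min_time: "continuous_on {0..} (min_time r)"
proof -
  have "continuous_on {0..} (\<lambda>t. if r = \<top> then t else min (enn2real r) t)"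
    by (cases "r = \<top>") (auto intro!: continuous_intros)
  then show ?thesis
    by (rule continuous_on_eq) (simp add: min_time_alt)
qed

lemma continuous_on_simple_integral:
  assumes W: "continuous_on {0..} (\<lambda>t. W t \<omega>)"
  shows "continuous_on {0..} (\<lambda>t. simple_integral W S t \<omega>)"
proof -
  obtain n T \<xi> where S: "S = (n, T, \<xi>)" by (cases S)
  have "continuous_on {0..} (\<lambda>t. W (min_time r t) \<omega>)" for r
    by (rule continuous_on_compose2[OF W continuous_on_min_time]) (auto simp: min_time_bounds)
  then show ?thesis
    unfolding S simple_integral_def stopped_def min_time_def[symmetric] prod.case
    by (intro continuous_intros)
qed

lemma continuous_on_atLeastI:
  fixes f :: "real \<Rightarrow> 'b::topological_space"
  assumes "\<And>t. 0 \<le> t \<Longrightarrow> continuous_on {0..t} f"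
  shows "continuous_on {0..} f"
  unfolding continuous_on_eq_continuous_within
proof
  fix s :: real assume s: "s \<in> {0..}"
  have "continuous (at s within {0..s+1}) f"
    using assms[of "s + 1"] s by (auto simp: continuous_on_eq_continuous_within)
  moreover have "at s within {0..s+1} = at s within {0..}"
    by (rule at_within_nhd[of _ "{..<s+1}"]) auto
  ultimately show "continuous (at s within {0..}) f" by (simp add: continuous_within)
qed

context usual_filtration
begin

text \<open>The Ito integral is almost surely a locally uniform limit of continuous paths that start
  at 0. Setting it to 0 on the exceptional null set makes this true for every outcome, as sampling
  at stopping times requires.\<close>

lemma gbm_equation_integralE:
  assumes W: "AE \<omega> in M. continuous_on {0..} (\<lambda>t. W t \<omega>)"
    and eq: "gbm_equation M F W \<mu> \<sigma> x\<^sub>0 A X"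
  obtains I where "ito_integral M F W (\<lambda>s \<omega>. \<sigma> * X s \<omega>) I"
    and "\<forall>\<omega>\<in>space M. continuous_on {0..} (\<lambda>t. I t \<omega>) \<and> I 0 \<omega> = 0"
    and "AE \<omega> in M. \<forall>t\<ge>0. set_integrable lborel {0..t} (\<lambda>s. X s \<omega>) \<and>
           X t \<omega> = x\<^sub>0 - (LINT s:{0..t}|lborel. \<mu> * X s \<omega>) + I t \<omega> + A t \<omega>"
proof -
  obtain I0 where I0: "ito_integral M F W (\<lambda>s \<omega>. \<sigma> * X s \<omega>) I0"
    and eq0: "AE \<omega> in M. \<forall>t\<ge>0. set_integrable lborel {0..t} (\<lambda>s. X s \<omega>) \<and>
           X t \<omega> = x\<^sub>0 - (LINT s:{0..t}|lborel. \<mu> * X s \<omega>) + I0 t \<omega> + A t \<omega>"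
    using eq unfolding gbm_equation_def by blast
  obtain S where ad: "adapted F (\<lambda>s \<omega>. \<sigma> * X s \<omega>)" "adapted F I0"
    and mb: "AE \<omega> in M. set_borel_measurable lborel {0..} (\<lambda>s. \<sigma> * X s \<omega>)"
    and S: "\<And>m. simple_predictable M F (S m)"
    and lim: "AE \<omega> in M. \<forall>t\<ge>0.
       (\<lambda>m. \<integral>\<^sup>+ s\<in>{0..t}. ennreal ((simple_value (S m) s \<omega> - \<sigma> * X s \<omega>)\<^sup>2) \<partial>lborel) \<longlonglongrightarrow> 0 \<and>
       uniform_limit {0..t} (\<lambda>m s. simple_integral W (S m) s \<omega>) (\<lambda>s. I0 s \<omega>) sequentially"
    using I0 unfolding ito_integral_def by auto
  have "AE \<omega> in M. continuous_on {0..} (\<lambda>t. I0 t \<omega>) \<and> I0 0 \<omega> = 0"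
    using W lim
  proof eventually_elim
    case (elim \<omega>)
    have "continuous_on {0..t} (\<lambda>t. I0 t \<omega>)" if "0 \<le> t" for t
    proof (rule uniform_limit_theorem)
      show "\<forall>\<^sub>F m in sequentially. continuous_on {0..t} (\<lambda>s. simple_integral W (S m) s \<omega>)"
        by (intro always_eventually allI continuous_on_subset[OF continuous_on_simple_integral[where W=W and \<omega>=\<omega>, OF elim(1)]]) auto
    qed (use elim(2) that in auto)
    moreover have "(\<lambda>m. simple_integral W (S m) 0 \<omega>) \<longlonglongrightarrow> I0 0 \<omega>"
      by (rule tendsto_uniform_limitI[where S="{0..0}"]) (use elim(2) in auto)
    moreover have "simple_integral W (S m) 0 \<omega> = 0" for m
      by (cases "S m") (simp add: simple_integral_def stopped_def)
    ultimately show ?case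
      using LIMSEQ_unique tendsto_const by (auto intro!: continuous_on_atLeastI) blast
  qed
  then obtain N where N: "N \<in> null_sets M"
      "\<And>\<omega>. \<omega> \<in> space M - N \<Longrightarrow> continuous_on {0..} (\<lambda>t. I0 t \<omega>) \<and> I0 0 \<omega> = 0"
    by (auto elim!: AE_E3)
  define I where "I t \<omega> = (if \<omega> \<in> N then 0 else I0 t \<omega>)" for t \<omega>
  have AEN: "AE \<omega> in M. \<forall>t. I t \<omega> = I0 t \<omega>"
    using AE_not_in[OF N(1)] by eventually_elim (simp add: I_def)
  show ?thesis
  proof
    show "\<forall>\<omega>\<in>space M. continuous_on {0..} (\<lambda>t. I t \<omega>) \<and> I 0 \<omega> = 0"
    proof
      fix \<omega> assume "\<omega> \<in> space M"
      then show "continuous_on {0..} (\<lambda>t. I t \<omega>) \<and> I 0 \<omega> = 0"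
        using N(2)[of \<omega>] by (cases "\<omega> \<in> N") (simp_all add: I_def)
    qed
    show "ito_integral M F W (\<lambda>s \<omega>. \<sigma> * X s \<omega>) I"
      unfolding ito_integral_def
    proof (intro conjI exI[of _ S] allI S ad mb)
      show "adapted F I"
        unfolding adapted_def
      proof (intro allI impI)
        fix t :: real assume "0 \<le> t"
        then show "I t \<in> borel_measurable (F (ennreal t))"
          by (intro measurable_F_AE_cong[OF adaptedD[OF ad(2), of t "ennreal t"]])
             (use AEN in \<open>auto elim: eventually_mono\<close>)
      qed
      show "AE \<omega> in M. \<forall>t\<ge>0.
       (\<lambda>m. \<integral>\<^sup>+ s\<in>{0..t}. ennreal ((simple_value (S m) s \<omega> - \<sigma> * X s \<omega>)\<^sup>2) \<partial>lborel) \<longlonglongrightarrow> 0 \<and>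
       uniform_limit {0..t} (\<lambda>m s. simple_integral W (S m) s \<omega>) (\<lambda>s. I s \<omega>) sequentially"
        using lim AEN by eventually_elim simp
    qed
    show "AE \<omega> in M. \<forall>t\<ge>0. set_integrable lborel {0..t} (\<lambda>s. X s \<omega>) \<and>
           X t \<omega> = x\<^sub>0 - (LINT s:{0..t}|lborel. \<mu> * X s \<omega>) + I t \<omega> + A t \<omega>"
      using eq0 AEN by eventually_elim simp
  qed
qed

end

text \<open>Jump \<open>n\<close> of the factor contributes \<open>d n\<close> times the integral
  over the part of \<open>{0..t}\<close> after \<open>r n\<close>. Absolute summability of the jumps
  allows series and integral to be exchanged.\<close>

lemma set_integral_rescale:
  fixes x :: "real \<Rightarrow> real" and r :: "nat \<Rightarrow> ennreal" and d :: "nat \<Rightarrow> real"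
  assumes x: "set_integrable lborel {0..t} x" and t: "0 \<le> t"
    and d: "summable (\<lambda>n. if r n \<le> ennreal t then \<bar>d n\<bar> else 0)"
  defines "m s \<equiv> 1 + (\<Sum>n. if r n \<le> ennreal s then d n else 0)"
  defines "\<Xi> u \<equiv> (LINT s:{0..u}|lborel. x s)"
  shows "set_integrable lborel {0..t} (\<lambda>s. m s * x s)"
    and "(LINT s:{0..t}|lborel. m s * x s) = \<Xi> t + (\<Sum>n. if r n \<le> ennreal t then d n * (\<Xi> t - \<Xi> (enn2real (r n))) else 0)"
proof -
  define e where "e n = (if r n \<le> ennreal t then \<bar>d n\<bar> else 0)" for n
  have e: "summable e" "\<And>n. 0 \<le> e n" using d by (auto simp: e_def[abs_def])
  define g where "g s = indicator {0..t} s * x s" for s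
  have g: "integrable lborel g" using x by (simp add: set_integrable_def g_def[abs_def])
  have g': "integrable lborel (\<lambda>s. indicator B s * g s)" if "B \<in> sets borel" for B
    using integrable_mult_indicator[of B lborel g] that g by simp
  define f where "f n s = (if r n \<le> ennreal t then d n * (g s - indicator {..<enn2real (r n)} s * g s) else 0)" for n s
  have f_eq: "f n s = (if r n \<le> ennreal s then d n else 0) * g s" if "s \<in> {0..t}" for n s
  proof (cases "r n")
    case (real q)
    then show ?thesis using that by (auto simp: f_def indicator_def)
  qed (auto simp: f_def top_unique)
  have f_abs: "\<bar>f n s\<bar> \<le> e n * \<bar>g s\<bar>" for n s
    by (auto simp: f_def e_def abs_mult indicator_def mult_nonneg_nonneg)
  have f_int: "integrable lborel (f n)" for n
    unfolding f_def[abs_def] using g g'[of "{..<enn2real (r n)}"] by (cases "r n \<le> ennreal t") auto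
  have sf: "summable (\<lambda>n. norm (f n s))" for s
    by (rule summable_comparison_test'[of "\<lambda>n. e n * \<bar>g s\<bar>"]) (use f_abs e in \<open>auto intro!: summable_mult2\<close>)
  have sI: "summable (\<lambda>n. \<integral>s. norm (f n s) \<partial>lborel)"
  proof (rule summable_comparison_test')
    show "summable (\<lambda>n. e n * (\<integral>s. \<bar>g s\<bar> \<partial>lborel))" using e by (intro summable_mult2)
    fix n
    have "(\<integral>s. norm (f n s) \<partial>lborel) \<le> (\<integral>s. e n * \<bar>g s\<bar> \<partial>lborel)"
      using f_abs f_int[of n] g by (intro integral_mono) auto
    then show "norm (\<integral>s. norm (f n s) \<partial>lborel) \<le> e n * (\<integral>s. \<bar>g s\<bar> \<partial>lborel)"
      by simp
  qed
  have pw: "indicator {0..t} s * (m s * x s) = g s + (\<Sum>n. f n s)" for s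
  proof (cases "s \<in> {0..t}")
    case True
    have "ennreal s \<le> ennreal t" using True by (auto intro: ennreal_leI)
    then have "summable (\<lambda>n. if r n \<le> ennreal s then d n else 0)"
      by (intro summable_comparison_test'[OF e(1)]) (auto simp: e_def intro: order.trans)
    then have "(\<Sum>n. f n s) = (\<Sum>n. if r n \<le> ennreal s then d n else 0) * g s"
      unfolding f_eq[OF True] by (rule suminf_mult2[symmetric])
    then show ?thesis using True by (simp add: m_def g_def algebra_simps)
  next
    case False
    then have "g s = 0" by (simp add: g_def)
    then have "f n s = 0" for n by (auto simp: f_def)
    then show ?thesis using False \<open>g s = 0\<close> by simp
  qed
  show "set_integrable lborel {0..t} (\<lambda>s. m s * x s)"
    unfolding set_integrable_def real_scaleR_def pw
    by (intro Bochner_Integration.integrable_add g integrable_suminf f_int AE_I2 sf sI)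
  have \<Xi>: "\<Xi> u = (\<integral>s. indicator {..u} s * g s \<partial>lborel)" if "u \<in> {0..t}" for u
    unfolding \<Xi>_def set_lebesgue_integral_def
    by (intro Bochner_Integration.integral_cong) (use that in \<open>auto simp: g_def indicator_def\<close>)
  have \<Xi>': "\<Xi> u = (\<integral>s. indicator {..<u} s * g s \<partial>lborel)" if "u \<in> {0..t}" for u
    unfolding \<Xi>[OF that]
  proof (rule integral_cong_AE)
    show "AE s in lborel. indicator {..u} s * g s = indicator {..<u} s * g s"
      using AE_lborel_singleton[of u] by eventually_elim (simp add: indicator_def less_le)
  qed (use g' in \<open>auto intro!: borel_measurable_integrable\<close>)
  have \<Xi>t: "\<Xi> t = (\<integral>s. g s \<partial>lborel)"
    unfolding \<Xi>_def set_lebesgue_integral_def by (simp add: g_def)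
  have f_integral: "(\<integral>s. f n s \<partial>lborel) = (if r n \<le> ennreal t then d n * (\<Xi> t - \<Xi> (enn2real (r n))) else 0)" for n
  proof (cases "r n \<le> ennreal t")
    case True
    then have "enn2real (r n) \<in> {0..t}" using t by (auto intro: enn2real_leI)
    then show ?thesis
      using True g g'[of "{..<enn2real (r n)}"] by (simp add: f_def \<Xi>' \<Xi>t)
  qed (simp add: f_def)
  have "(LINT s:{0..t}|lborel. m s * x s) = (\<integral>s. g s + (\<Sum>n. f n s) \<partial>lborel)"
    unfolding set_lebesgue_integral_def real_scaleR_def pw ..
  also have "\<dots> = \<Xi> t + (\<Sum>n. \<integral>s. f n s \<partial>lborel)"
    unfolding \<Xi>t
    by (subst Bochner_Integration.integral_add)
       (auto intro!: g integrable_suminf integral_suminf f_int AE_I2 sf sI)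
  finally show "(LINT s:{0..t}|lborel. m s * x s) =
      \<Xi> t + (\<Sum>n. if r n \<le> ennreal t then d n * (\<Xi> t - \<Xi> (enn2real (r n))) else 0)"
    by (simp add: f_integral)
qed

text \<open>This is integration by parts. \<open>X - A\<close> is continuous and \<open>m\<close> is
  a pure jump process, so \<open>m * (X - A)\<close> is the sum of \<open>x\<^sub>0\<close>, the
  integral of \<open>m\<close> against \<open>X - A\<close>, and the jumps \<open>d n\<close> of
  \<open>m\<close> times \<open>X - A\<close> at \<open>\<rho> n\<close>. Moving
  \<open>m * A\<close> to the right gives the new order term.\<close>

lemma (in usual_filtration) gbm_equation_rescale:
  assumes W: "AE \<omega> in M. continuous_on {0..} (\<lambda>t. W t \<omega>)"
    and eq: "gbm_equation M F W \<mu> \<sigma> x\<^sub>0 A X"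
    and \<rho>: "\<And>n. stopping_time F (\<rho> n)" and inc: "\<And>\<omega>. \<omega> \<in> space M \<Longrightarrow> incseq (\<lambda>n. \<rho> n \<omega>)"
    and d: "\<And>n. d n \<in> borel_measurable (pre_sigma (\<rho> n))"
    and summ: "AE \<omega> in M. \<forall>t\<ge>0. summable (\<lambda>n. if \<rho> n \<omega> \<le> ennreal t then \<bar>d n \<omega>\<bar> else 0)"
  defines "m \<equiv> \<lambda>t \<omega>. 1 + (\<Sum>n. if \<rho> n \<omega> \<le> ennreal t then d n \<omega> else 0)"
  shows "gbm_equation M F W \<mu> \<sigma> x\<^sub>0
    (\<lambda>t \<omega>. m t \<omega> * A t \<omega> + (\<Sum>n. if \<rho> n \<omega> \<le> ennreal t
        then d n \<omega> * (X (enn2real (\<rho> n \<omega>)) \<omega> - A (enn2real (\<rho> n \<omega>)) \<omega>) else 0))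
    (\<lambda>t \<omega>. m t \<omega> * X t \<omega>)"
proof -
  obtain I where I: "ito_integral M F W (\<lambda>s \<omega>. \<sigma> * X s \<omega>) I"
    and cont': "\<forall>\<omega>\<in>space M. continuous_on {0..} (\<lambda>t. I t \<omega>) \<and> I 0 \<omega> = 0"
    and X_eq: "AE \<omega> in M. \<forall>t\<ge>0. set_integrable lborel {0..t} (\<lambda>s. X s \<omega>) \<and>
           X t \<omega> = x\<^sub>0 - (LINT s:{0..t}|lborel. \<mu> * X s \<omega>) + I t \<omega> + A t \<omega>"
    using gbm_equation_integralE[OF W eq] by blast
  have cont: "continuous_on {0..} (\<lambda>t. I t \<omega>)" if "\<omega> \<in> space M" for \<omega>
    using cont' that by blast
  have adX: "adapted F X" using eq by (simp add: gbm_equation_def)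
  obtain S where adI: "adapted F I"
    and mb: "AE \<omega> in M. set_borel_measurable lborel {0..} (\<lambda>s. \<sigma> * X s \<omega>)"
    and S: "\<And>m. simple_predictable M F (S m)"
    and lim: "AE \<omega> in M. \<forall>t\<ge>0.
       (\<lambda>m. \<integral>\<^sup>+ s\<in>{0..t}. ennreal ((simple_value (S m) s \<omega> - \<sigma> * X s \<omega>)\<^sup>2) \<partial>lborel) \<longlonglongrightarrow> 0 \<and>
       uniform_limit {0..t} (\<lambda>m s. simple_integral W (S m) s \<omega>) (\<lambda>s. I s \<omega>) sequentially"
    using I unfolding ito_integral_def by auto
  \<comment> \<open>This is the integral of the rescaled integrand: jump \<open>n\<close> rescales
    the increment of \<open>I\<close> after \<open>\<rho> n\<close>.\<close>
  define I' where "I' t \<omega> = I t \<omega> + (\<Sum>n. d n \<omega> * (I t \<omega> - I (min_time (\<rho> n \<omega>) t) \<omega>))" for t \<omega>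
  have rc: "continuous (at s within {s..}) (\<lambda>s. I s \<omega>)" if "\<omega> \<in> space M" "0 \<le> s" for \<omega> s
    using cont[OF that(1)] that(2) by (auto simp: continuous_on_eq_continuous_within intro: continuous_within_subset)
  have d_meas: "(\<lambda>\<omega>. if \<rho> n \<omega> \<le> t then d n \<omega> else 0) \<in> borel_measurable (F t)" for n t
    by (rule pre_sigma_measurableD[OF \<rho> d])
  have m_meas: "m t \<in> borel_measurable (F (ennreal t))" for t
    unfolding m_def by (intro borel_measurable_add borel_measurable_const borel_measurable_suminf d_meas)
  have adX': "adapted F (\<lambda>t \<omega>. m t \<omega> * X t \<omega>)"
    using adX m_meas unfolding adapted_def by (auto intro: borel_measurable_times)
  have adH: "adapted F (\<lambda>t \<omega>. \<sigma> * (m t \<omega> * X t \<omega>))"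
    using adX' unfolding adapted_def by (auto intro!: borel_measurable_times[OF borel_measurable_const])
  have adI': "adapted F I'"
    unfolding adapted_def
  proof (intro allI impI)
    fix t :: real assume t: "0 \<le> t"
    have "(\<lambda>\<omega>. I t \<omega> + (\<Sum>n. (if \<rho> n \<omega> \<le> ennreal t then d n \<omega> else 0) * (I t \<omega> - I (min_time (\<rho> n \<omega>) t) \<omega>)))
        \<in> borel_measurable (F (ennreal t))"
      using adaptedD[OF adI t order_refl] measurable_sample[OF adI \<rho> rc t]
      by (intro borel_measurable_add borel_measurable_suminf borel_measurable_times borel_measurable_diff d_meas)
         (auto simp: min_time_def)
    also have "(\<lambda>\<omega>. I t \<omega> + (\<Sum>n. (if \<rho> n \<omega> \<le> ennreal t then d n \<omega> else 0) * (I t \<omega> - I (min_time (\<rho> n \<omega>) t) \<omega>))) = I' t"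
      unfolding I'_def using t
      by (intro ext arg_cong2[where f="(+)"] refl arg_cong[where f=suminf]) (auto simp: min_time_eq)
    finally show "I' t \<in> borel_measurable (F (ennreal t))" .
  qed
  have S': "simple_predictable M F (rescale_simple \<rho> d (S k) n)" for k n
    by (rule simple_predictable_rescale_simple[OF S \<rho> inc d])
  have ito: "ito_integral M F W (\<lambda>t \<omega>. \<sigma> * (m t \<omega> * X t \<omega>)) I'"
    unfolding ito_integral_def
  proof (intro conjI adH adI' exI[of _ "\<lambda>k. rescale_simple \<rho> d (S k) k"] allI S')
    show "AE \<omega> in M. set_borel_measurable lborel {0..} (\<lambda>s. \<sigma> * (m s \<omega> * X s \<omega>))"
      using mb
    proof eventually_elim
      case (elim \<omega>)
      have "(\<lambda>s. m s \<omega>) \<in> borel_measurable borel" unfolding m_def by measurable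
      with elim have "(\<lambda>s. m s \<omega> * (indicator {0..} s *\<^sub>R (\<sigma> * X s \<omega>))) \<in> borel_measurable lborel"
        unfolding set_borel_measurable_def by (intro borel_measurable_times) auto
      then show ?case unfolding set_borel_measurable_def by (simp add: ac_simps)
    qed
    show "AE \<omega> in M. \<forall>t\<ge>0.
       (\<lambda>k. \<integral>\<^sup>+ s\<in>{0..t}. ennreal ((simple_value (rescale_simple \<rho> d (S k) k) s \<omega> - \<sigma> * (m s \<omega> * X s \<omega>))\<^sup>2) \<partial>lborel) \<longlonglongrightarrow> 0 \<and>
       uniform_limit {0..t} (\<lambda>k s. simple_integral W (rescale_simple \<rho> d (S k) k) s \<omega>) (\<lambda>s. I' s \<omega>) sequentially"
      using lim summ mb AE_space
    proof eventually_elim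
      case (elim \<omega>)
      show ?case
      proof (intro allI impI conjI)
        fix t :: real assume t: "0 \<le> t"
        have comm: "\<sigma> * (m s \<omega> * X s \<omega>) = m s \<omega> * (\<sigma> * X s \<omega>)" for s by simp
        have "(\<lambda>k. \<integral>\<^sup>+ s\<in>{0..t}. ennreal (((1 + (\<Sum>j<k. if \<rho> j \<omega> < ennreal s then d j \<omega> else 0)) * simple_value (S k) s \<omega> -
            m s \<omega> * (\<sigma> * X s \<omega>))\<^sup>2) \<partial>lborel) \<longlonglongrightarrow> 0"
          unfolding m_def
          by (rule tendsto_L2_rescale[OF _ measurable_simple_value simple_value_bounded]) (use elim t in auto)
        then show "(\<lambda>k. \<integral>\<^sup>+ s\<in>{0..t}. ennreal ((simple_value (rescale_simple \<rho> d (S k) k) s \<omega> - \<sigma> * (m s \<omega> * X s \<omega>))\<^sup>2) \<partial>lborel) \<longlonglongrightarrow> 0"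
          unfolding comm by (simp only: simple_value_rescale_simple[where \<rho>=\<rho> and \<omega>=\<omega>, OF inc[OF elim(4)]])
        have "uniform_limit {0..t} (\<lambda>k s. simple_integral W (S k) s \<omega> +
            (\<Sum>j<k. d j \<omega> * (simple_integral W (S k) s \<omega> - simple_integral W (S k) (min_time (\<rho> j \<omega>) s) \<omega>)))
            (\<lambda>s. I' s \<omega>) sequentially"
          unfolding I'_def
          by (rule uniform_limit_rescale) (use elim t cont[OF elim(4)] in \<open>auto intro: continuous_on_subset\<close>)
        also have "?this \<longleftrightarrow> uniform_limit {0..t} (\<lambda>k s. simple_integral W (rescale_simple \<rho> d (S k) k) s \<omega>) (\<lambda>s. I' s \<omega>) sequentially"
          by (intro uniform_limit_cong always_eventually allI ballI refl)
             (simp add: simple_integral_rescale_simple[where \<rho>=\<rho> and \<omega>=\<omega>, OF S' inc[OF elim(4)] elim(4)])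
        finally show "uniform_limit {0..t} (\<lambda>k s. simple_integral W (rescale_simple \<rho> d (S k) k) s \<omega>) (\<lambda>s. I' s \<omega>) sequentially" .
      qed
    qed
  qed
  have "AE \<omega> in M. \<forall>t\<ge>0. set_integrable lborel {0..t} (\<lambda>s. m s \<omega> * X s \<omega>) \<and>
      m t \<omega> * X t \<omega> = x\<^sub>0 - (LINT s:{0..t}|lborel. \<mu> * (m s \<omega> * X s \<omega>)) + I' t \<omega> +
        (m t \<omega> * A t \<omega> + (\<Sum>n. if \<rho> n \<omega> \<le> ennreal t
        then d n \<omega> * (X (enn2real (\<rho> n \<omega>)) \<omega> - A (enn2real (\<rho> n \<omega>)) \<omega>) else 0))"
    using X_eq summ AE_space
  proof eventually_elim
    case (elim \<omega>)
    show ?case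
    proof (intro allI impI)
      fix t :: real assume t: "0 \<le> t"
      define \<Xi> where "\<Xi> u = (LINT s:{0..u}|lborel. X s \<omega>)" for u
      define r where "r n = enn2real (\<rho> n \<omega>)" for n
      have r: "r n \<in> {0..t}" if "\<rho> n \<omega> \<le> ennreal t" for n
        using that t by (auto simp: r_def intro: enn2real_leI)
      define u where "u n = (if \<rho> n \<omega> \<le> ennreal t then d n \<omega> else 0)" for n
      have su: "summable (\<lambda>n. \<bar>u n\<bar>)"
        using elim(2) t unfolding u_def by (simp add: if_distrib cong: if_cong)
      have su': "summable (\<lambda>n. u n * f n)" if f: "\<And>n. \<rho> n \<omega> \<le> ennreal t \<Longrightarrow> \<bar>f n\<bar> \<le> C" for f :: "nat \<Rightarrow> real" and C
      proof (rule summable_comparison_test')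
        show "summable (\<lambda>n. \<bar>u n\<bar> * C)" by (intro summable_mult2 su)
        show "norm (u n * f n) \<le> \<bar>u n\<bar> * C" for n
          using f[of n] by (auto simp: u_def abs_mult intro: mult_left_mono)
      qed
      have X_int: "set_integrable lborel {0..t} (\<lambda>s. X s \<omega>)" using elim(1) t by auto
      have X_at: "X s \<omega> - A s \<omega> = x\<^sub>0 - \<mu> * \<Xi> s + I s \<omega>" if "0 \<le> s" for s
        using elim(1) that by (auto simp: \<Xi>_def)
      note \<Xi>_rescale = set_integral_rescale[OF X_int t, of "\<lambda>n. \<rho> n \<omega>" "\<lambda>n. d n \<omega>"]
      have int': "set_integrable lborel {0..t} (\<lambda>s. m s \<omega> * X s \<omega>)"
        unfolding m_def using \<Xi>_rescale(1) elim(2) t by blast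
      have "(LINT s:{0..t}|lborel. m s \<omega> * X s \<omega>) =
          \<Xi> t + (\<Sum>n. if \<rho> n \<omega> \<le> ennreal t then d n \<omega> * (\<Xi> t - \<Xi> (r n)) else 0)"
        unfolding m_def \<Xi>_def r_def using \<Xi>_rescale(2) elim(2) t by blast
      also have "\<dots> = \<Xi> t + (\<Sum>n. u n * (\<Xi> t - \<Xi> (r n)))"
        unfolding u_def by (intro arg_cong2[where f="(+)"] refl arg_cong[where f=suminf] ext) auto
      finally have 1: "(LINT s:{0..t}|lborel. m s \<omega> * X s \<omega>) = \<Xi> t + (\<Sum>n. u n * (\<Xi> t - \<Xi> (r n)))" .
      have 2: "I' t \<omega> = I t \<omega> + (\<Sum>n. u n * (I t \<omega> - I (r n) \<omega>))"
        unfolding I'_def u_def r_def using t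
        by (intro arg_cong2[where f="(+)"] refl arg_cong[where f=suminf] ext) (auto simp: min_time_eq)
      have 3: "(\<Sum>n. if \<rho> n \<omega> \<le> ennreal t then d n \<omega> * (X (enn2real (\<rho> n \<omega>)) \<omega> - A (enn2real (\<rho> n \<omega>)) \<omega>) else 0) =
          (\<Sum>n. u n * (x\<^sub>0 - \<mu> * \<Xi> (r n) + I (r n) \<omega>))"
        unfolding u_def r_def using X_at
        by (intro arg_cong[where f=suminf] ext) auto
      have 4: "m t \<omega> = 1 + suminf u" unfolding m_def u_def ..
      obtain B where B: "\<And>s. s \<in> {0..t} \<Longrightarrow> \<bar>I s \<omega>\<bar> \<le> B"
      proof -
        have "continuous_on {0..t} (\<lambda>s. I s \<omega>)" using cont[OF elim(3)] by (rule continuous_on_subset) auto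
        from compact_imp_bounded[OF compact_continuous_image[OF this compact_Icc]] show ?thesis
          using that unfolding bounded_iff real_norm_def by blast
      qed
      define C where "C = (LINT s:{0..t}|lborel. \<bar>X s \<omega>\<bar>)"
      have C: "\<bar>\<Xi> s\<bar> \<le> C" if "s \<in> {0..t}" for s
      proof -
        have "\<bar>\<Xi> s\<bar> \<le> (\<integral>x. \<bar>indicator {0..s} x *\<^sub>R X x \<omega>\<bar> \<partial>lborel)"
          unfolding \<Xi>_def set_lebesgue_integral_def by (rule integral_abs_bound)
        also have "\<dots> \<le> C"
          unfolding C_def set_lebesgue_integral_def
        proof (rule integral_mono)
          show "integrable lborel (\<lambda>x. \<bar>indicator {0..s} x *\<^sub>R X x \<omega>\<bar>)"
            using set_integrable_subset[OF X_int, of "{0..s}"] that by (auto simp: set_integrable_def intro: integrable_abs)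
          show "integrable lborel (\<lambda>x. indicator {0..t} x *\<^sub>R \<bar>X x \<omega>\<bar>)"
            using integrable_abs[OF X_int[unfolded set_integrable_def]] by (simp add: abs_mult)
        qed (use that in \<open>auto simp: indicator_def\<close>)
        finally show ?thesis .
      qed
      have s1: "summable (\<lambda>n. u n * (\<Xi> t - \<Xi> (r n)))"
      proof (rule su'[of _ "2 * C"])
        fix n assume "\<rho> n \<omega> \<le> ennreal t"
        then show "\<bar>\<Xi> t - \<Xi> (r n)\<bar> \<le> 2 * C" using C[of t] C[OF r, of n] t by auto
      qed
      have s2: "summable (\<lambda>n. u n * (I t \<omega> - I (r n) \<omega>))"
      proof (rule su'[of _ "2 * B"])
        fix n assume "\<rho> n \<omega> \<le> ennreal t"
        then show "\<bar>I t \<omega> - I (r n) \<omega>\<bar> \<le> 2 * B" using B[of t] B[OF r, of n] t by auto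
      qed
      have s3: "summable (\<lambda>n. u n * (x\<^sub>0 - \<mu> * \<Xi> (r n) + I (r n) \<omega>))"
      proof (rule su'[of _ "\<bar>x\<^sub>0\<bar> + \<bar>\<mu>\<bar> * C + B"])
        fix n assume n: "\<rho> n \<omega> \<le> ennreal t"
        have "\<bar>\<mu> * \<Xi> (r n)\<bar> \<le> \<bar>\<mu>\<bar> * C" using C[OF r[OF n]] by (simp add: abs_mult mult_left_mono)
        then show "\<bar>x\<^sub>0 - \<mu> * \<Xi> (r n) + I (r n) \<omega>\<bar> \<le> \<bar>x\<^sub>0\<bar> + \<bar>\<mu>\<bar> * C + B"
          using B[OF r[OF n]] by linarith
      qed
      \<comment> \<open>In each summand the terms taken at \<open>r n\<close> cancel, which leaves
        \<open>u n\<close> times \<open>X - A\<close> at time \<open>t\<close>.\<close>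
      have "(\<Sum>n. u n * (I t \<omega> - I (r n) \<omega>)) - \<mu> * (\<Sum>n. u n * (\<Xi> t - \<Xi> (r n))) +
          (\<Sum>n. u n * (x\<^sub>0 - \<mu> * \<Xi> (r n) + I (r n) \<omega>)) =
          (\<Sum>n. u n * (I t \<omega> - I (r n) \<omega>) - \<mu> * (u n * (\<Xi> t - \<Xi> (r n))) + u n * (x\<^sub>0 - \<mu> * \<Xi> (r n) + I (r n) \<omega>))"
        by (intro sums_unique sums_add sums_diff sums_mult summable_sums s1 s2 s3)
      also have "\<dots> = (\<Sum>n. u n * (X t \<omega> - A t \<omega>))"
        unfolding X_at[OF t] by (simp add: algebra_simps)
      also have "\<dots> = suminf u * (X t \<omega> - A t \<omega>)"
        by (rule suminf_mult2[symmetric, OF summable_rabs_cancel[OF su]])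
      finally have sum_eq: "(\<Sum>n. u n * (I t \<omega> - I (r n) \<omega>)) - \<mu> * (\<Sum>n. u n * (\<Xi> t - \<Xi> (r n))) +
          (\<Sum>n. u n * (x\<^sub>0 - \<mu> * \<Xi> (r n) + I (r n) \<omega>)) = suminf u * (X t \<omega> - A t \<omega>)" .
      have "m t \<omega> * X t \<omega> = x\<^sub>0 - \<mu> * (\<Xi> t + (\<Sum>n. u n * (\<Xi> t - \<Xi> (r n)))) + I' t \<omega> +
        (m t \<omega> * A t \<omega> + (\<Sum>n. u n * (x\<^sub>0 - \<mu> * \<Xi> (r n) + I (r n) \<omega>)))"
        using sum_eq[unfolded right_diff_distrib[of "suminf u"]] X_at[OF t]
        unfolding 2 4 distrib_right distrib_left[of \<mu>] by linarith
      then show "set_integrable lborel {0..t} (\<lambda>s. m s \<omega> * X s \<omega>) \<and>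
          m t \<omega> * X t \<omega> = x\<^sub>0 - (LINT s:{0..t}|lborel. \<mu> * (m s \<omega> * X s \<omega>)) + I' t \<omega> +
          (m t \<omega> * A t \<omega> + (\<Sum>n. if \<rho> n \<omega> \<le> ennreal t
            then d n \<omega> * (X (enn2real (\<rho> n \<omega>)) \<omega> - A (enn2real (\<rho> n \<omega>)) \<omega>) else 0))"
        using int' unfolding 3 1[symmetric] by simp
    qed
  qed
  with adX' ito show ?thesis unfolding gbm_equation_def by blast
qed

section \<open>The modified policy along a path\<close>

text \<open>
  \<open>R\<close> is the ratio of the modified to the original inventory, \<open>y\<close> and \<open>z\<close> are the original levels
  before and after a change, and the result is the ratio after it.
\<close>

definition update_ratio :: "real \<Rightarrow> real \<Rightarrow> real \<Rightarrow> real \<Rightarrow> real \<Rightarrow> real" where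
  "update_ratio a B R y z = (if R * y \<le> a \<and> R * y < z then if z \<le> B then 1 else 2 * a / z else R * y / z)"

text \<open>A lower bound for what the modified policy has saved so far, as a function of the ratio \<open>R\<close>.\<close>

definition potential :: "real \<Rightarrow> real \<Rightarrow> real \<Rightarrow> real \<Rightarrow> real \<Rightarrow> real" where
  "potential k\<^sub>1 k\<^sub>2 \<eta> a R = (if R < 1 then k\<^sub>1 + k\<^sub>2 * a powr \<eta> * (R powr (- \<eta>) - 1) else 0)"

text \<open>\<open>B_large\<close> comes from replacing an original order up to \<open>z > B\<close>
  by one up to \<open>2 * a\<close>. The new ratio satisfies \<open>a / R' = z / 2\<close>, so the
  new potential contains \<open>(z / 2) powr \<eta>\<close> instead of \<open>z powr \<eta>\<close>.
  The difference \<open>z powr \<eta> * (1 - 2 powr (- \<eta>))\<close> must pay for the additional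
  \<open>k\<^sub>1 / k\<^sub>2\<close> and for the rise from \<open>a\<close> to
  \<open>2 * a\<close>; as it increases with \<open>z\<close>, its value at \<open>B\<close>
  suffices.\<close>

locale control_parameters =
  fixes k\<^sub>1 k\<^sub>2 \<eta> a B :: real
  assumes k\<^sub>1: "0 < k\<^sub>1" and k\<^sub>2: "0 < k\<^sub>2" and \<eta>: "0 < \<eta>" and a: "0 < a" and B: "2 * a \<le> B"
    and B_large: "(2 powr \<eta> - 1) * a powr \<eta> + k\<^sub>1 / k\<^sub>2 \<le> B powr \<eta> * (1 - 2 powr (- \<eta>))"

lemma (in control_parameters) potential_nonneg: "0 < r \<Longrightarrow> 0 \<le> potential k\<^sub>1 k\<^sub>2 \<eta> a r"
  using k\<^sub>1 k\<^sub>2 \<eta> by (auto simp: potential_def powr_minus one_le_inverse_iff intro!: add_nonneg_nonneg mult_nonneg_nonneg powr_le1)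

text \<open>\<open>y\<close> and \<open>z\<close> are the original levels just before and at a
  change of state. As long as the ratio is below 1 the modified level has not yet dropped below
  \<open>a\<close>, and the change is caused by an original order or by the modified level reaching
  \<open>a\<close>.\<close>

locale control_step = control_parameters +
  fixes R y z :: real
  assumes R: "0 < R" "R \<le> 1" and y: "0 \<le> y" and yz: "y \<le> z" and Ry: "R < 1 \<Longrightarrow> a \<le> R * y"
    and trigger: "y < z \<or> R < 1 \<and> R * y \<le> a"
begin

abbreviation "R' \<equiv> update_ratio a B R y z"

text \<open>The remaining combination \<open>R * y \<le> a\<close> and \<open>z \<le> R * y\<close>
  forces \<open>y = z\<close> together with \<open>R = 1\<close> or \<open>y = 0\<close>, and then
  there is no trigger.\<close>

lemma order_cases:
  obtains (wait) "a < R * y" "y < z" "R' = R * y / z"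
  | (restore) "R * y \<le> a" "R * y < z" "z \<le> B" "R' = 1"
  | (partial) "R * y \<le> a" "R * y < z" "B < z" "R' = 2 * a / z"
proof (cases "R * y \<le> a \<and> R * y < z")
  case True
  then show ?thesis using restore partial by (cases "z \<le> B") (auto simp: update_ratio_def)
next
  case False
  have "R * y \<le> y" using R y by (simp add: mult_left_le_one_le)
  have "a < R * y"
  proof (rule ccontr)
    assume *: "\<not> a < R * y"
    with False have "z \<le> R * y" by auto
    with \<open>R * y \<le> y\<close> yz have "R * y = y" "z = y" by linarith+
    then have "(R - 1) * y = 0" by (simp add: algebra_simps)
    then have "R = 1 \<or> y = 0" by simp
    then show False using trigger Ry a \<open>z = y\<close> by auto
  qed
  then show ?thesis using wait trigger False by (auto simp: update_ratio_def)
qed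

lemma z_pos: "0 < z"
proof -
  have Ry0: "0 \<le> R * y" using R y by simp
  show ?thesis using order_cases by cases (use y Ry0 in linarith)+
qed

text \<open>The strict inequality in the third claim is the gain from ordering up to
  \<open>2 * a\<close>: after the step the modified level is away from its trigger.\<close>

lemma update_ratio_bounds: "0 < R'" "R' \<le> 1" "R' < 1 \<Longrightarrow> a < R' * z" "R * y \<le> R' * z"
proof -
  have "R * y \<le> y" using R y by (simp add: mult_left_le_one_le)
  with yz have "R * y \<le> z" by simp
  have "0 < R' \<and> R' \<le> 1 \<and> (R' < 1 \<longrightarrow> a < R' * z) \<and> R * y \<le> R' * z"
    using order_cases
  proof cases
    case wait
    then have "R' * z = R * y" "0 < R * y" using z_pos a by auto
    then show ?thesis using wait z_pos \<open>R * y \<le> z\<close> by simp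
  next
    case restore
    then show ?thesis by simp
  next
    case partial
    then have "R' * z = 2 * a" using z_pos by simp
    then show ?thesis using partial z_pos a B by simp
  qed
  then show "0 < R'" "R' \<le> 1" "R' < 1 \<Longrightarrow> a < R' * z" "R * y \<le> R' * z" by auto
qed

lemma order_level:
  assumes "R * y < R' * z"
  shows "R' * z \<le> B"
  using order_cases by cases (use assms z_pos B in auto)

text \<open>The new level is at least \<open>R * y\<close>, so the ratio loses at most the relative
  size of the original order, and \<open>z\<close> is at least \<open>a\<close> whenever it loses
  anything. The total of all decreases is thus controlled by the total amount ordered
  originally.\<close>

lemma ratio_decrease: "R - R' \<le> (z - y) / a"
proof (cases "R' < R")
  case True
  have az: "a \<le> z"
    using order_cases
  proof cases
    case wait
    have "R * y \<le> y" using R y by (simp add: mult_left_le_one_le)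
    then show ?thesis using wait by linarith
  qed (use True R B a in auto)
  have "R * y / z \<le> R'" using update_ratio_bounds(4) z_pos by (simp add: field_simps)
  then have "R - R' \<le> R * ((z - y) / z)" using z_pos by (simp add: field_simps)
  also have "\<dots> \<le> (z - y) / z" using R yz z_pos by (intro mult_left_le_one_le) auto
  also have "\<dots> \<le> (z - y) / a" using az a yz by (intro divide_left_mono) auto
  finally show ?thesis .
next
  case False
  then show ?thesis using a yz divide_nonneg_pos[of "z - y" a] by linarith
qed

text \<open>Waiting raises the potential by no more than the original order costs. A restoring order
  combines the prepaid order from \<open>a\<close> to \<open>y\<close> with the original one from
  \<open>y\<close> to \<open>z\<close>. A partial order is paid for by
  \<open>B_large\<close>.\<close>

lemma cost_step:
  "potential k\<^sub>1 k\<^sub>2 \<eta> a R' + (if R * y < R' * z then ordering_cost k\<^sub>1 k\<^sub>2 \<eta> (R * y) (R' * z) else 0)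
   \<le> potential k\<^sub>1 k\<^sub>2 \<eta> a R + (if y < z then ordering_cost k\<^sub>1 k\<^sub>2 \<eta> y z else 0)"
proof -
  have pot: "a powr \<eta> * r powr (- \<eta>) = (a / r) powr \<eta>" if "0 < r" for r
    using that a by (simp add: powr_divide powr_minus_divide)
  have zy: "y powr \<eta> \<le> z powr \<eta>" using y yz \<eta> by (intro powr_mono2) auto
  have c: "k\<^sub>2 * (z powr \<eta> - y powr \<eta>) \<le> (if y < z then ordering_cost k\<^sub>1 k\<^sub>2 \<eta> y z else 0)"
    using k\<^sub>1 yz by (auto simp: ordering_cost_def)
  \<comment> \<open>Here \<open>y = a / R\<close>, so the potential is exactly the cost of an order
    from \<open>a\<close> to \<open>y\<close>.\<close>
  have hit: "potential k\<^sub>1 k\<^sub>2 \<eta> a R = k\<^sub>1 + k\<^sub>2 * (y powr \<eta> - a powr \<eta>)" "R * y = a" if "R < 1" "R * y \<le> a"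
  proof -
    show "R * y = a" using that Ry by simp
    then have "a / R = y" using R by (auto simp: field_simps)
    then show "potential k\<^sub>1 k\<^sub>2 \<eta> a R = k\<^sub>1 + k\<^sub>2 * (y powr \<eta> - a powr \<eta>)"
      using pot[OF R(1)] that by (simp add: potential_def algebra_simps)
  qed
  show ?thesis
    using order_cases
  proof cases
    case wait
    have y0: "0 < y" using wait(1) a y by (cases "y = 0") simp_all
    have no: "\<not> R * y < R' * z" using wait(3) z_pos by simp
    \<comment> \<open>Since \<open>a / R\<close> and \<open>a / R'\<close> are the multiples of
      \<open>y\<close> and \<open>z\<close> by the same factor \<open>a / (R * y)\<close>, which is
      below 1, the potential grows by \<open>w\<close> times the growth of the original
      power.\<close>
    define w where "w = a powr \<eta> / (R * y) powr \<eta>"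
    have w: "0 \<le> w" "w \<le> 1"
      unfolding w_def using wait(1) a \<eta> by (auto simp: divide_le_eq_1 intro!: powr_mono2)
    have "a / R' = a / (R * y) * z" using wait(3) by simp
    then have 1: "a powr \<eta> * R' powr (- \<eta>) = w * z powr \<eta>"
      unfolding pot[OF update_ratio_bounds(1)] w_def using a R y0 z_pos by (simp add: powr_mult powr_divide)
    have "a / R = a / (R * y) * y" using y0 by simp
    then have 2: "a powr \<eta> * R powr (- \<eta>) = w * y powr \<eta>"
      unfolding pot[OF R(1)] w_def using a R y0 z_pos by (simp add: powr_mult powr_divide)
    have R'1: "R' < 1"
    proof -
      have "R * y \<le> y" using R y by (simp add: mult_left_le_one_le)
      then show ?thesis using wait z_pos by simp
    qed
    have le: "k\<^sub>2 * (a powr \<eta> * (R powr (- \<eta>) - 1)) \<le> potential k\<^sub>1 k\<^sub>2 \<eta> a R"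
      using k\<^sub>1 R by (auto simp: potential_def)
    have "k\<^sub>2 * (w * (z powr \<eta> - y powr \<eta>)) \<le> k\<^sub>2 * (z powr \<eta> - y powr \<eta>)"
      using w zy k\<^sub>2 by (intro mult_left_mono mult_left_le_one_le) auto
    moreover have "potential k\<^sub>1 k\<^sub>2 \<eta> a R' = k\<^sub>1 + k\<^sub>2 * (a powr \<eta> * (R powr (- \<eta>) - 1)) + k\<^sub>2 * (w * (z powr \<eta> - y powr \<eta>))"
      using R'1 1 2 unfolding potential_def by (simp add: algebra_simps)
    ultimately show ?thesis
      using no le wait(2) by (simp add: ordering_cost_def)
  next
    case restore
    have V': "potential k\<^sub>1 k\<^sub>2 \<eta> a R' = 0" using restore by (simp add: potential_def)
    show ?thesis
    proof (cases "R < 1")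
      case True
      from hit[OF True restore(1)] c show ?thesis
        unfolding V' using restore by (simp add: ordering_cost_def algebra_simps)
    next
      case False
      then have "R = 1" using R by simp
      then show ?thesis unfolding V' using restore by (simp add: potential_def)
    qed
  next
    case partial
    have R'z: "R' * z = 2 * a" using partial z_pos by simp
    have half: "a / R' = z / 2" using partial a z_pos by simp
    have 1: "a powr \<eta> * R' powr (- \<eta>) = z powr \<eta> * 2 powr (- \<eta>)"
      unfolding pot[OF update_ratio_bounds(1)] half using z_pos by (simp add: powr_divide powr_minus_divide)
    have "R' < 1" using partial B a z_pos by simp
    with 1 have V': "potential k\<^sub>1 k\<^sub>2 \<eta> a R' = k\<^sub>1 + k\<^sub>2 * (z powr \<eta> * 2 powr (- \<eta>) - a powr \<eta>)"
      unfolding potential_def by (simp add: algebra_simps)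
    have "2 powr (- \<eta>) \<le> 1" using \<eta> using powr_mono[of "- \<eta>" 0 2] by simp
    then have "B powr \<eta> * (1 - 2 powr (- \<eta>)) \<le> z powr \<eta> * (1 - 2 powr (- \<eta>))"
      using partial B a \<eta> by (intro mult_right_mono powr_mono2) auto
    with B_large have "(2 powr \<eta> - 1) * a powr \<eta> + k\<^sub>1 / k\<^sub>2 \<le> z powr \<eta> * (1 - 2 powr (- \<eta>))" by simp
    then have "k\<^sub>2 * ((2 powr \<eta> - 1) * a powr \<eta> + k\<^sub>1 / k\<^sub>2) \<le> k\<^sub>2 * (z powr \<eta> * (1 - 2 powr (- \<eta>)))"
      using k\<^sub>2 by (intro mult_left_mono) auto
    then have K: "k\<^sub>2 * (2 powr \<eta> * a powr \<eta>) - k\<^sub>2 * a powr \<eta> + k\<^sub>1 \<le> k\<^sub>2 * z powr \<eta> - k\<^sub>2 * (z powr \<eta> * 2 powr (- \<eta>))"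
      using k\<^sub>2 by (simp add: algebra_simps)
    have 2: "(2 * a) powr \<eta> = 2 powr \<eta> * a powr \<eta>" using a by (simp add: powr_mult)
    have ord: "R * y < 2 * a" using partial(1) a by linarith
    have c': "(if R * y < 2 * a then ordering_cost k\<^sub>1 k\<^sub>2 \<eta> (R * y) (2 * a) else 0) =
        k\<^sub>1 + (k\<^sub>2 * (2 powr \<eta> * a powr \<eta>) - k\<^sub>2 * (R * y) powr \<eta>)"
      using ord by (simp add: ordering_cost_def 2 right_diff_distrib)
    show ?thesis
    proof (cases "R < 1")
      case True
      from hit[OF True partial(1)] c K show ?thesis
        unfolding V' R'z c' right_diff_distrib by simp
    next
      case False
      then have "R = 1" using R by simp
      then show ?thesis
        unfolding V' R'z c' using partial K by (simp add: potential_def ordering_cost_def right_diff_distrib)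
    qed
  qed
qed

text \<open>Without an original order the whole cost of the modified order, at least
  \<open>k\<^sub>1\<close>, is taken from the potential. This prevents an endless run of such
  changes.\<close>

lemma hit_decreases_potential:
  assumes "y = z"
  shows "potential k\<^sub>1 k\<^sub>2 \<eta> a R' + k\<^sub>1 \<le> potential k\<^sub>1 k\<^sub>2 \<eta> a R"
proof -
  have "R * y < R' * z"
    using order_cases by cases (use assms z_pos a in auto)
  moreover have "(R * y) powr \<eta> \<le> (R' * z) powr \<eta>"
    using update_ratio_bounds(4) R y \<eta> by (intro powr_mono2) auto
  then have "k\<^sub>1 \<le> ordering_cost k\<^sub>1 k\<^sub>2 \<eta> (R * y) (R' * z)" using k\<^sub>2 by (simp add: ordering_cost_def)
  ultimately show ?thesis using cost_step assms by simp
qed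

end

text \<open>For \<open>x \<ge> a \<ge> 1\<close> and \<open>\<beta> \<le> 0\<close> one has
  \<open>x powr (\<beta> - 1) \<le> 1 / a\<close>, so the condition on \<open>k\<^sub>3 * a\<close>
  makes the derivative nonnegative. The proof avoids derivatives by means of
  \<open>1 + u \<le> exp u\<close> and \<open>ln r \<le> r - 1\<close>.\<close>

lemma holding_cost_mono:
  assumes a: "1 \<le> a" "k\<^sub>4 * (- \<beta>) \<le> k\<^sub>3 * a" and k: "0 \<le> k\<^sub>3" "0 \<le> k\<^sub>4" "\<beta> \<le> 0" and xy: "a \<le> x" "x \<le> y"
  shows "holding_cost k\<^sub>3 k\<^sub>4 \<beta> x \<le> holding_cost k\<^sub>3 k\<^sub>4 \<beta> y"
proof -
  have x: "0 < x" "1 \<le> x" and y: "0 < y" using a xy by auto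
  have "1 - (y / x) powr \<beta> \<le> - \<beta> * ln (y / x)"
  proof -
    have "(y / x) powr \<beta> = exp (\<beta> * ln (y / x))" using x y by (simp add: powr_def)
    then show ?thesis
      using exp_ge_add_one_self[of "\<beta> * ln (y / x)"] by (simp only: mult_minus_left)
  qed
  also have "\<dots> \<le> - \<beta> * (y / x - 1)"
    using x y k by (intro mult_left_mono ln_le_minus_one) auto
  finally have "x powr \<beta> * (1 - (y / x) powr \<beta>) \<le> x powr \<beta> * (- \<beta> * (y / x - 1))"
    by (intro mult_left_mono) auto
  moreover have "x powr \<beta> * (y / x) powr \<beta> = y powr \<beta>" using x y by (simp add: powr_divide)
  ultimately have "x powr \<beta> - y powr \<beta> \<le> x powr \<beta> * (- \<beta> * (y / x - 1))" by (simp add: algebra_simps)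
  also have "\<dots> \<le> 1 * (- \<beta> * (y / x - 1))"
    using x xy k powr_mono[of \<beta> 0 x] by (intro mult_right_mono mult_nonneg_nonneg) (auto simp: field_simps)
  finally have "k\<^sub>4 * (x powr \<beta> - y powr \<beta>) \<le> k\<^sub>4 * (- \<beta> * (y / x - 1))"
    using k by (intro mult_left_mono) auto
  also have "\<dots> = k\<^sub>4 * (- \<beta>) * ((y - x) / x)" using x by (simp add: field_simps)
  also have "\<dots> \<le> k\<^sub>3 * x * ((y - x) / x)"
    using a xy k x by (intro mult_right_mono) (auto intro: order.trans mult_left_mono)
  also have "\<dots> = k\<^sub>3 * (y - x)" using x by simp
  finally show ?thesis by (simp add: holding_cost_def algebra_simps)
qed

text \<open>The strict inequalities make the condition persist to the right on right-continuous
  paths, as \<open>stopping_time_debut\<close> demands. At the infimum itself the modified level is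
  only known to be at most \<open>a\<close>.\<close>

definition next_time ::
    "real \<Rightarrow> (real \<Rightarrow> real) \<Rightarrow> (real \<Rightarrow> real) \<Rightarrow> ennreal \<Rightarrow> real \<Rightarrow> real \<Rightarrow> ennreal" where
  "next_time a X A r L R = Inf {ennreal t |t. 0 \<le> t \<and> r \<le> ennreal t \<and> (L < A t \<or> R < 1 \<and> R * X t < a)}"

text \<open>
  The state consists of the current time, the total amount ordered so far by the original policy,
  and the ratio.  It changes when the original policy orders or when the modified level reaches
  \<open>a\<close>; the initial state is the one before a possible order at time \<open>0\<close>.
\<close>

primrec control :: "real \<Rightarrow> real \<Rightarrow> (real \<Rightarrow> real) \<Rightarrow> (real \<Rightarrow> real) \<Rightarrow> nat \<Rightarrow> ennreal \<times> real \<times> real" where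
  "control a B X A 0 = (0, 0, 1)"
| "control a B X A (Suc n) = (case control a B X A n of (r, L, R) \<Rightarrow>
     let r' = next_time a X A r L R; t = enn2real r' in
     if r' = \<infinity> then (r', L, R) else (r', A t, update_ratio a B R (X t - (A t - L)) (X t)))"

definition control_time where "control_time a B X A n = fst (control a B X A n)"
definition control_level where "control_level a B X A n = fst (snd (control a B X A n))"
definition control_ratio where "control_ratio a B X A n = snd (snd (control a B X A n))"

lemma control_0 [simp]:
  "control_time a B X A 0 = 0" "control_level a B X A 0 = 0" "control_ratio a B X A 0 = 1"
  by (simp_all add: control_time_def control_level_def control_ratio_def)

lemma control_time_Suc:
  "control_time a B X A (Suc n) =
    next_time a X A (control_time a B X A n) (control_level a B X A n) (control_ratio a B X A n)"
  by (simp add: control_time_def control_level_def control_ratio_def Let_def split: prod.split)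

lemma control_level_Suc:
  "control_level a B X A (Suc n) =
    (if control_time a B X A (Suc n) = \<infinity> then control_level a B X A n
     else A (enn2real (control_time a B X A (Suc n))))"
  by (simp add: control_time_def control_level_def control_ratio_def Let_def split: prod.split)

lemma control_ratio_Suc:
  "control_ratio a B X A (Suc n) =
    (if control_time a B X A (Suc n) = \<infinity> then control_ratio a B X A n
     else let t = enn2real (control_time a B X A (Suc n)) in
       update_ratio a B (control_ratio a B X A n) (X t - (A t - control_level a B X A n)) (X t))"
  by (simp add: control_time_def control_level_def control_ratio_def Let_def split: prod.split)

text \<open>\<open>X t - (A t - L)\<close> is the original level just before time \<open>t\<close>,
  because the ordered total has been \<open>L\<close> since the previous change. Writing it without
  a left limit lets measurability follow from sampling right-continuous processes.\<close>

definition order_size :: "real \<Rightarrow> real \<Rightarrow> (real \<Rightarrow> real) \<Rightarrow> (real \<Rightarrow> real) \<Rightarrow> nat \<Rightarrow> real" where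
  "order_size a B X A n =
    (if control_time a B X A (Suc n) = \<infinity> then 0 else let t = enn2real (control_time a B X A (Suc n)) in
      control_ratio a B X A (Suc n) * X t - control_ratio a B X A n * (X t - (A t - control_level a B X A n)))"

text \<open>A series rather than a case distinction over the intervals between changes, so that the
  ratio is also defined after infinitely many changes.\<close>

definition ratio_at :: "real \<Rightarrow> real \<Rightarrow> (real \<Rightarrow> real) \<Rightarrow> (real \<Rightarrow> real) \<Rightarrow> real \<Rightarrow> real" where
  "ratio_at a B X A t = 1 + (\<Sum>n. if control_time a B X A (Suc n) \<le> ennreal t
     then control_ratio a B X A (Suc n) - control_ratio a B X A n else 0)"

lemma control_time_mono: "incseq (control_time a B X A)"
  by (rule incseq_SucI) (auto simp: control_time_Suc next_time_def intro!: Inf_greatest)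

text \<open>\<open>C\<close> stands for the drift and the Ito integral together; the pathwise
  argument sees them only as one continuous function starting at 0.\<close>

locale policy_path =
  fixes x\<^sub>0 :: real and \<tau> :: "nat \<Rightarrow> ennreal" and Y :: "nat \<Rightarrow> real" and C A X :: "real \<Rightarrow> real"
  assumes x\<^sub>0: "0 < x\<^sub>0" and \<tau>: "incseq \<tau>" and Y: "\<And>k. 0 \<le> Y k"
    and summ: "\<And>t. 0 \<le> t \<Longrightarrow> summable (\<lambda>k. if \<tau> k \<le> ennreal t then Y k else 0)"
    and C: "continuous_on {0..} C" "C 0 = 0"
    and A: "\<And>t. 0 \<le> t \<Longrightarrow> A t = (\<Sum>k. if \<tau> k \<le> ennreal t then Y k else 0)"
    and X: "\<And>t. 0 \<le> t \<Longrightarrow> X t = x\<^sub>0 + C t + A t"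
begin

section \<open>Regularity of the original path\<close>

lemma A_nonneg: "0 \<le> t \<Longrightarrow> 0 \<le> A t"
  using Y summ by (simp add: A suminf_nonneg)

lemma A_mono: "0 \<le> s \<Longrightarrow> s \<le> t \<Longrightarrow> A s \<le> A t"
proof -
  assume st: "0 \<le> s" "s \<le> t"
  have "\<tau> k \<le> ennreal t" if "\<tau> k \<le> ennreal s" for k
    using that st by (meson ennreal_leI order.trans)
  then show ?thesis using st Y summ by (auto simp: A intro!: suminf_le)
qed

text \<open>The order times increase with the index, so they can accumulate only from the left:
  either all of them have passed, or there is a gap before the next one.\<close>

lemma A_locally_constant:
  assumes t: "0 \<le> t"
  shows "\<exists>\<epsilon>>0. \<forall>s. t \<le> s \<and> s < t + \<epsilon> \<longrightarrow> A s = A t"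
proof (cases "\<forall>k. \<tau> k \<le> ennreal t")
  case True
  have "\<tau> k \<le> ennreal s" if "t \<le> s" for s k
    using True that by (meson ennreal_leI order.trans)
  with True t show ?thesis by (intro exI[of _ 1]) (simp add: A)
next
  case False
  define k0 where "k0 = (LEAST k. \<not> \<tau> k \<le> ennreal t)"
  have k0: "\<not> \<tau> k0 \<le> ennreal t" using False unfolding k0_def by (metis LeastI)
  have less: "\<tau> k \<le> ennreal t" if "k < k0" for k using not_less_Least that unfolding k0_def by blast
  obtain v where v: "t < v" "ennreal v \<le> \<tau> k0"
  proof (cases "\<tau> k0")
    case (real r)
    then show ?thesis using k0 t that[of r] by (simp add: not_le ennreal_less_iff)
  qed (use that[of "t + 1"] in simp)
  have const: "A s = A t" if s: "t \<le> s" "s < v" for s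
  proof -
    have "\<tau> k \<le> ennreal s \<longleftrightarrow> \<tau> k \<le> ennreal t" for k
    proof (cases "k < k0")
      case True
      then show ?thesis using less[OF True] s by (meson ennreal_leI order.trans)
    next
      case False
      then have "ennreal v \<le> \<tau> k" using v incseqD[OF \<tau>, of k0 k] by auto
      moreover have "ennreal s < ennreal v" using s t by (simp add: ennreal_less_iff)
      ultimately show ?thesis using s by (meson ennreal_leI leD order.trans le_less_trans)
    qed
    then show ?thesis using s t by (simp add: A)
  qed
  show ?thesis
  proof (intro exI[of _ "v - t"] conjI allI impI)
    show "0 < v - t" using v by simp
    show "A s = A t" if "t \<le> s \<and> s < t + (v - t)" for s
      by (rule const) (use that in auto)
  qed
qed

lemma eventually_A_eq:
  assumes "0 \<le> t"
  shows "eventually (\<lambda>s. A s = A t) (at t within {t..})"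
proof -
  obtain \<epsilon> where \<epsilon>: "\<epsilon> > 0" "\<And>s. t \<le> s \<Longrightarrow> s < t + \<epsilon> \<Longrightarrow> A s = A t"
    using A_locally_constant[OF assms] by blast
  show ?thesis
    unfolding eventually_at
  proof (intro exI[of _ \<epsilon>] conjI ballI impI \<epsilon>(1))
    fix s assume "s \<in> {t..}" "s \<noteq> t \<and> dist s t < \<epsilon>"
    then show "A s = A t" by (intro \<epsilon>(2)) (auto simp: dist_real_def)
  qed
qed

lemma right_continuous_A: "0 \<le> t \<Longrightarrow> continuous (at t within {t..}) A"
  unfolding continuous_within by (rule tendsto_eventually[OF eventually_A_eq])

lemma right_continuous_C: "0 \<le> t \<Longrightarrow> continuous (at t within {t..}) C"
  using C by (auto simp: continuous_on_eq_continuous_within intro: continuous_within_subset)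

lemma right_continuous_X: "0 \<le> t \<Longrightarrow> continuous (at t within {t..}) X"
proof -
  assume t: "0 \<le> t"
  have "continuous (at t within {t..}) (\<lambda>s. x\<^sub>0 + C s + A s)"
    using right_continuous_A[OF t] right_continuous_C[OF t] by (intro continuous_intros)
  then show ?thesis
    by (rule continuous_transform_within[OF _ zero_less_one]) (use t X in auto)
qed

lemma X_tendsto_left:
  assumes s: "0 \<le> s" "s < t" and L: "\<And>u. s \<le> u \<Longrightarrow> u < t \<Longrightarrow> A u = L"
  shows "(X \<longlongrightarrow> x\<^sub>0 + C t + L) (at_left t)"
proof -
  have "(C \<longlongrightarrow> C t) (at t within {0..})" using C s by (auto simp: continuous_on_def)
  then have "(C \<longlongrightarrow> C t) (at t)" using s at_within_interior[of t "{0..}"] by auto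
  then have "(C \<longlongrightarrow> C t) (at_left t)" by (rule tendsto_within_subset) simp
  then have "((\<lambda>u. x\<^sub>0 + C u + L) \<longlongrightarrow> x\<^sub>0 + C t + L) (at_left t)" by (intro tendsto_intros)
  moreover have "eventually (\<lambda>u. X u = x\<^sub>0 + C u + L) (at_left t)"
    using s by (auto simp: eventually_at_left_field intro!: exI[of _ s] simp: X L)
  ultimately show ?thesis by (simp add: filterlim_cong)
qed

end

locale controlled_path = policy_path + control_parameters +
  assumes X_nonneg: "\<And>t. 0 \<le> t \<Longrightarrow> 0 \<le> X t"
begin

abbreviation "\<rho> \<equiv> control_time a B X A"
abbreviation "L \<equiv> control_level a B X A"
abbreviation "R \<equiv> control_ratio a B X A"
abbreviation "Z \<equiv> order_size a B X A"
abbreviation "m \<equiv> ratio_at a B X A"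

definition time where "time n = enn2real (\<rho> n)"
definition pre where "pre n = X (time (Suc n)) - (A (time (Suc n)) - L n)"
definition post where "post n = X (time (Suc n))"

section \<open>Invariant and timing of the changes of state\<close>

lemma time_nonneg: "0 \<le> time n" by (simp add: time_def)

lemma \<rho>_eq: "\<rho> n \<noteq> \<infinity> \<Longrightarrow> \<rho> n = ennreal (time n)"
  by (cases "\<rho> n") (auto simp: time_def)

lemma finite_earlier: "\<rho> n \<noteq> \<infinity> \<Longrightarrow> k \<le> n \<Longrightarrow> \<rho> k \<noteq> \<infinity>"
  using incseqD[OF control_time_mono, of k n] by (metis infinity_ennreal_def top.extremum_unique)

lemma R_Suc: "\<rho> (Suc n) \<noteq> \<infinity> \<Longrightarrow> R (Suc n) = update_ratio a B (R n) (pre n) (post n)"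
  by (simp add: control_ratio_Suc pre_def post_def time_def Let_def)

lemma L_Suc: "\<rho> (Suc n) \<noteq> \<infinity> \<Longrightarrow> L (Suc n) = A (time (Suc n))"
  by (simp add: control_level_Suc time_def)

lemma Z_eq: "\<rho> (Suc n) \<noteq> \<infinity> \<Longrightarrow> Z n = R (Suc n) * post n - R n * pre n"
  by (simp add: order_size_def pre_def post_def time_def Let_def)

text \<open>Stage 0 precedes a possible order at time 0, so \<open>L 0 = 0\<close> may differ from
  \<open>A (time 0)\<close>; this is the reason for the separate clause.\<close>

definition invariant where
  "invariant n \<longleftrightarrow> 0 < R n \<and> R n \<le> 1 \<and> (\<forall>s\<ge>time n. L n \<le> A s) \<and>
     (if n = 0 then R n = 1 \<and> L n = 0 else L n = A (time n) \<and> (R n < 1 \<longrightarrow> a < R n * X (time n)))"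

lemma no_trigger:
  assumes "\<rho> n \<noteq> \<infinity>" "time n \<le> s" "ennreal s < \<rho> (Suc n)"
  shows "A s \<le> L n" "R n < 1 \<Longrightarrow> a \<le> R n * X s"
proof -
  have s: "0 \<le> s" using assms(2) time_nonneg[of n] by linarith
  have "\<rho> n \<le> ennreal s" using assms(1,2) \<rho>_eq[of n] by (simp add: ennreal_leI)
  have "\<not> (L n < A s \<or> R n < 1 \<and> R n * X s < a)"
  proof
    assume *: "L n < A s \<or> R n < 1 \<and> R n * X s < a"
    have "\<rho> (Suc n) \<le> ennreal s"
      unfolding control_time_Suc next_time_def
      by (rule Inf_lower, rule CollectI, rule exI[of _ s]) (intro conjI refl s * \<open>\<rho> n \<le> ennreal s\<close>)
    then show False using assms(3) by simp
  qed
  then show "A s \<le> L n" "R n < 1 \<Longrightarrow> a \<le> R n * X s" by auto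
qed

lemma step:
  assumes inv: "invariant n" and fin: "\<rho> (Suc n) \<noteq> \<infinity>"
  shows step_control: "control_step k\<^sub>1 k\<^sub>2 \<eta> a B (R n) (pre n) (post n)"
    and step_time: "time n < time (Suc n) \<or> n = 0 \<and> time 0 = 0 \<and> time (Suc 0) = 0"
    and step_const: "\<And>s. time n \<le> s \<Longrightarrow> s < time (Suc n) \<Longrightarrow> A s = L n"
    and step_pre: "pre n = x\<^sub>0 + C (time (Suc n)) + L n"
proof -
  let ?t = "time (Suc n)"
  have fin': "\<rho> n \<noteq> \<infinity>" using finite_earlier[OF fin, of n] by simp
  have t: "\<rho> (Suc n) = ennreal ?t" "0 \<le> ?t" using \<rho>_eq[OF fin] time_nonneg by auto
  have le: "time n \<le> ?t"
  proof -
    have "\<rho> n \<le> \<rho> (Suc n)" by (rule incseqD[OF control_time_mono]) simp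
    then have "ennreal (time n) \<le> ennreal ?t" unfolding t(1) \<rho>_eq[OF fin', symmetric] .
    then show ?thesis using t by simp
  qed
  have before: "A s \<le> L n" "R n < 1 \<Longrightarrow> a \<le> R n * X s" if "time n \<le> s" "s < ?t" for s
    using no_trigger[OF fin' that(1)] that t time_nonneg[of n] by (auto simp: ennreal_less_iff)
  show const: "A s = L n" if "time n \<le> s" "s < ?t" for s
    using before(1)[OF that] that inv by (auto simp: invariant_def intro: antisym)
  show pre: "pre n = x\<^sub>0 + C ?t + L n" using X[OF t(2)] by (simp add: pre_def)
  have LA: "L n \<le> A ?t" using inv le by (auto simp: invariant_def)
  \<comment> \<open>The infimum need not be attained. If both conditions failed at
    \<open>?t\<close>, the second with room to spare, right continuity would make them fail on an
    interval to the right and the infimum would be larger.\<close>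
  have trig: "L n < A ?t \<or> R n < 1 \<and> R n * X ?t \<le> a"
  proof (rule ccontr)
    assume neg: "\<not> ?thesis"
    then have AL: "A ?t = L n" using LA by simp
    have "eventually (\<lambda>s. A s = L n \<and> \<not> (R n < 1 \<and> R n * X s < a)) (at ?t within {?t..})"
    proof (intro eventually_conj)
      show "eventually (\<lambda>s. A s = L n) (at ?t within {?t..})" using eventually_A_eq[OF t(2)] AL by simp
      show "eventually (\<lambda>s. \<not> (R n < 1 \<and> R n * X s < a)) (at ?t within {?t..})"
      proof (cases "R n < 1")
        case True
        then have "a < R n * X ?t" using neg by auto
        moreover have "((\<lambda>s. R n * X s) \<longlongrightarrow> R n * X ?t) (at ?t within {?t..})"
          using right_continuous_X[OF t(2)] by (intro tendsto_intros) (simp add: continuous_within)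
        ultimately have "eventually (\<lambda>s. a < R n * X s) (at ?t within {?t..})" by (rule order_tendstoD(1)[rotated])
        then show ?thesis by eventually_elim auto
      qed simp
    qed
    then obtain \<epsilon> where \<epsilon>: "0 < \<epsilon>" "\<And>s. s \<in> {?t..} \<Longrightarrow> s \<noteq> ?t \<Longrightarrow> dist s ?t < \<epsilon> \<Longrightarrow> A s = L n \<and> \<not> (R n < 1 \<and> R n * X s < a)"
      unfolding eventually_at by auto
    have "\<rho> (Suc n) \<ge> ennreal (?t + \<epsilon>)"
      unfolding control_time_Suc next_time_def
    proof (rule Inf_greatest)
      fix u assume "u \<in> {ennreal t |t. 0 \<le> t \<and> \<rho> n \<le> ennreal t \<and> (L n < A t \<or> R n < 1 \<and> R n * X t < a)}"
      then obtain s where u: "u = ennreal s" and s: "0 \<le> s" "\<rho> n \<le> ennreal s" "L n < A s \<or> R n < 1 \<and> R n * X s < a"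
        by auto
      have "time n \<le> s" using s(1,2) \<rho>_eq[OF fin'] by (simp add: time_nonneg)
      show "ennreal (?t + \<epsilon>) \<le> u"
        unfolding u
      proof (rule ccontr)
        assume "\<not> ennreal (?t + \<epsilon>) \<le> ennreal s"
        then have "s < ?t + \<epsilon>" by (meson ennreal_leI not_le)
        then consider "s < ?t" | "s = ?t" | "?t < s" "dist s ?t < \<epsilon>"
          by (cases s ?t rule: linorder_cases) (auto simp: dist_real_def)
        then show False
        proof cases
          case 1
          then show False using s(3) before[OF \<open>time n \<le> s\<close>] by linarith
        next
          case 2
          then show False using s(3) neg by auto
        next
          case 3
          then show False using s(3) \<epsilon>(2)[of s] by auto
        qed
      qed
    qed
    then show False using \<epsilon>(1) t by simp
  qed
  \<comment> \<open>After a change at a later stage nothing is pending: all orders made at that time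
    are contained in \<open>L n\<close>, and the level is strictly above \<open>a\<close>. Only the
    initial state can change at its own time.\<close>
  show time: "time n < ?t \<or> n = 0 \<and> time 0 = 0 \<and> time (Suc 0) = 0"
  proof (cases "time n < ?t")
    case False
    then have eq: "time n = ?t" using le by simp
    have "n = 0"
    proof (rule ccontr)
      assume "n \<noteq> 0"
      then have "L n = A ?t" "R n < 1 \<longrightarrow> a < R n * X ?t" using inv eq by (auto simp: invariant_def)
      with trig show False by auto
    qed
    then show ?thesis using eq by (simp add: time_def)
  qed simp
  \<comment> \<open>If time has passed since the last change, \<open>pre n\<close> is the left limit
    of \<open>X\<close> and inherits the bounds valid between the changes. Otherwise it is
    \<open>x\<^sub>0\<close> and the ratio is 1.\<close>
  have "0 \<le> pre n \<and> (R n < 1 \<longrightarrow> a \<le> R n * pre n)"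
  proof (cases "time n < ?t")
    case True
    have lim: "(X \<longlongrightarrow> pre n) (at_left ?t)"
      unfolding pre by (rule X_tendsto_left[OF time_nonneg True]) (use const in auto)
    have ev: "eventually (\<lambda>s. time n < s \<and> s < ?t) (at_left ?t)"
      using True by (auto simp: eventually_at_left_field)
    have "0 \<le> pre n"
      by (rule tendsto_lowerbound[OF lim])
         (use ev time_nonneg[of n] in \<open>auto elim!: eventually_mono intro!: X_nonneg\<close>)
    moreover have "a \<le> R n * pre n" if "R n < 1"
      by (rule tendsto_lowerbound[OF tendsto_mult_left[OF lim]])
         (use ev before(2) that in \<open>auto elim!: eventually_mono\<close>)
    ultimately show ?thesis by simp
  next
    case False
    then have "n = 0" "?t = 0" using time by auto
    then show ?thesis using pre inv C x\<^sub>0 by (simp add: invariant_def)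
  qed
  then have pre': "0 \<le> pre n" "R n < 1 \<Longrightarrow> a \<le> R n * pre n" by auto
  have R: "0 < R n" "R n \<le> 1" using inv by (auto simp: invariant_def)
  have le': "pre n \<le> post n" using LA by (simp add: pre_def post_def)
  have "pre n < post n \<or> R n < 1 \<and> R n * pre n \<le> a"
  proof (cases "L n < A ?t")
    case False
    then have "A ?t = L n" using LA by simp
    then show ?thesis using trig by (simp add: pre_def)
  qed (simp add: pre_def post_def)
  with pre' R le' show "control_step k\<^sub>1 k\<^sub>2 \<eta> a B (R n) (pre n) (post n)"
    by (intro control_step.intro control_step_axioms.intro control_parameters_axioms)
qed

lemma invariant: "\<rho> n \<noteq> \<infinity> \<Longrightarrow> invariant n"
proof (induction n)
  case 0
  then show ?case using A_nonneg by (auto simp: invariant_def time_def)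
next
  case (Suc n)
  then have inv: "invariant n" using finite_earlier[of "Suc n" n] by auto
  interpret control_step k\<^sub>1 k\<^sub>2 \<eta> a B "R n" "pre n" "post n" by (rule step_control[OF inv Suc.prems])
  show ?case
    using update_ratio_bounds R_Suc[OF Suc.prems] L_Suc[OF Suc.prems] A_mono[OF time_nonneg]
    by (auto simp: invariant_def post_def)
qed

lemma control_stepI: "\<rho> (Suc n) \<noteq> \<infinity> \<Longrightarrow> control_step k\<^sub>1 k\<^sub>2 \<eta> a B (R n) (pre n) (post n)"
  using step_control invariant finite_earlier[of "Suc n" n] by auto

lemma R_bounds: "0 < R n" "R n \<le> 1"
proof -
  have "0 < R n \<and> R n \<le> 1"
  proof (induction n)
    case (Suc n)
    show ?case
    proof (cases "\<rho> (Suc n) = \<infinity>")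
      case True
      then show ?thesis using Suc by (simp add: control_ratio_Suc)
    next
      case False
      then show ?thesis using invariant[OF False] by (auto simp: invariant_def)
    qed
  qed simp
  then show "0 < R n" "R n \<le> 1" by auto
qed

section \<open>Variation of the ratio\<close>

lemma L_Suc_diff: "\<rho> (Suc n) \<noteq> \<infinity> \<Longrightarrow> post n - pre n = L (Suc n) - L n"
  by (simp add: pre_def post_def L_Suc)

lemma L_mono: "L n \<le> L (Suc n)"
proof (cases "\<rho> (Suc n) = \<infinity>")
  case False
  interpret control_step k\<^sub>1 k\<^sub>2 \<eta> a B "R n" "pre n" "post n" by (rule control_stepI[OF False])
  show ?thesis using yz L_Suc_diff[OF False] by linarith
qed (simp add: control_level_Suc)

lemma L_le_A:
  assumes "\<rho> n \<le> ennreal t" "0 \<le> t"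
  shows "L n \<le> A t"
proof -
  have fin: "\<rho> n \<noteq> \<infinity>" using assms by (auto simp: top_unique)
  have "time n \<le> t" using assms \<rho>_eq[OF fin] by (simp add: time_nonneg)
  then show ?thesis using invariant[OF fin] by (auto simp: invariant_def)
qed

lemma Z_nonneg: "0 \<le> Z n"
proof (cases "\<rho> (Suc n) = \<infinity>")
  case False
  interpret control_step k\<^sub>1 k\<^sub>2 \<eta> a B "R n" "pre n" "post n" by (rule control_stepI[OF False])
  show ?thesis using update_ratio_bounds(4) by (simp add: Z_eq[OF False] R_Suc[OF False])
qed (simp add: order_size_def)

text \<open>An absolute value is the number itself plus twice its negative part, and
  \<open>ratio_decrease\<close> bounds the latter. In this form both terms telescope.\<close>

lemma variation_step: "\<bar>R (Suc n) - R n\<bar> \<le> (R (Suc n) - R n) + 2 * ((L (Suc n) - L n) / a)"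
proof (cases "\<rho> (Suc n) = \<infinity>")
  case False
  interpret control_step k\<^sub>1 k\<^sub>2 \<eta> a B "R n" "pre n" "post n" by (rule control_stepI[OF False])
  have "0 \<le> (L (Suc n) - L n) / a" using L_mono[of n] a by simp
  then show ?thesis using ratio_decrease unfolding R_Suc[OF False] L_Suc_diff[OF False] by linarith
qed (simp add: control_ratio_Suc control_level_Suc)

text \<open>The bound is independent of \<open>N\<close> and therefore covers infinitely many
  changes up to time \<open>t\<close>.\<close>

lemma variation_bounded:
  assumes t: "0 \<le> t"
  shows "(\<Sum>n<N. if \<rho> (Suc n) \<le> ennreal t then \<bar>R (Suc n) - R n\<bar> else 0) \<le> 1 + 2 * (A t / a)"
proof -
  define K where "K = card {n. n < N \<and> \<rho> (Suc n) \<le> ennreal t}"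
  have "\<exists>K\<le>N. \<forall>n<N. \<rho> (Suc n) \<le> ennreal t \<longleftrightarrow> n < K"
  proof (induction N)
    case (Suc N)
    then obtain K where K: "K \<le> N" "\<forall>n<N. \<rho> (Suc n) \<le> ennreal t \<longleftrightarrow> n < K" by blast
    show ?case
    proof (cases "\<rho> (Suc N) \<le> ennreal t")
      case True
      then have "\<rho> (Suc n) \<le> ennreal t" if "n < Suc N" for n
        using that incseqD[OF control_time_mono, of "Suc n" "Suc N"] by (meson Suc_le_mono less_Suc_eq_le order.trans)
      then show ?thesis by (intro exI[of _ "Suc N"]) auto
    next
      case False
      then show ?thesis using K by (intro exI[of _ K]) (auto simp: less_Suc_eq)
    qed
  qed simp
  then obtain K where K: "K \<le> N" "\<And>n. n < N \<Longrightarrow> \<rho> (Suc n) \<le> ennreal t \<longleftrightarrow> n < K" by blast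
  have "(\<Sum>n<N. if \<rho> (Suc n) \<le> ennreal t then \<bar>R (Suc n) - R n\<bar> else 0) = (\<Sum>n<K. \<bar>R (Suc n) - R n\<bar>)"
    using K by (intro sum.mono_neutral_cong_right) auto
  also have "\<dots> \<le> (\<Sum>n<K. (R (Suc n) - R n) + 2 * ((L (Suc n) - L n) / a))"
    by (intro sum_mono variation_step)
  also have "\<dots> = (R K - R 0) + 2 * ((L K - L 0) / a)"
    by (simp only: sum.distrib sum_distrib_left[symmetric] sum_divide_distrib[symmetric] sum_lessThan_telescope)
  also have "\<dots> \<le> 1 + 2 * (A t / a)"
  proof -
    have "L K \<le> A t"
    proof (cases K)
      case (Suc k)
      then show ?thesis using K t by (intro L_le_A) auto
    qed (use A_nonneg t in simp)
    then have "(L K - L 0) / a \<le> A t / a" using a by (intro divide_right_mono) auto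
    then show ?thesis using R_bounds(2)[of K] by simp
  qed
  finally show ?thesis .
qed

lemma variation_summable:
  assumes t: "0 \<le> t"
  shows "summable (\<lambda>n. if \<rho> (Suc n) \<le> ennreal t then \<bar>R (Suc n) - R n\<bar> else 0)"
  by (rule bounded_imp_summable[where B="1 + 2 * (A t / a)"])
     (use variation_bounded[OF t, of "Suc _"] in \<open>auto simp: lessThan_Suc_atMost\<close>)

end

section \<open>Accumulation of changes and the total amount ordered\<close>

context controlled_path
begin

text \<open>The second case is an accumulation of infinitely many changes by time
  \<open>t\<close>.\<close>

lemma position_cases:
  obtains (between) n where "\<rho> n \<le> ennreal t" "ennreal t < \<rho> (Suc n)" | (all) "\<And>n. \<rho> n \<le> ennreal t"
proof (cases "\<forall>n. \<rho> n \<le> ennreal t")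
  case False
  define n where "n = (LEAST n. \<not> \<rho> n \<le> ennreal t)"
  have n: "\<not> \<rho> n \<le> ennreal t" using False unfolding n_def by (metis LeastI)
  then obtain k where k: "n = Suc k" by (cases n) auto
  have "\<rho> k \<le> ennreal t" using not_less_Least[of k "\<lambda>n. \<not> \<rho> n \<le> ennreal t"] k n_def by auto
  then show ?thesis using between[of k] n k by (simp add: not_le)
qed (use all in auto)

lemma before_iff:
  assumes "\<rho> n \<le> ennreal t" "ennreal t < \<rho> (Suc n)"
  shows "\<rho> (Suc k) \<le> ennreal t \<longleftrightarrow> k < n"
proof
  assume le: "\<rho> (Suc k) \<le> ennreal t"
  show "k < n"
  proof (rule ccontr)
    assume "\<not> k < n"
    then have "\<rho> (Suc n) \<le> \<rho> (Suc k)" by (intro incseqD[OF control_time_mono]) simp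
    with le assms(2) show False by (meson leD order.trans)
  qed
next
  assume "k < n"
  then have "\<rho> (Suc k) \<le> \<rho> n" by (intro incseqD[OF control_time_mono]) simp
  with assms(1) show "\<rho> (Suc k) \<le> ennreal t" by (rule order.trans[rotated])
qed

lemma suminf_before:
  assumes "\<rho> n \<le> ennreal t" "ennreal t < \<rho> (Suc n)"
  shows "(\<lambda>k. if \<rho> (Suc k) \<le> ennreal t then f k else 0) sums (\<Sum>k<n. f k :: real)"
  unfolding before_iff[OF assms] using sums_If_finite_set[of "{..<n}" f] by simp

lemma ratio_between:
  assumes "\<rho> n \<le> ennreal t" "ennreal t < \<rho> (Suc n)"
  shows "m t = R n"
  using suminf_before[OF assms, of "\<lambda>n. R (Suc n) - R n"]
  by (simp add: ratio_at_def sums_iff sum_lessThan_telescope)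

lemma A_between:
  assumes t: "0 \<le> t" and "\<rho> n \<le> ennreal t" "ennreal t < \<rho> (Suc n)"
  shows "A t = L n"
proof (rule antisym)
  have fin: "\<rho> n \<noteq> \<infinity>" using assms(2) by (auto simp: top_unique)
  have "time n \<le> t" using assms(1,2) \<rho>_eq[OF fin] by (simp add: time_nonneg)
  from no_trigger(1)[OF fin this assms(3)] show "A t \<le> L n" .
qed (rule L_le_A[OF assms(2) t])

text \<open>From an index with no further original orders on, every change would lower the
  nonnegative potential by at least \<open>k\<^sub>1\<close>.\<close>

lemma ordered_infinitely_often:
  assumes fin: "\<And>n. \<rho> n \<noteq> \<infinity>"
  shows "\<exists>n\<ge>N. L n < L (Suc n)"
proof (rule ccontr)
  assume neg: "\<not> ?thesis"
  have hit: "potential k\<^sub>1 k\<^sub>2 \<eta> a (R (Suc n)) + k\<^sub>1 \<le> potential k\<^sub>1 k\<^sub>2 \<eta> a (R n)" if "N \<le> n" for n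
  proof -
    interpret control_step k\<^sub>1 k\<^sub>2 \<eta> a B "R n" "pre n" "post n" by (rule control_stepI[OF fin])
    have "\<not> L n < L (Suc n)" using neg that by blast
    then have "L (Suc n) = L n" using L_mono[of n] by linarith
    then have "pre n = post n" using L_Suc_diff[OF fin[of "Suc n"]] by simp
    then show ?thesis using hit_decreases_potential by (simp add: R_Suc[OF fin])
  qed
  have "potential k\<^sub>1 k\<^sub>2 \<eta> a (R (N + j)) + real j * k\<^sub>1 \<le> potential k\<^sub>1 k\<^sub>2 \<eta> a (R N)" for j
  proof (induction j)
    case (Suc j)
    then show ?case using hit[of "N + j"] by (simp add: algebra_simps)
  qed simp
  then have "real j * k\<^sub>1 \<le> potential k\<^sub>1 k\<^sub>2 \<eta> a (R N)" for j
    using potential_nonneg[OF R_bounds(1)[of "N + j"]] by (smt (verit))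
  then show False using k\<^sub>1 reals_Archimedean3[of k\<^sub>1] by (meson not_le)
qed

text \<open>The total is constant on the interval before the change, so its increase at the change
  cannot come from earlier orders and some order must be placed at that very time.\<close>

lemma order_at_jump:
  assumes fin: "\<rho> (Suc n) \<noteq> \<infinity>" and jump: "L n < L (Suc n)"
  shows "\<exists>k. \<tau> k = \<rho> (Suc n)"
proof (rule ccontr)
  assume neg: "\<not> ?thesis"
  define t where "t = time (Suc n)"
  have t: "\<rho> (Suc n) = ennreal t" "0 \<le> t" using \<rho>_eq[OF fin] time_nonneg by (auto simp: t_def)
  have inv: "invariant n" using invariant finite_earlier[OF fin, of n] by simp
  have Lt: "L (Suc n) = A t" using L_Suc[OF fin] by (simp add: t_def)
  show False
  proof (cases "time n < t")
    case True
    have "A t \<le> L n"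
      unfolding A[OF t(2)]
    proof (rule suminf_le_const[OF summ[OF t(2)]])
      fix K
      show "(\<Sum>k<K. if \<tau> k \<le> ennreal t then Y k else 0) \<le> L n"
      proof -
        \<comment> \<open>The latest of the finitely many order times counted by the partial sum,
          but not before \<open>time n\<close>. It lies strictly before \<open>t\<close>, where the
          total still equals \<open>L n\<close>.\<close>
        define s where "s = Max (insert (time n) ((\<lambda>k. enn2real (\<tau> k)) ` {k. k < K \<and> \<tau> k \<le> ennreal t}))"
        have s1: "time n \<le> s" "\<And>k. k < K \<Longrightarrow> \<tau> k \<le> ennreal t \<Longrightarrow> enn2real (\<tau> k) \<le> s"
          unfolding s_def by (auto intro: Max_ge)
        have "s \<in> insert (time n) ((\<lambda>k. enn2real (\<tau> k)) ` {k. k < K \<and> \<tau> k \<le> ennreal t})"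
          unfolding s_def by (rule Max_in) auto
        then have s2: "s < t"
        proof safe
          fix k assume k: "\<tau> k \<le> ennreal t"
          then have "\<tau> k < ennreal t" using neg t(1) by (metis order.not_eq_order_implies_strict)
          then show "enn2real (\<tau> k) < t" using t(2) by (cases "\<tau> k") (auto simp: ennreal_less_iff)
        qed (use True in simp)
        have s0: "0 \<le> s" using s1(1) time_nonneg[of n] by linarith
        have "(\<Sum>k<K. if \<tau> k \<le> ennreal t then Y k else 0) \<le> (\<Sum>k<K. if \<tau> k \<le> ennreal s then Y k else 0)"
        proof (rule sum_mono)
          fix k assume "k \<in> {..<K}"
          then have "\<tau> k \<le> ennreal s" if "\<tau> k \<le> ennreal t"
            using s1(2)[of k] that by (cases "\<tau> k") (auto simp: top_unique intro: ennreal_leI)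
          then show "(if \<tau> k \<le> ennreal t then Y k else 0) \<le> (if \<tau> k \<le> ennreal s then Y k else 0)"
            using Y by auto
        qed
        also have "\<dots> \<le> A s"
          unfolding A[OF s0] using Y by (intro sum_le_suminf summ s0) auto
        also have "A s = L n"
          using step_const[OF inv fin s1(1)] s2 by (simp add: t_def)
        finally show ?thesis .
      qed
    qed
    then show False using jump Lt by simp
  next
    case False
    then have n: "n = 0" and t0: "t = 0" using step_time[OF inv fin] by (auto simp: t_def)
    have "A 0 = 0"
      using neg t t0 by (subst A) (auto intro!: suminf_zero)
    then show False using jump Lt n t0 by simp
  qed
qed

lemma time_strict: "\<rho> (Suc (Suc n)) \<noteq> \<infinity> \<Longrightarrow> \<rho> (Suc n) < \<rho> (Suc (Suc n))"
proof -
  assume fin: "\<rho> (Suc (Suc n)) \<noteq> \<infinity>"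
  then have fin': "\<rho> (Suc n) \<noteq> \<infinity>" using finite_earlier[of "Suc (Suc n)" "Suc n"] by simp
  have "time (Suc n) < time (Suc (Suc n))" using step_time[OF invariant[OF fin'] fin] by auto
  then show ?thesis using \<rho>_eq[OF fin] \<rho>_eq[OF fin'] by (metis ennreal_less_iff time_nonneg)
qed

lemma time_strict_mono:
  assumes "n < k" "\<rho> (Suc k) \<noteq> \<infinity>"
  shows "\<rho> (Suc n) < \<rho> (Suc k)"
proof -
  have "\<rho> (Suc (Suc n)) \<noteq> \<infinity>" using finite_earlier[OF assms(2), of "Suc (Suc n)"] assms(1) by simp
  then have "\<rho> (Suc n) < \<rho> (Suc (Suc n))" by (rule time_strict)
  also have "\<dots> \<le> \<rho> (Suc k)" using assms(1) by (intro incseqD[OF control_time_mono]) simp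
  finally show ?thesis .
qed

definition jumps where "jumps = {n. \<rho> (Suc n) \<noteq> \<infinity> \<and> L n < L (Suc n)}"
text \<open>Original orders may coincide. Choosing one of them for each jump gives a lower bound of
  the original cost, and the choice is injective because the changes after the initial state happen
  at strictly increasing times.\<close>

definition jump_order where "jump_order n = (SOME k. \<tau> k = \<rho> (Suc n))"

lemma jump_order: "n \<in> jumps \<Longrightarrow> \<tau> (jump_order n) = \<rho> (Suc n)"
  unfolding jump_order_def jumps_def by (rule someI_ex) (use order_at_jump in auto)

lemma inj_jump_order: "inj_on jump_order jumps"
proof (rule inj_onI)
  fix n k assume *: "n \<in> jumps" "k \<in> jumps" "jump_order n = jump_order k"
  then have "\<rho> (Suc n) = \<rho> (Suc k)" using jump_order by metis
  with * show "n = k"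
    using time_strict_mono[of n k] time_strict_mono[of k n] by (cases n k rule: linorder_cases) (auto simp: jumps_def)
qed

lemma infinite_jumps: "(\<And>n. \<rho> n \<noteq> \<infinity>) \<Longrightarrow> infinite jumps"
  unfolding jumps_def infinite_nat_iff_unbounded_le using ordered_infinitely_often by blast

text \<open>The injective \<open>jump_order\<close> takes arbitrarily large values on the infinite
  set of jumps, so the changes overtake every original order time.\<close>

lemma late_jump:
  assumes fin: "\<And>n. \<rho> n \<noteq> \<infinity>"
  obtains n where "n \<in> jumps" "\<tau> K \<le> \<rho> (Suc n)"
proof -
  have "infinite (jump_order ` jumps)"
    using finite_imageD[OF _ inj_jump_order] infinite_jumps[OF fin] by blast
  then obtain k where "k \<ge> K" "k \<in> jump_order ` jumps" unfolding infinite_nat_iff_unbounded_le by blast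
  then show ?thesis using that jump_order incseqD[OF \<tau>, of K k] by auto
qed

text \<open>By \<open>late_jump\<close> every partial sum of the original orders is eventually
  contained in some \<open>L n\<close>, so nothing is lost at the accumulation point.\<close>

lemma L_tendsto:
  assumes t: "0 \<le> t" and all: "\<And>n. \<rho> n \<le> ennreal t"
  shows "L \<longlonglongrightarrow> A t"
proof (rule order_tendstoI)
  have fin: "\<rho> n \<noteq> \<infinity>" for n using all[of n] by (auto simp: top_unique)
  have mono: "incseq L" by (simp add: incseq_Suc_iff L_mono)
  fix x assume "x < A t"
  then have "eventually (\<lambda>K. x < (\<Sum>k<K. if \<tau> k \<le> ennreal t then Y k else 0)) sequentially"
    using summable_LIMSEQ[OF summ[OF t]] by (auto simp: A[OF t] dest: order_tendstoD)
  then obtain K where K: "x < (\<Sum>k<K. if \<tau> k \<le> ennreal t then Y k else 0)" by (auto simp: eventually_sequentially)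
  obtain n where n: "\<tau> K \<le> \<rho> (Suc n)" using late_jump[OF fin] by metis
  have "(\<Sum>k<K. if \<tau> k \<le> ennreal t then Y k else 0) \<le> (\<Sum>k<K. if \<tau> k \<le> ennreal (time (Suc n)) then Y k else 0)"
  proof (rule sum_mono)
    fix k assume "k \<in> {..<K}"
    then have "\<tau> k \<le> ennreal (time (Suc n))"
      using incseqD[OF \<tau>, of k K] n \<rho>_eq[OF fin[of "Suc n"]] by auto
    then show "(if \<tau> k \<le> ennreal t then Y k else 0) \<le> (if \<tau> k \<le> ennreal (time (Suc n)) then Y k else 0)"
      using Y by auto
  qed
  also have "\<dots> \<le> A (time (Suc n))"
    unfolding A[OF time_nonneg] using Y by (intro sum_le_suminf summ time_nonneg) auto
  also have "\<dots> = L (Suc n)" using L_Suc[OF fin] by simp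
  finally have "x < L (Suc n)" using K by simp
  then show "eventually (\<lambda>n. x < L n) sequentially"
    unfolding eventually_sequentially using incseqD[OF mono, of "Suc n"] by (meson less_le_trans)
next
  fix x assume "A t < x"
  then show "eventually (\<lambda>n. L n < x) sequentially"
    using L_le_A[OF all t] by (intro always_eventually allI) (meson le_less_trans)
qed

text \<open>\<open>X - A\<close> is the same before and after an order, so each size splits into a
  difference of consecutive products \<open>R * L\<close> and a jump of the ratio times
  \<open>X - A\<close>. The first part telescopes to \<open>m t * A t\<close>; together they form
  the order term of \<open>gbm_equation_rescale\<close>.\<close>

lemma order_sizes_sums:
  assumes t: "0 \<le> t"
  shows "(\<lambda>n. if \<rho> (Suc n) \<le> ennreal t then Z n else 0) sums
    (m t * A t + (\<Sum>n. if \<rho> (Suc n) \<le> ennreal t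
       then (R (Suc n) - R n) * (X (time (Suc n)) - A (time (Suc n))) else 0))"
proof -
  let ?c = "\<lambda>n. \<rho> (Suc n) \<le> ennreal t"
  have fin: "\<rho> (Suc n) \<noteq> \<infinity>" if "?c n" for n using that by (auto simp: top_unique)
  have time: "time (Suc n) \<in> {0..t}" if "?c n" for n
    using that \<rho>_eq[OF fin[OF that]] time_nonneg[of "Suc n"] t by simp
  obtain D where D: "\<And>s. s \<in> {0..t} \<Longrightarrow> \<bar>x\<^sub>0 + C s\<bar> \<le> D"
  proof -
    have "continuous_on {0..t} (\<lambda>s. x\<^sub>0 + C s)" using C(1) by (auto intro!: continuous_intros intro: continuous_on_subset)
    from compact_imp_bounded[OF compact_continuous_image[OF this compact_Icc]] show ?thesis
      using that unfolding bounded_iff real_norm_def by blast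
  qed
  have w: "X (time (Suc n)) - A (time (Suc n)) = x\<^sub>0 + C (time (Suc n))" for n
    using X[OF time_nonneg] by simp
  have "summable (\<lambda>n. if ?c n then (R (Suc n) - R n) * (X (time (Suc n)) - A (time (Suc n))) else 0)"
  proof (rule summable_comparison_test')
    show "summable (\<lambda>n. (if ?c n then \<bar>R (Suc n) - R n\<bar> else 0) * D)"
      by (intro summable_mult2 variation_summable t)
    fix n
    show "norm (if ?c n then (R (Suc n) - R n) * (X (time (Suc n)) - A (time (Suc n))) else 0)
        \<le> (if ?c n then \<bar>R (Suc n) - R n\<bar> else 0) * D"
      using D[OF time, of n] by (auto simp: w abs_mult intro: mult_left_mono)
  qed
  note part1 = summable_sums[OF this]
  have part2: "(\<lambda>n. if ?c n then R (Suc n) * L (Suc n) - R n * L n else 0) sums (m t * A t)"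
  proof (cases rule: position_cases[of t])
    case (between n)
    have "(\<Sum>k<n. R (Suc k) * L (Suc k) - R k * L k) = m t * A t"
      by (simp add: sum_lessThan_telescope[of "\<lambda>k. R k * L k"] ratio_between[OF between] A_between[OF t between])
    then show ?thesis using suminf_before[OF between, of "\<lambda>k. R (Suc k) * L (Suc k) - R k * L k"] by simp
  next
    case all
    have c: "?c n" for n using all by blast
    \<comment> \<open>After infinitely many changes the telescoped products still converge: the
      ratios tend to \<open>m t\<close> because their variation is finite, and the totals tend to
      \<open>A t\<close>.\<close>
    have "summable (\<lambda>n. R (Suc n) - R n)"
      using variation_summable[OF t] c by (simp add: summable_rabs_cancel)
    then have "(\<lambda>N. \<Sum>n<N. R (Suc n) - R n) \<longlonglongrightarrow> (\<Sum>n. R (Suc n) - R n)" by (rule summable_LIMSEQ)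
    then have "(\<lambda>N. 1 + (R N - 1)) \<longlonglongrightarrow> 1 + (\<Sum>n. R (Suc n) - R n)"
      by (intro tendsto_add tendsto_const) (simp add: sum_lessThan_telescope)
    then have "R \<longlonglongrightarrow> m t" using c by (simp add: ratio_at_def)
    then have "(\<lambda>n. R n * L n) \<longlonglongrightarrow> m t * A t" using L_tendsto[OF t all] by (rule tendsto_mult)
    from telescope_sums[OF this] show ?thesis using c by simp
  qed
  have "(if ?c n then Z n else 0) = (if ?c n then R (Suc n) * L (Suc n) - R n * L n else 0) +
      (if ?c n then (R (Suc n) - R n) * (X (time (Suc n)) - A (time (Suc n))) else 0)" for n
    using Z_eq[OF fin, of n] L_Suc[OF fin, of n] by (auto simp: pre_def post_def algebra_simps)
  then show ?thesis using sums_add[OF part2 part1] by simp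
qed

lemma modified_left_limit:
  assumes fin: "\<rho> (Suc n) \<noteq> \<infinity>"
  shows "(if time (Suc n) = 0 then x\<^sub>0 else Lim (at_left (time (Suc n))) (\<lambda>s. m s * X s)) = R n * pre n"
    and "(if time (Suc n) = 0 then x\<^sub>0 else Lim (at_left (time (Suc n))) X) = pre n"
proof -
  let ?t = "time (Suc n)"
  have fin': "\<rho> n \<noteq> \<infinity>" using finite_earlier[OF fin, of n] by simp
  have inv: "invariant n" using invariant[OF fin'] .
  have "(if ?t = 0 then x\<^sub>0 else Lim (at_left ?t) (\<lambda>s. m s * X s)) = R n * pre n \<and>
      (if ?t = 0 then x\<^sub>0 else Lim (at_left ?t) X) = pre n"
  proof (cases "?t = 0")
    case True
    then have "n = 0" using step_time[OF inv fin] time_nonneg[of n] by auto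
    then show ?thesis using True step_pre[OF inv fin] C by simp
  next
    case False
    then have less: "time n < ?t" using step_time[OF inv fin] by auto
    have lim: "(X \<longlongrightarrow> pre n) (at_left ?t)"
      unfolding step_pre[OF inv fin] by (rule X_tendsto_left[OF time_nonneg less]) (rule step_const[OF inv fin])
    have "eventually (\<lambda>s. m s * X s = R n * X s) (at_left ?t)"
      unfolding eventually_at_left_field
    proof (intro exI[of _ "time n"] conjI less allI impI)
      fix s assume s: "time n < s" "s < ?t"
      have "\<rho> n \<le> ennreal s" unfolding \<rho>_eq[OF fin'] using s by (intro ennreal_leI) simp
      moreover have "ennreal s < \<rho> (Suc n)"
        unfolding \<rho>_eq[OF fin] using s time_nonneg[of n] by (simp add: ennreal_less_iff)
      ultimately show "m s * X s = R n * X s" using ratio_between by simp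
    qed
    then have "((\<lambda>s. m s * X s) \<longlongrightarrow> R n * pre n) (at_left ?t)"
      by (rule tendsto_cong[THEN iffD2, OF _ tendsto_mult_left[OF lim]])
    then show ?thesis using False lim by (auto intro!: tendsto_Lim)
  qed
  then show "(if ?t = 0 then x\<^sub>0 else Lim (at_left ?t) (\<lambda>s. m s * X s)) = R n * pre n"
    "(if ?t = 0 then x\<^sub>0 else Lim (at_left ?t) X) = pre n" by auto
qed

lemma modified_level:
  assumes fin: "\<rho> (Suc n) \<noteq> \<infinity>"
  shows "m (time (Suc n)) * X (time (Suc n)) = R (Suc n) * post n"
proof -
  have "\<rho> (Suc n) < \<rho> (Suc (Suc n))"
  proof (cases "\<rho> (Suc (Suc n)) = \<infinity>")
    case True
    then show ?thesis using fin by (simp add: top.not_eq_extremum)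
  qed (rule time_strict)
  then have "m (time (Suc n)) = R (Suc n)"
    by (intro ratio_between) (simp_all add: \<rho>_eq[OF fin, symmetric])
  then show ?thesis by (simp add: post_def)
qed

lemma order_level_bounds:
  assumes "0 < Z n"
  shows "\<rho> (Suc n) \<noteq> \<infinity>" "0 < R (Suc n) * post n" "R (Suc n) * post n \<le> B"
proof -
  show fin: "\<rho> (Suc n) \<noteq> \<infinity>" using assms by (auto simp: order_size_def)
  interpret control_step k\<^sub>1 k\<^sub>2 \<eta> a B "R n" "pre n" "post n" by (rule control_stepI[OF fin])
  show "0 < R (Suc n) * post n" using z_pos R_bounds by simp
  show "R (Suc n) * post n \<le> B" using order_level assms by (simp add: Z_eq[OF fin] R_Suc[OF fin])
qed

section \<open>Comparison of the costs along a path\<close>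

definition original_cost where
  "original_cost n = (if pre n < post n then ordering_cost k\<^sub>1 k\<^sub>2 \<eta> (pre n) (post n) else 0)"
definition modified_cost where
  "modified_cost n = (if 0 < Z n then ordering_cost k\<^sub>1 k\<^sub>2 \<eta> (R n * pre n) (R (Suc n) * post n) else 0)"

lemma cost_nonneg:
  assumes fin: "\<rho> (Suc n) \<noteq> \<infinity>"
  shows "0 \<le> original_cost n" "0 \<le> modified_cost n" "pre n < post n \<Longrightarrow> k\<^sub>1 \<le> original_cost n"
proof -
  interpret control_step k\<^sub>1 k\<^sub>2 \<eta> a B "R n" "pre n" "post n" by (rule control_stepI[OF fin])
  have "(R n * pre n) powr \<eta> \<le> (R (Suc n) * post n) powr \<eta>"
    using update_ratio_bounds(4) R y \<eta> unfolding R_Suc[OF fin] by (intro powr_mono2) auto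
  moreover have "pre n powr \<eta> \<le> post n powr \<eta>" using y yz \<eta> by (intro powr_mono2) auto
  ultimately show "0 \<le> original_cost n" "0 \<le> modified_cost n" "pre n < post n \<Longrightarrow> k\<^sub>1 \<le> original_cost n"
    using k\<^sub>1 k\<^sub>2 by (auto simp: original_cost_def modified_cost_def ordering_cost_def)
qed

text \<open>Induction with \<open>cost_step\<close>. The potential is kept only while stage
  \<open>N\<close> is reached by time \<open>t\<close>; after that it is dropped from the smaller
  side.\<close>

lemma costs_telescope:
  "(\<Sum>n<N. if \<rho> (Suc n) \<le> ennreal t then ennreal (modified_cost n) else 0) +
     (if \<rho> N \<le> ennreal t then ennreal (potential k\<^sub>1 k\<^sub>2 \<eta> a (R N)) else 0)
   \<le> (\<Sum>n<N. if \<rho> (Suc n) \<le> ennreal t then ennreal (original_cost n) else 0)"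
proof (induction N)
  case 0
  then show ?case by (simp add: potential_def)
next
  case (Suc N)
  show ?case
  proof (cases "\<rho> (Suc N) \<le> ennreal t")
    case True
    then have fin: "\<rho> (Suc N) \<noteq> \<infinity>" by (auto simp: top_unique)
    have "\<rho> N \<le> \<rho> (Suc N)" by (rule incseqD[OF control_time_mono]) simp
    then have N: "\<rho> N \<le> ennreal t" using True by simp
    interpret control_step k\<^sub>1 k\<^sub>2 \<eta> a B "R N" "pre N" "post N" by (rule control_stepI[OF fin])
    have "modified_cost N + potential k\<^sub>1 k\<^sub>2 \<eta> a (R (Suc N)) \<le> potential k\<^sub>1 k\<^sub>2 \<eta> a (R N) + original_cost N"
    proof -
      have "modified_cost N = (if R N * pre N < R' * post N
          then ordering_cost k\<^sub>1 k\<^sub>2 \<eta> (R N * pre N) (R' * post N) else 0)"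
        by (simp add: modified_cost_def Z_eq[OF fin] R_Suc[OF fin])
      then show ?thesis using cost_step unfolding original_cost_def R_Suc[OF fin] by linarith
    qed
    then have "ennreal (modified_cost N + potential k\<^sub>1 k\<^sub>2 \<eta> a (R (Suc N))) \<le>
        ennreal (potential k\<^sub>1 k\<^sub>2 \<eta> a (R N) + original_cost N)" by (rule ennreal_leI)
    then have "ennreal (modified_cost N) + ennreal (potential k\<^sub>1 k\<^sub>2 \<eta> a (R (Suc N))) \<le>
        ennreal (potential k\<^sub>1 k\<^sub>2 \<eta> a (R N)) + ennreal (original_cost N)"
      using cost_nonneg[OF fin] potential_nonneg[OF R_bounds(1)] by (simp add: ennreal_plus)
    then have "S + (ennreal (modified_cost N) + ennreal (potential k\<^sub>1 k\<^sub>2 \<eta> a (R (Suc N)))) \<le>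
        S' + ennreal (original_cost N)"
      if "S + ennreal (potential k\<^sub>1 k\<^sub>2 \<eta> a (R N)) \<le> S'" for S S'
      using add_left_mono[of _ _ S] add_right_mono[OF that, of "ennreal (original_cost N)"]
      by (metis add.assoc order.trans)
    then show ?thesis using Suc True N by (simp add: add.assoc)
  next
    case False
    then show ?thesis using Suc by (auto intro: order.trans[rotated] split: if_splits)
  qed
qed

lemma modified_orders_cheaper:
  "(\<Sum>n. if \<rho> (Suc n) \<le> ennreal t then ennreal (modified_cost n) else 0)
   \<le> (\<Sum>n. if \<rho> (Suc n) \<le> ennreal t then ennreal (original_cost n) else 0)"
proof (rule suminf_le_const)
  fix N
  have "(\<Sum>n<N. if \<rho> (Suc n) \<le> ennreal t then ennreal (modified_cost n) else 0) \<le>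
      (\<Sum>n<N. if \<rho> (Suc n) \<le> ennreal t then ennreal (original_cost n) else 0)"
    using costs_telescope[of t N] by (rule order.trans[rotated]) simp
  also have "\<dots> \<le> (\<Sum>n. if \<rho> (Suc n) \<le> ennreal t then ennreal (original_cost n) else 0)"
    by (intro sum_le_suminf) auto
  finally show "(\<Sum>n<N. if \<rho> (Suc n) \<le> ennreal t then ennreal (modified_cost n) else 0) \<le>
    (\<Sum>n. if \<rho> (Suc n) \<le> ennreal t then ennreal (original_cost n) else 0)" .
qed simp

text \<open>\<open>jump_order\<close> embeds the jumps into the original orders. By
  \<open>modified_left_limit\<close> an order chosen in this way is charged for the whole jump, from
  \<open>pre n\<close> to \<open>post n\<close>.\<close>

lemma original_orders_cost:
  "(\<Sum>n. if \<rho> (Suc n) \<le> ennreal t then ennreal (original_cost n) else 0) \<le>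
   (\<Sum>k. if \<tau> k \<le> ennreal t then ennreal (ordering_cost k\<^sub>1 k\<^sub>2 \<eta>
      (if enn2real (\<tau> k) = 0 then x\<^sub>0 else Lim (at_left (enn2real (\<tau> k))) X) (X (enn2real (\<tau> k)))) else 0)"
  (is "_ \<le> (\<Sum>k. ?g k)")
proof (rule suminf_le_const)
  fix N
  let ?J = "{n. n < N \<and> n \<in> jumps \<and> \<rho> (Suc n) \<le> ennreal t}"
  have jump: "n \<in> jumps \<longleftrightarrow> pre n < post n" if "\<rho> (Suc n) \<le> ennreal t" for n
  proof -
    have fin: "\<rho> (Suc n) \<noteq> \<infinity>" using that by (auto simp: top_unique)
    then show ?thesis using L_Suc_diff[OF fin] by (auto simp: jumps_def)
  qed
  have g: "?g (jump_order n) = ennreal (original_cost n)" if "n \<in> ?J" for n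
  proof -
    have fin: "\<rho> (Suc n) \<noteq> \<infinity>" using that by (auto simp: jumps_def)
    have "\<tau> (jump_order n) = \<rho> (Suc n)" "pre n < post n" using that jump_order jump by auto
    then show ?thesis
      using that by (simp only: time_def[symmetric] modified_left_limit(2)[OF fin])
        (simp add: original_cost_def post_def)
  qed
  have "(\<Sum>n<N. if \<rho> (Suc n) \<le> ennreal t then ennreal (original_cost n) else 0) = (\<Sum>n\<in>?J. ennreal (original_cost n))"
    using jump by (intro sum.mono_neutral_cong_right) (auto simp: original_cost_def)
  also have "\<dots> = (\<Sum>n\<in>?J. ?g (jump_order n))" by (rule sum.cong) (simp_all only: g)
  also have "\<dots> = sum ?g (jump_order ` ?J)"
    by (rule sum.reindex[unfolded o_def, symmetric]) (rule inj_on_subset[OF inj_jump_order], auto)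
  also have "\<dots> \<le> (\<Sum>k. ?g k)" by (intro sum_le_suminf) auto
  finally show "(\<Sum>n<N. if \<rho> (Suc n) \<le> ennreal t then ennreal (original_cost n) else 0) \<le> (\<Sum>k. ?g k)" .
qed simp

text \<open>An accumulation of changes contains infinitely many jumps, and each costs at least
  \<open>k\<^sub>1\<close>.\<close>

lemma original_cost_infinite:
  assumes all: "\<And>n. \<rho> n \<le> ennreal t"
  shows "(\<Sum>n. if \<rho> (Suc n) \<le> ennreal t then ennreal (original_cost n) else 0) = \<infinity>"
proof -
  have fin: "\<rho> n \<noteq> \<infinity>" for n using all[of n] by (auto simp: top_unique)
  have "\<infinity> = ennreal k\<^sub>1 * emeasure (count_space UNIV) jumps"
    using infinite_jumps[OF fin] k\<^sub>1 by (simp add: ennreal_mult_top)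
  also have "\<dots> = (\<integral>\<^sup>+n. ennreal k\<^sub>1 * indicator jumps n \<partial>count_space UNIV)"
    by (rule nn_integral_cmult_indicator[symmetric]) simp
  also have "\<dots> \<le> (\<integral>\<^sup>+n. (if \<rho> (Suc n) \<le> ennreal t then ennreal (original_cost n) else 0) \<partial>count_space UNIV)"
  proof (rule nn_integral_mono)
    fix n
    have "k\<^sub>1 \<le> original_cost n" if "n \<in> jumps"
      using that cost_nonneg(3)[OF fin] L_Suc_diff[OF fin, of n] by (auto simp: jumps_def)
    then show "ennreal k\<^sub>1 * indicator jumps n \<le> (if \<rho> (Suc n) \<le> ennreal t then ennreal (original_cost n) else 0)"
      using all by (auto simp: indicator_def intro: ennreal_leI)
  qed
  finally show ?thesis by (simp add: nn_integral_count_space_nat top_unique)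
qed

text \<open>If the changes accumulate by time \<open>t\<close>, the right-hand side is infinite.
  Otherwise the holding costs compare pointwise: the ratio is 1, or both levels lie in the range
  where the holding cost increases.\<close>

lemma modified_cheaper:
  assumes t: "0 \<le> t" and h: "1 \<le> a" "k\<^sub>4 * (- \<beta>) \<le> k\<^sub>3 * a" "0 \<le> k\<^sub>3" "0 \<le> k\<^sub>4" "\<beta> \<le> 0"
  shows "(\<integral>\<^sup>+ s\<in>{0..t}. ennreal (holding_cost k\<^sub>3 k\<^sub>4 \<beta> (m s * X s)) \<partial>lborel) +
      (\<Sum>n. if \<rho> (Suc n) \<le> ennreal t then ennreal (modified_cost n) else 0)
    \<le> (\<integral>\<^sup>+ s\<in>{0..t}. ennreal (holding_cost k\<^sub>3 k\<^sub>4 \<beta> (X s)) \<partial>lborel) +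
      (\<Sum>n. if \<rho> (Suc n) \<le> ennreal t then ennreal (original_cost n) else 0)"
proof (cases rule: position_cases[of t])
  case all
  show ?thesis unfolding original_cost_infinite[OF all] by simp
next
  case (between N)
  show ?thesis
  proof (intro add_mono modified_orders_cheaper nn_integral_mono)
    fix s
    show "ennreal (holding_cost k\<^sub>3 k\<^sub>4 \<beta> (m s * X s)) * indicator {0..t} s \<le>
        ennreal (holding_cost k\<^sub>3 k\<^sub>4 \<beta> (X s)) * indicator {0..t} s"
    proof (cases "s \<in> {0..t}")
      case True
      then have s: "0 \<le> s" "ennreal s \<le> ennreal t" by (auto intro: ennreal_leI)
      have "holding_cost k\<^sub>3 k\<^sub>4 \<beta> (m s * X s) \<le> holding_cost k\<^sub>3 k\<^sub>4 \<beta> (X s)"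
      proof (cases rule: position_cases[of s])
        case all
        then have "\<rho> (Suc N) \<le> ennreal t" using s(2) by (meson order.trans)
        then show ?thesis using between(2) by simp
      next
        case n: (between n)
        have ms: "m s = R n" by (rule ratio_between[OF n])
        show ?thesis
        proof (cases "R n < 1")
          case True
          have fin: "\<rho> n \<noteq> \<infinity>" using n(1) by (auto simp: top_unique)
          have "time n \<le> s" using n(1) s(1) \<rho>_eq[OF fin] by (simp add: time_nonneg)
          then have "a \<le> R n * X s" using no_trigger(2)[OF fin _ n(2) True] by simp
          moreover have "R n * X s \<le> X s"
            using R_bounds[of n] X_nonneg[OF s(1)] by (simp add: mult_left_le_one_le)
          ultimately show ?thesis using h unfolding ms by (intro holding_cost_mono) auto
        next
          case False
          then have "R n = 1" using R_bounds(2)[of n] by simp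
          then show ?thesis using ms by simp
        qed
      qed
      then show ?thesis by (intro mult_right_mono ennreal_leI) auto
    qed simp
  qed
qed

end

section \<open>Discarding the times without an order\<close>

text \<open>\<open>n\<close> is the \<open>j\<close>-th index with positive \<open>z n\<close>,
  counted from 0. The selection is necessary because an order of size zero would still be charged
  \<open>k\<^sub>1\<close>, and the level at its time may exceed \<open>B\<close>.\<close>

definition selects :: "(nat \<Rightarrow> real) \<Rightarrow> nat \<Rightarrow> nat \<Rightarrow> bool" where
  "selects z j n \<longleftrightarrow> 0 < z n \<and> (\<Sum>i<n. if 0 < z i then 1 else 0) = j"

text \<open>At most one index is selected, so the infimum reads off its time. The empty infimum
  \<open>\<infinity>\<close> encodes an order that is never placed.\<close>

definition thin_time :: "(nat \<Rightarrow> real) \<Rightarrow> (nat \<Rightarrow> ennreal) \<Rightarrow> nat \<Rightarrow> ennreal" where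
  "thin_time z r j = (INF n\<in>{n. selects z j n}. r n)"

definition thin_value :: "(nat \<Rightarrow> real) \<Rightarrow> nat \<Rightarrow> real" where
  "thin_value z j = (\<Sum>n. if selects z j n then z n else 0)"

lemma selects_unique:
  assumes "selects z j n" "selects z j k"
  shows "n = k"
proof -
  have "(\<Sum>i<n. if 0 < z i then 1 else 0 :: nat) < (\<Sum>i<k. if 0 < z i then 1 else 0)"
    if "n < k" "0 < z n" for n k
  proof -
    have "(\<Sum>i<n. if 0 < z i then 1 else 0 :: nat) < (\<Sum>i<Suc n. if 0 < z i then 1 else 0)"
      using that by simp
    also have "\<dots> \<le> (\<Sum>i<k. if 0 < z i then 1 else 0)"
      using that by (intro sum_mono2) auto
    finally show ?thesis .
  qed
  from this[of n k] this[of k n] assms show ?thesis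
    by (cases n k rule: linorder_cases) (auto simp: selects_def)
qed

lemma selects_iff: "selects z j n \<Longrightarrow> selects z j k \<longleftrightarrow> k = n"
  using selects_unique by blast

lemma thin_selected:
  assumes "selects z j n"
  shows "thin_time z r j = r n" "thin_value z j = z n"
proof -
  show "thin_time z r j = r n" by (simp add: thin_time_def selects_iff[OF assms])
  have "(\<lambda>k. if selects z j k then z k else 0) = (\<lambda>k. if k = n then z k else 0)"
    by (simp add: selects_iff[OF assms])
  then show "thin_value z j = z n" using sums_single[of n z] by (simp add: thin_value_def sums_iff)
qed

lemma thin_unselected:
  assumes "\<And>n. \<not> selects z j n"
  shows "thin_time z r j = \<infinity>" "thin_value z j = 0"
  using assms by (simp_all add: thin_time_def thin_value_def)

lemma thin_cases:
  obtains n where "selects z j n" "\<And>r. thin_time z r j = r n" "thin_value z j = z n"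
  | "\<And>n. \<not> selects z j n" "\<And>r. thin_time z r j = \<infinity>" "thin_value z j = 0"
  using thin_selected[of z j] thin_unselected[of z j] by (cases "\<exists>n. selects z j n") auto

lemma thin_value_nonneg: "0 \<le> thin_value z j"
  by (cases rule: thin_cases[of z j]) (auto simp: selects_def)

lemma selects_previous:
  assumes "selects z (Suc j) n"
  shows "\<exists>k<n. selects z j k"
proof -
  have "\<exists>k<n. selects z j k" if "(\<Sum>i<n. if 0 < z i then 1 else 0 :: nat) = Suc j" for n
    using that
  proof (induction n)
    case (Suc n)
    show ?case
    proof (cases "0 < z n")
      case True
      then have "selects z j n" using Suc.prems by (simp add: selects_def)
      then show ?thesis by blast
    next
      case False
      then show ?thesis using Suc by (auto intro: less_SucI)
    qed
  qed simp
  then show ?thesis using assms by (simp add: selects_def)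
qed

lemma incseq_thin_time:
  assumes "incseq r"
  shows "incseq (thin_time z r)"
proof (rule incseq_SucI)
  fix j
  show "thin_time z r j \<le> thin_time z r (Suc j)"
  proof (cases rule: thin_cases[of z "Suc j"])
    case (1 n)
    obtain k where k: "k < n" "selects z j k" using selects_previous[OF 1(1)] by blast
    then have "thin_time z r j = r k" using thin_selected by blast
    then show ?thesis using 1(2)[of r] incseqD[OF assms, of k n] k(1) by simp
  next
    case 2
    show ?thesis by (simp only: 2(2)) simp
  qed
qed

lemma thin_time_le_iff: "thin_time z r j \<le> ennreal t \<longleftrightarrow> (\<exists>n. selects z j n \<and> r n \<le> ennreal t)"
proof (cases rule: thin_cases[of z j])
  case (1 n)
  then show ?thesis using selects_unique by metis
qed (auto simp: top_unique)

text \<open>For each \<open>j\<close> at most one \<open>n\<close> is selected, and each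
  \<open>n\<close> with positive \<open>z n\<close> is selected by exactly one \<open>j\<close>, so
  the claim is an exchange of two sums of nonnegative terms. The condition on \<open>g\<close>
  removes the indices \<open>j\<close> that select nothing.\<close>

lemma suminf_thin:
  fixes g :: "ennreal \<Rightarrow> real \<Rightarrow> ennreal"
  assumes g: "g \<infinity> 0 = 0"
  shows "(\<Sum>j. g (thin_time z r j) (thin_value z j)) = (\<Sum>n. if 0 < z n then g (r n) (z n) else 0)"
proof -
  have inner: "(\<Sum>j. if selects z j n then g (r n) (z n) else 0) = (if 0 < z n then g (r n) (z n) else 0)" for n
  proof -
    let ?j = "\<Sum>i<n. if 0 < z i then 1 else 0 :: nat"
    have "(\<lambda>j. if selects z j n then g (r n) (z n) else 0) =
        (\<lambda>j. if j = ?j then if 0 < z n then g (r n) (z n) else 0 else 0)"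
      by (auto simp: selects_def)
    then show ?thesis
      using sums_single[of ?j "\<lambda>_. if 0 < z n then g (r n) (z n) else 0"] by (simp add: sums_iff)
  qed
  have "g (thin_time z r j) (thin_value z j) = (\<Sum>n. if selects z j n then g (r n) (z n) else 0)" for j
  proof (cases rule: thin_cases[of z j])
    case (1 n)
    have "(\<lambda>k. if selects z j k then g (r k) (z k) else 0) = (\<lambda>k. if k = n then g (r k) (z k) else 0)"
      by (simp add: selects_iff[OF 1(1)])
    then show ?thesis using sums_single[of n "\<lambda>k. g (r k) (z k)"] 1(2)[of r] 1(3) by (simp add: sums_iff)
  next
    case 2
    then show ?thesis using g by simp
  qed
  then have "(\<Sum>j. g (thin_time z r j) (thin_value z j)) =
      (\<Sum>j. \<Sum>n. if selects z j n then g (r n) (z n) else 0)" by simp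
  also have "\<dots> = (\<integral>\<^sup>+j. (\<Sum>n. if selects z j n then g (r n) (z n) else 0) \<partial>count_space UNIV)"
    by (rule nn_integral_count_space_nat[symmetric])
  also have "\<dots> = (\<Sum>n. \<integral>\<^sup>+j. (if selects z j n then g (r n) (z n) else 0) \<partial>count_space UNIV)"
    by (rule nn_integral_suminf) simp
  also have "\<dots> = (\<Sum>n. \<Sum>j. if selects z j n then g (r n) (z n) else 0)"
    by (simp only: nn_integral_count_space_nat)
  also have "\<dots> = (\<Sum>n. if 0 < z n then g (r n) (z n) else 0)" by (simp only: inner)
  finally show ?thesis .
qed

text \<open>Sums are rearranged in \<open>ennreal\<close>, where convergence is automatic; this
  returns the result to the reals.\<close>

lemma sums_of_ennreal_eq:
  fixes f h :: "nat \<Rightarrow> real"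
  assumes "\<And>n. 0 \<le> f n" "\<And>n. 0 \<le> h n" and f: "f sums S"
    and eq: "(\<Sum>n. ennreal (h n)) = (\<Sum>n. ennreal (f n))"
  shows "h sums S"
proof -
  have fS: "(\<Sum>n. ennreal (f n)) = ennreal S" using assms by (intro suminf_ennreal_eq) auto
  then have "(\<Sum>n. ennreal (h n)) \<noteq> \<top>" using eq by simp
  then have sh: "summable h" by (rule summable_suminf_not_top[OF assms(2)])
  then have "(\<Sum>n. ennreal (h n)) = ennreal (suminf h)"
    by (intro suminf_ennreal_eq assms(2) summable_sums)
  moreover have "0 \<le> suminf h" by (rule suminf_nonneg[OF sh assms(2)])
  moreover have "0 \<le> S" using sums_le[OF assms(1) sums_zero f] .
  ultimately have "suminf h = S" using fS eq by simp
  then show ?thesis using sh by (simp add: sums_iff)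
qed

lemma sums_thin:
  assumes z: "\<And>n. 0 \<le> z n" and S: "(\<lambda>n. if r n \<le> ennreal t then z n else 0) sums S"
  shows "(\<lambda>j. if thin_time z r j \<le> ennreal t then thin_value z j else 0) sums S"
proof (rule sums_of_ennreal_eq[OF _ _ S])
  have "(\<Sum>j. ennreal (if thin_time z r j \<le> ennreal t then thin_value z j else 0)) =
      (\<Sum>n. if 0 < z n then ennreal (if r n \<le> ennreal t then z n else 0) else 0)"
    by (rule suminf_thin) simp
  also have "(\<lambda>n. if 0 < z n then ennreal (if r n \<le> ennreal t then z n else 0) else 0) =
      (\<lambda>n. ennreal (if r n \<le> ennreal t then z n else 0))"
    using z by (auto simp: fun_eq_iff less_le)
  finally show "(\<Sum>j. ennreal (if thin_time z r j \<le> ennreal t then thin_value z j else 0)) =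
      (\<Sum>n. ennreal (if r n \<le> ennreal t then z n else 0))" .
qed (use z thin_value_nonneg in auto)

section \<open>Measurability of the selected orders\<close>

context usual_filtration
begin

lemma measurable_selects:
  assumes "\<And>i. i \<le> n \<Longrightarrow> z i \<in> borel_measurable (F t)"
  shows "Measurable.pred (F t) (\<lambda>\<omega>. selects (\<lambda>i. z i \<omega>) j n)"
proof -
  have [measurable]: "z i \<in> borel_measurable (F t)" if "i \<in> {..n}" for i using assms that by simp
  have "(\<lambda>\<omega>. \<Sum>i<n. if 0 < z i \<omega> then 1 else 0 :: real) \<in> borel_measurable (F t)"
    using assms by (intro borel_measurable_sum measurable_If) auto
  then have "Measurable.pred (F t) (\<lambda>\<omega>. 0 < z n \<omega> \<and> (\<Sum>i<n. if 0 < z i \<omega> then 1 else 0 :: real) = real j)"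
    using assms[of n] by (intro pred_intros_logic) (auto simp: pred_def)
  also have "(\<lambda>\<omega>. 0 < z n \<omega> \<and> (\<Sum>i<n. if 0 < z i \<omega> then 1 else 0 :: real) = real j) =
      (\<lambda>\<omega>. selects (\<lambda>i. z i \<omega>) j n)"
    unfolding selects_def of_nat_eq_iff[where 'a=real, symmetric] of_nat_sum
    by (auto simp: fun_eq_iff if_distrib cong: if_cong)
  finally show ?thesis .
qed

context
  fixes r :: "nat \<Rightarrow> 'a \<Rightarrow> ennreal" and z :: "nat \<Rightarrow> 'a \<Rightarrow> real"
  assumes r: "\<And>n. stopping_time F (r n)" and inc: "\<And>\<omega>. \<omega> \<in> space M \<Longrightarrow> incseq (\<lambda>n. r n \<omega>)"
    and z: "\<And>n. z n \<in> borel_measurable (pre_sigma (r n))"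
begin

text \<open>Whether \<open>n\<close> is selected depends only on the values up to index
  \<open>n\<close>, all of which are known at time \<open>r n\<close>. Cutting them off on the event
  \<open>r n \<omega> \<le> t\<close> makes them measurable at \<open>t\<close> without changing the
  conjunction.\<close>

lemma pred_selects:
  "Measurable.pred (F t) (\<lambda>\<omega>. selects (\<lambda>i. z i \<omega>) j n \<and> r n \<omega> \<le> t)"
proof -
  have "Measurable.pred (F t) (\<lambda>\<omega>. selects (\<lambda>i. if r n \<omega> \<le> t then z i \<omega> else 0) j n \<and> r n \<omega> \<le> t)"
  proof (intro pred_intros_logic measurable_selects stopping_timeD[OF r])
    fix i assume i: "i \<le> n"
    have "z i \<in> borel_measurable (pre_sigma (r n))"
      by (rule measurable_pre_sigma_mono[OF r r _ z]) (use i incseqD[OF inc] in auto)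
    then show "(\<lambda>\<omega>. if r n \<omega> \<le> t then z i \<omega> else 0) \<in> borel_measurable (F t)"
      by (rule pre_sigma_measurableD[OF r])
  qed
  also have "(\<lambda>\<omega>. selects (\<lambda>i. if r n \<omega> \<le> t then z i \<omega> else 0) j n \<and> r n \<omega> \<le> t) =
      (\<lambda>\<omega>. selects (\<lambda>i. z i \<omega>) j n \<and> r n \<omega> \<le> t)"
    by (auto simp: fun_eq_iff)
  finally show ?thesis .
qed

lemma stopping_time_thin: "stopping_time F (\<lambda>\<omega>. thin_time (\<lambda>n. z n \<omega>) (\<lambda>n. r n \<omega>) j)"
proof (rule stopping_timeI)
  fix t
  show "Measurable.pred (F t) (\<lambda>\<omega>. thin_time (\<lambda>n. z n \<omega>) (\<lambda>n. r n \<omega>) j \<le> t)"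
  proof (cases t)
    case (real u)
    show ?thesis
      unfolding real(2) thin_time_le_iff by (intro pred_intros_countable pred_selects)
  qed simp
qed

lemma measurable_thin_value:
  "(\<lambda>\<omega>. thin_value (\<lambda>n. z n \<omega>) j) \<in> borel_measurable (pre_sigma (\<lambda>\<omega>. thin_time (\<lambda>n. z n \<omega>) (\<lambda>n. r n \<omega>) j))"
  unfolding borel_measurable_pre_sigma_iff[OF stopping_time_thin]
proof
  fix t
  have "(\<lambda>\<omega>. \<Sum>n. if selects (\<lambda>i. z i \<omega>) j n \<and> r n \<omega> \<le> t then if r n \<omega> \<le> t then z n \<omega> else 0 else 0)
      \<in> borel_measurable (F t)"
    using pred_selects
    by (intro borel_measurable_suminf measurable_If pre_sigma_measurableD[OF r z] borel_measurable_const) (auto simp: pred_def)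
  also have "(\<lambda>\<omega>. \<Sum>n. if selects (\<lambda>i. z i \<omega>) j n \<and> r n \<omega> \<le> t then if r n \<omega> \<le> t then z n \<omega> else 0 else 0) =
      (\<lambda>\<omega>. if thin_time (\<lambda>n. z n \<omega>) (\<lambda>n. r n \<omega>) j \<le> t then thin_value (\<lambda>n. z n \<omega>) j else 0)"
  proof
    fix \<omega>
    show "(\<Sum>n. if selects (\<lambda>i. z i \<omega>) j n \<and> r n \<omega> \<le> t then if r n \<omega> \<le> t then z n \<omega> else 0 else 0) =
        (if thin_time (\<lambda>n. z n \<omega>) (\<lambda>n. r n \<omega>) j \<le> t then thin_value (\<lambda>n. z n \<omega>) j else 0)"
    proof (cases rule: thin_cases[of "\<lambda>n. z n \<omega>" j])
      case (1 k)
      have "(\<lambda>n. if selects (\<lambda>i. z i \<omega>) j n \<and> r n \<omega> \<le> t then if r n \<omega> \<le> t then z n \<omega> else 0 else 0) =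
          (\<lambda>n. if n = k then if r k \<omega> \<le> t then z k \<omega> else 0 else 0)"
        by (auto simp: selects_iff[OF 1(1)])
      then show ?thesis
        using sums_single[of k "\<lambda>_. if r k \<omega> \<le> t then z k \<omega> else 0"] 1(2)[of "\<lambda>n. r n \<omega>"] 1(3) by (simp add: sums_iff)
    next
      case 2
      then show ?thesis by simp
    qed
  qed
  finally show "(\<lambda>\<omega>. if thin_time (\<lambda>n. z n \<omega>) (\<lambda>n. r n \<omega>) j \<le> t then thin_value (\<lambda>n. z n \<omega>) j else 0)
    \<in> borel_measurable (F t)" .
qed

end

end

section \<open>Regular paths and absorption at zero\<close>

lemma continuous_on_set_integral:
  fixes f :: "real \<Rightarrow> real"
  assumes "\<And>t. 0 \<le> t \<Longrightarrow> set_integrable lborel {0..t} f"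
  shows "continuous_on {0..} (\<lambda>t. LINT s:{0..t}|lborel. f s)"
proof (rule continuous_on_atLeastI)
  fix t :: real assume t: "0 \<le> t"
  have "continuous_on {0..t} (\<lambda>u. integral {0..u} f)"
    using set_borel_integral_eq_integral(1)[OF assms[OF t]] by (rule indefinite_integral_continuous_1)
  then show "continuous_on {0..t} (\<lambda>u. LINT s:{0..u}|lborel. f s)"
    by (rule continuous_on_eq) (use set_borel_integral_eq_integral(2)[OF assms] in auto)
qed

lemma (in usual_filtration) gbm_equation_AE_cong:
  assumes eq: "gbm_equation M F W \<mu> \<sigma> x\<^sub>0 A X"
    and X: "AE \<omega> in M. \<forall>t. X t \<omega> = X' t \<omega>" and A: "AE \<omega> in M. \<forall>t\<ge>0. A t \<omega> = A' t \<omega>"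
  shows "gbm_equation M F W \<mu> \<sigma> x\<^sub>0 A' X'"
proof -
  obtain I where I: "ito_integral M F W (\<lambda>s \<omega>. \<sigma> * X s \<omega>) I"
    and eq0: "AE \<omega> in M. \<forall>t\<ge>0. set_integrable lborel {0..t} (\<lambda>s. X s \<omega>) \<and>
           X t \<omega> = x\<^sub>0 - (LINT s:{0..t}|lborel. \<mu> * X s \<omega>) + I t \<omega> + A t \<omega>"
    and adX: "adapted F X"
    using eq unfolding gbm_equation_def by blast
  have adX': "adapted F X'"
    unfolding adapted_def
  proof (intro allI impI)
    fix t :: real assume "0 \<le> t"
    then show "X' t \<in> borel_measurable (F (ennreal t))"
      by (intro measurable_F_AE_cong[OF adaptedD[OF adX, of t "ennreal t"]]) (use X in \<open>auto elim: eventually_mono\<close>)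
  qed
  have adH: "adapted F (\<lambda>s \<omega>. \<sigma> * X' s \<omega>)"
    using adX' unfolding adapted_def by (auto intro!: borel_measurable_times[OF borel_measurable_const])
  obtain S where S: "\<And>m. simple_predictable M F (S m)" and adI: "adapted F I"
    and mb: "AE \<omega> in M. set_borel_measurable lborel {0..} (\<lambda>s. \<sigma> * X s \<omega>)"
    and lim: "AE \<omega> in M. \<forall>t\<ge>0.
       (\<lambda>m. \<integral>\<^sup>+ s\<in>{0..t}. ennreal ((simple_value (S m) s \<omega> - \<sigma> * X s \<omega>)\<^sup>2) \<partial>lborel) \<longlonglongrightarrow> 0 \<and>
       uniform_limit {0..t} (\<lambda>m s. simple_integral W (S m) s \<omega>) (\<lambda>s. I s \<omega>) sequentially"
    using I unfolding ito_integral_def by auto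
  have "ito_integral M F W (\<lambda>s \<omega>. \<sigma> * X' s \<omega>) I"
    unfolding ito_integral_def
  proof (intro conjI adH adI exI[of _ S] allI S)
    show "AE \<omega> in M. set_borel_measurable lborel {0..} (\<lambda>s. \<sigma> * X' s \<omega>)"
      using mb X by eventually_elim simp
    show "AE \<omega> in M. \<forall>t\<ge>0.
       (\<lambda>m. \<integral>\<^sup>+ s\<in>{0..t}. ennreal ((simple_value (S m) s \<omega> - \<sigma> * X' s \<omega>)\<^sup>2) \<partial>lborel) \<longlonglongrightarrow> 0 \<and>
       uniform_limit {0..t} (\<lambda>m s. simple_integral W (S m) s \<omega>) (\<lambda>s. I s \<omega>) sequentially"
      using lim X by eventually_elim simp
  qed
  moreover have "AE \<omega> in M. \<forall>t\<ge>0. set_integrable lborel {0..t} (\<lambda>s. X' s \<omega>) \<and>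
           X' t \<omega> = x\<^sub>0 - (LINT s:{0..t}|lborel. \<mu> * X' s \<omega>) + I t \<omega> + A' t \<omega>"
    using eq0 X A by eventually_elim simp
  ultimately show ?thesis using adX' unfolding gbm_equation_def by blast
qed

section \<open>Absorption along a path\<close>

context policy_path
begin

text \<open>The time of falling strictly below zero: a strict condition persists to the right on
  right-continuous paths. The clause \<open>0 \<le> ennreal t\<close> gives the set the shape of
  \<open>stopping_time_debut\<close> with starting time 0.\<close>

definition absorption where "absorption = Inf {ennreal t |t. 0 \<le> t \<and> 0 \<le> ennreal t \<and> X t < 0}"

lemma nonneg_before_absorption: "0 \<le> t \<Longrightarrow> ennreal t < absorption \<Longrightarrow> 0 \<le> X t"
proof (rule ccontr)
  assume t: "0 \<le> t" "ennreal t < absorption" "\<not> 0 \<le> X t"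
  then have "absorption \<le> ennreal t" unfolding absorption_def by (intro Inf_lower) auto
  with t show False by simp
qed

text \<open>Orders only raise the level, so a path cannot jump below zero: the left limit bounds
  \<open>X u\<close> from below by 0, and right continuity bounds it from above.\<close>

lemma zero_at_absorption:
  assumes u: "0 \<le> u" "absorption = ennreal u"
  shows "X u = 0" "0 < u"
proof -
  have "X u \<le> 0"
  proof (rule ccontr)
    assume "\<not> X u \<le> 0"
    then have "eventually (\<lambda>s. 0 < X s) (at u within {u..})"
      using order_tendstoD(1)[OF right_continuous_X[OF u(1), unfolded continuous_within], of 0] by simp
    then obtain \<epsilon> where \<epsilon>: "0 < \<epsilon>" "\<And>s. s \<in> {u..} \<Longrightarrow> s \<noteq> u \<Longrightarrow> dist s u < \<epsilon> \<Longrightarrow> 0 < X s"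
      unfolding eventually_at by auto
    have "ennreal (u + \<epsilon>) \<le> absorption"
      unfolding absorption_def
    proof (rule Inf_greatest)
      fix v assume "v \<in> {ennreal t |t. 0 \<le> t \<and> 0 \<le> ennreal t \<and> X t < 0}"
      then obtain s where v: "v = ennreal s" and s: "0 \<le> s" "X s < 0" by auto
      have "\<not> s < u" using nonneg_before_absorption[of s] s u by (auto simp: ennreal_less_iff)
      moreover have "s \<noteq> u" using s \<open>\<not> X u \<le> 0\<close> by auto
      ultimately have "\<not> s < u + \<epsilon>" using \<epsilon>(2)[of s] s by (auto simp: dist_real_def)
      then show "ennreal (u + \<epsilon>) \<le> v" unfolding v by (intro ennreal_leI) simp
    qed
    then show False using u \<epsilon>(1) by simp
  qed
  moreover have X0: "0 < X 0" using X[of 0] x\<^sub>0 C A_nonneg[of 0] by simp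
  ultimately show u0: "0 < u" using u by (cases "u = 0") auto
  have "0 \<le> x\<^sub>0 + C u + A u"
  proof (rule tendsto_lowerbound)
    have "(C \<longlongrightarrow> C u) (at u within {0..})" using C u by (auto simp: continuous_on_def)
    then have "(C \<longlongrightarrow> C u) (at u)" using u0 at_within_interior[of u "{0..}"] by auto
    then have "(C \<longlongrightarrow> C u) (at_left u)" by (rule tendsto_within_subset) simp
    then show "((\<lambda>s. x\<^sub>0 + C s + A u) \<longlongrightarrow> x\<^sub>0 + C u + A u) (at_left u)" by (intro tendsto_intros)
    show "eventually (\<lambda>s. 0 \<le> x\<^sub>0 + C s + A u) (at_left u)"
      unfolding eventually_at_left_field
    proof (intro exI[of _ 0] conjI u0 allI impI)
      fix s assume s: "0 < s" "s < u"
      then have "0 \<le> X s" using nonneg_before_absorption[of s] u by (simp add: ennreal_less_iff)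
      moreover have "A s \<le> A u" using A_mono[of s u] s by simp
      ultimately show "0 \<le> x\<^sub>0 + C s + A u" using X[of s] s by simp
    qed
  qed simp
  then have "0 \<le> X u" using X[OF u(1)] by simp
  with \<open>X u \<le> 0\<close> show "X u = 0" by simp
qed

text \<open>As the level is 0 at a finite absorption time, stopping \<open>C\<close> and
  \<open>A\<close> there makes \<open>x\<^sub>0 + C + A\<close> vanish from then on. Later orders
  are moved to \<open>\<infinity>\<close>.\<close>

lemma absorbed_path:
  "policy_path x\<^sub>0 (\<lambda>k. if \<tau> k \<le> absorption then \<tau> k else \<infinity>) Y (\<lambda>t. C (min_time absorption t))
     (\<lambda>t. A (min_time absorption t)) (\<lambda>t. if absorption \<le> ennreal t then 0 else X t)"
    (is "policy_path _ ?\<tau> _ ?C ?A ?X")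
  and absorbed_nonneg: "0 \<le> t \<Longrightarrow> 0 \<le> (if absorption \<le> ennreal t then 0 else X t)"
proof -
  have \<tau>_iff: "?\<tau> k \<le> ennreal t \<longleftrightarrow> \<tau> k \<le> ennreal (min_time absorption t)" if "0 \<le> t" for k t
    using that by (auto simp: ennreal_min_time top_unique)
  show "policy_path x\<^sub>0 ?\<tau> Y ?C ?A ?X"
  proof
    show "incseq ?\<tau>"
      using incseqD[OF \<tau>] by (auto simp: incseq_def top_unique intro: order.trans)
    show "continuous_on {0..} ?C"
      by (rule continuous_on_compose2[OF C(1) continuous_on_min_time]) (auto simp: min_time_bounds)
    have "min_time absorption 0 = 0" by (simp add: min_time_def)
    then show "?C 0 = 0" using C by simp
    fix t :: real assume t: "0 \<le> t"
    show "summable (\<lambda>k. if ?\<tau> k \<le> ennreal t then Y k else 0)"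
      unfolding \<tau>_iff[OF t] by (intro summ min_time_bounds t)
    show "?A t = (\<Sum>k. if ?\<tau> k \<le> ennreal t then Y k else 0)"
      unfolding \<tau>_iff[OF t] by (intro A min_time_bounds t)
    show "?X t = x\<^sub>0 + ?C t + ?A t"
    proof (cases "absorption \<le> ennreal t")
      case True
      then obtain u where u: "0 \<le> u" "absorption = ennreal u" by (cases absorption) (auto simp: top_unique)
      then have "min_time absorption t = u" using True t by (simp add: min_time_eq)
      then show ?thesis using True zero_at_absorption(1)[OF u] X[OF u(1)] by simp
    next
      case False
      then show ?thesis using X[OF t] t by (simp add: min_time_eq)
    qed
  qed (use x\<^sub>0 Y in auto)
  show "0 \<le> (if absorption \<le> ennreal t then 0 else X t)" if "0 \<le> t"
    using nonneg_before_absorption[OF that] by (simp add: not_le)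
qed

end

lemma Lim_cong:
  assumes "eventually (\<lambda>x. f x = g x) G"
  shows "Lim G f = Lim G g"
  unfolding t2_space_class.Lim_def using tendsto_cong[OF assms] by simp

lemma (in policy_path) absorbed_cost:
  assumes pos: "\<And>k. \<tau> k < \<infinity> \<Longrightarrow> 0 < X (enn2real (\<tau> k))" and t: "0 \<le> t"
  defines "\<tau>' \<equiv> \<lambda>k. if \<tau> k \<le> absorption then \<tau> k else \<infinity>"
  defines "X' \<equiv> \<lambda>t. if absorption \<le> ennreal t then 0 else X t"
  shows "(\<integral>\<^sup>+ s\<in>{0..t}. ennreal (holding_cost k\<^sub>3 k\<^sub>4 \<beta> (X' s)) \<partial>lborel) +
      (\<Sum>k. if \<tau>' k \<le> ennreal t then ennreal (ordering_cost k\<^sub>1 k\<^sub>2 \<eta>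
        (if enn2real (\<tau>' k) = 0 then x\<^sub>0 else Lim (at_left (enn2real (\<tau>' k))) X') (X' (enn2real (\<tau>' k)))) else 0)
    \<le> (\<integral>\<^sup>+ s\<in>{0..t}. ennreal (holding_cost k\<^sub>3 k\<^sub>4 \<beta> (X s)) \<partial>lborel) +
      (\<Sum>k. if \<tau> k \<le> ennreal t then ennreal (ordering_cost k\<^sub>1 k\<^sub>2 \<eta>
        (if enn2real (\<tau> k) = 0 then x\<^sub>0 else Lim (at_left (enn2real (\<tau> k))) X) (X (enn2real (\<tau> k)))) else 0)"
proof (intro add_mono nn_integral_mono suminf_le)
  show "ennreal (holding_cost k\<^sub>3 k\<^sub>4 \<beta> (X' s)) * indicator {0..t} s \<le>
      ennreal (holding_cost k\<^sub>3 k\<^sub>4 \<beta> (X s)) * indicator {0..t} s" for s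
    by (auto simp: X'_def holding_cost_def indicator_def)
  fix k
  show "(if \<tau>' k \<le> ennreal t then ennreal (ordering_cost k\<^sub>1 k\<^sub>2 \<eta>
        (if enn2real (\<tau>' k) = 0 then x\<^sub>0 else Lim (at_left (enn2real (\<tau>' k))) X') (X' (enn2real (\<tau>' k)))) else 0)
    \<le> (if \<tau> k \<le> ennreal t then ennreal (ordering_cost k\<^sub>1 k\<^sub>2 \<eta>
        (if enn2real (\<tau> k) = 0 then x\<^sub>0 else Lim (at_left (enn2real (\<tau> k))) X) (X (enn2real (\<tau> k)))) else 0)"
  proof (cases "\<tau>' k \<le> ennreal t")
    case True
    then have le: "\<tau> k \<le> absorption" and eq: "\<tau>' k = \<tau> k" by (auto simp: \<tau>'_def top_unique split: if_splits)
    obtain v where v: "0 \<le> v" "\<tau> k = ennreal v" using True eq by (cases "\<tau> k") (auto simp: top_unique)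
    \<comment> \<open>The level is positive at every order time but 0 at absorption, so every
      retained order comes strictly earlier, where both paths still agree.\<close>
    have "\<tau> k \<noteq> absorption" using pos[of k] zero_at_absorption(1)[of v] v by auto
    then have less: "ennreal v < absorption" using le v by simp
    have "X' s = X s" if "0 \<le> s" "s \<le> v" for s
    proof -
      have "ennreal s < absorption" using less that by (meson ennreal_leI le_less_trans)
      then show ?thesis by (simp add: X'_def)
    qed
    then have "Lim (at_left v) X' = Lim (at_left v) X" "X' v = X v" if "v \<noteq> 0"
      using v that by (auto intro!: Lim_cong simp: eventually_at_left_field intro!: exI[of _ 0])
    moreover have "X' v = X v" using less by (simp add: X'_def)
    ultimately show ?thesis using True eq v by simp
  qed simp
qed auto

context usual_filtration
begin

text \<open>The path properties are required for every outcome rather than almost surely, because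
  the control is built outcome by outcome and its times must be stopping times.\<close>

definition regular_policy ::
    "(real \<Rightarrow> 'a \<Rightarrow> real) \<Rightarrow> real \<Rightarrow> real \<Rightarrow> real \<Rightarrow> (nat \<Rightarrow> 'a \<Rightarrow> ennreal) \<Rightarrow> (nat \<Rightarrow> 'a \<Rightarrow> real) \<Rightarrow>
     (real \<Rightarrow> 'a \<Rightarrow> real) \<Rightarrow> (real \<Rightarrow> 'a \<Rightarrow> real) \<Rightarrow> (real \<Rightarrow> 'a \<Rightarrow> real) \<Rightarrow> bool" where
  "regular_policy W \<mu> \<sigma> x\<^sub>0 \<tau> Y C A X \<longleftrightarrow>
     (\<forall>k. stopping_time F (\<tau> k)) \<and> adapted F A \<and> adapted F X \<and> gbm_equation M F W \<mu> \<sigma> x\<^sub>0 A X \<and>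
     (\<forall>\<omega>\<in>space M. policy_path x\<^sub>0 (\<lambda>k. \<tau> k \<omega>) (\<lambda>k. Y k \<omega>) (\<lambda>t. C t \<omega>) (\<lambda>t. A t \<omega>) (\<lambda>t. X t \<omega>))"

text \<open>On a null set outside which all path properties hold, nothing is changed elsewhere:
  there the policy is replaced by no orders at all and the level by the constant
  \<open>x\<^sub>0\<close>. The filtration contains the null sets, so measurability
  survives.\<close>

lemma regularize:
  assumes W: "AE \<omega> in M. continuous_on {0..} (\<lambda>t. W t \<omega>)" and x\<^sub>0: "0 < x\<^sub>0"
    and adm: "admissible M F W \<mu> \<sigma> x\<^sub>0 \<tau> Y X"
  obtains \<tau>' C A X' where "regular_policy W \<mu> \<sigma> x\<^sub>0 \<tau>' Y C A X'"
    and "AE \<omega> in M. (\<forall>k. \<tau>' k \<omega> = \<tau> k \<omega>) \<and> (\<forall>t. X' t \<omega> = X t \<omega>)"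
proof -
  have st: "\<And>k. stopping_time F (\<tau> k)" and inc: "\<And>\<omega>. \<omega> \<in> space M \<Longrightarrow> incseq (\<lambda>k. \<tau> k \<omega>)"
    and Ym: "\<And>k. Y k \<in> borel_measurable (pre_sigma (\<tau> k))" and Y0: "\<And>k \<omega>. \<omega> \<in> space M \<Longrightarrow> 0 \<le> Y k \<omega>"
    and summ: "AE \<omega> in M. \<forall>t\<ge>0. summable (\<lambda>k. if \<tau> k \<omega> \<le> ennreal t then Y k \<omega> else 0)"
    and eq: "gbm_equation M F W \<mu> \<sigma> x\<^sub>0 (ordered_amount \<tau> Y) X"
    using adm unfolding admissible_def by auto
  obtain I where cont: "\<forall>\<omega>\<in>space M. continuous_on {0..} (\<lambda>t. I t \<omega>) \<and> I 0 \<omega> = 0"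
    and X_eq: "AE \<omega> in M. \<forall>t\<ge>0. set_integrable lborel {0..t} (\<lambda>s. X s \<omega>) \<and>
           X t \<omega> = x\<^sub>0 - (LINT s:{0..t}|lborel. \<mu> * X s \<omega>) + I t \<omega> + ordered_amount \<tau> Y t \<omega>"
    using gbm_equation_integralE[OF W eq] by blast
  define good_path where "good_path \<omega> \<longleftrightarrow>
      (\<forall>t\<ge>0. summable (\<lambda>k. if \<tau> k \<omega> \<le> ennreal t then Y k \<omega> else 0)) \<and>
      continuous_on {0..} (\<lambda>t. X t \<omega> - x\<^sub>0 - ordered_amount \<tau> Y t \<omega>) \<and>
      X 0 \<omega> = x\<^sub>0 + ordered_amount \<tau> Y 0 \<omega>" for \<omega>
  have "AE \<omega> in M. good_path \<omega>"
    using summ X_eq AE_space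
  proof eventually_elim
    case (elim \<omega>)
    have "continuous_on {0..} (\<lambda>t. X t \<omega> - x\<^sub>0 - ordered_amount \<tau> Y t \<omega>)"
    proof (rule continuous_on_eq)
      show "continuous_on {0..} (\<lambda>t. - (LINT s:{0..t}|lborel. \<mu> * X s \<omega>) + I t \<omega>)"
        using cont elim by (intro continuous_intros continuous_on_set_integral set_integrable_mult_right) auto
    qed (use elim(2) in simp)
    moreover have "(LINT s:{0..0}|lborel. \<mu> * X s \<omega>) = 0"
      by (simp add: set_lebesgue_integral_def integral_eq_zero_AE AE_mp[OF AE_lborel_singleton[of 0]])
    ultimately show ?case using elim cont unfolding good_path_def by auto
  qed
  then obtain N where good_path: "\<And>\<omega>. \<omega> \<in> space M - N \<Longrightarrow> good_path \<omega>" and N: "N \<in> null_sets M"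
    by (auto elim!: AE_E3)
  note good = good_path[unfolded good_path_def]
  define \<tau>' where "\<tau>' k \<omega> = (if \<omega> \<in> N then \<infinity> else \<tau> k \<omega>)" for k \<omega>
  define X' where "X' t \<omega> = (if \<omega> \<in> N then x\<^sub>0 else X t \<omega>)" for t \<omega>
  define A where "A = ordered_amount \<tau>' Y"
  define C where "C t \<omega> = X' t \<omega> - x\<^sub>0 - A t \<omega>" for t \<omega>
  have AEN: "AE \<omega> in M. (\<forall>k. \<tau>' k \<omega> = \<tau> k \<omega>) \<and> (\<forall>t. X' t \<omega> = X t \<omega>)"
    using AE_not_in[OF N] by eventually_elim (simp add: \<tau>'_def X'_def)
  have NF: "N \<in> sets (F t)" for t using N null_sets_F by blast
  have st': "stopping_time F (\<tau>' k)" for k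
  proof (rule stopping_timeI)
    fix t
    show "Measurable.pred (F t) (\<lambda>\<omega>. \<tau>' k \<omega> \<le> t)"
    proof (cases "t = \<infinity>")
      case False
      then have "(\<lambda>\<omega>. \<tau>' k \<omega> \<le> t) = (\<lambda>\<omega>. \<omega> \<notin> N \<and> \<tau> k \<omega> \<le> t)"
        by (auto simp: \<tau>'_def fun_eq_iff top_unique)
      moreover have "Measurable.pred (F t) (\<lambda>\<omega>. \<omega> \<notin> N \<and> \<tau> k \<omega> \<le> t)"
        using NF[of t] by (intro pred_intros_logic stopping_timeD[OF st]) simp
      ultimately show ?thesis by simp
    qed simp
  qed
  have adA: "adapted F A"
    unfolding adapted_def
  proof (intro allI impI)
    fix t :: real
    have "ordered_amount \<tau> Y t \<in> borel_measurable (F (ennreal t))"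
      unfolding ordered_amount_def[abs_def]
      by (intro borel_measurable_suminf pre_sigma_measurableD[OF st Ym])
    then show "A t \<in> borel_measurable (F (ennreal t))"
      by (rule measurable_F_AE_cong) (use AEN in \<open>auto simp: A_def ordered_amount_def elim: eventually_mono\<close>)
  qed
  have gbm: "gbm_equation M F W \<mu> \<sigma> x\<^sub>0 A X'"
    by (rule gbm_equation_AE_cong[OF eq]) (use AEN in \<open>auto simp: A_def ordered_amount_def elim: eventually_mono\<close>)
  have path: "policy_path x\<^sub>0 (\<lambda>k. \<tau>' k \<omega>) (\<lambda>k. Y k \<omega>) (\<lambda>t. C t \<omega>) (\<lambda>t. A t \<omega>) (\<lambda>t. X' t \<omega>)"
    if \<omega>: "\<omega> \<in> space M" for \<omega>
  proof (cases "\<omega> \<in> N")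
    case True
    then have 0: "A t \<omega> = 0" "C t \<omega> = 0" for t
      by (simp_all add: A_def ordered_amount_def \<tau>'_def X'_def C_def top_unique)
    show ?thesis
      by unfold_locales (use True x\<^sub>0 Y0[OF \<omega>] in \<open>simp_all add: 0 \<tau>'_def X'_def top_unique incseq_def\<close>)
  next
    case False
    then have A_eq: "A t \<omega> = ordered_amount \<tau> Y t \<omega>" for t by (simp add: A_def ordered_amount_def \<tau>'_def)
    show ?thesis
      by unfold_locales (use False x\<^sub>0 Y0[OF \<omega>] inc[OF \<omega>] good[of \<omega>] \<omega> in
        \<open>simp_all add: C_def A_eq \<tau>'_def X'_def\<close>, simp add: ordered_amount_def)
  qed
  show ?thesis
  proof
    show "regular_policy W \<mu> \<sigma> x\<^sub>0 \<tau>' Y C A X'"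
      unfolding regular_policy_def using st' adA gbm path by (auto simp: gbm_equation_def)
    show "AE \<omega> in M. (\<forall>k. \<tau>' k \<omega> = \<tau> k \<omega>) \<and> (\<forall>t. X' t \<omega> = X t \<omega>)" by (rule AEN)
  qed
qed

lemma absorb:
  assumes W: "AE \<omega> in M. continuous_on {0..} (\<lambda>t. W t \<omega>)"
    and reg: "regular_policy W \<mu> \<sigma> x\<^sub>0 \<tau> Y C A X"
  defines "T \<equiv> \<lambda>\<omega>. Inf {ennreal t |t. 0 \<le> t \<and> 0 \<le> ennreal t \<and> X t \<omega> < 0}"
  shows "regular_policy W \<mu> \<sigma> x\<^sub>0 (\<lambda>k \<omega>. if \<tau> k \<omega> \<le> T \<omega> then \<tau> k \<omega> else \<infinity>) Y
    (\<lambda>t \<omega>. C (min_time (T \<omega>) t) \<omega>) (\<lambda>t \<omega>. A (min_time (T \<omega>) t) \<omega>)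
    (\<lambda>t \<omega>. if T \<omega> \<le> ennreal t then 0 else X t \<omega>)"
proof -
  have st: "\<And>k. stopping_time F (\<tau> k)" and ad: "adapted F A" "adapted F X"
    and eq: "gbm_equation M F W \<mu> \<sigma> x\<^sub>0 A X"
    and path: "\<And>\<omega>. \<omega> \<in> space M \<Longrightarrow> policy_path x\<^sub>0 (\<lambda>k. \<tau> k \<omega>) (\<lambda>k. Y k \<omega>) (\<lambda>t. C t \<omega>) (\<lambda>t. A t \<omega>) (\<lambda>t. X t \<omega>)"
    using reg unfolding regular_policy_def by auto
  have T: "stopping_time F T"
    unfolding T_def
  proof (rule stopping_time_debut[OF stopping_time_const])
    fix t :: real assume "0 \<le> t"
    then have [measurable]: "X t \<in> borel_measurable (F (ennreal t))" by (rule adaptedD[OF ad(2)]) simp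
    show "Measurable.pred (F (ennreal t)) (\<lambda>\<omega>. 0 \<le> ennreal t \<and> X t \<omega> < 0)" by measurable
  next
    fix \<omega> t assume \<omega>: "\<omega> \<in> space M" and t: "0 \<le> t" "X t \<omega> < 0"
    interpret policy_path x\<^sub>0 "\<lambda>k. \<tau> k \<omega>" "\<lambda>k. Y k \<omega>" "\<lambda>t. C t \<omega>" "\<lambda>t. A t \<omega>" "\<lambda>t. X t \<omega>" by (rule path[OF \<omega>])
    have "eventually (\<lambda>s. X s \<omega> < 0) (at t within {t..})"
      by (rule order_tendstoD(2)[OF right_continuous_X[OF t(1), unfolded continuous_within] t(2)])
    then obtain \<epsilon> where \<epsilon>: "0 < \<epsilon>" "\<And>s. s \<in> {t..} \<Longrightarrow> s \<noteq> t \<Longrightarrow> dist s t < \<epsilon> \<Longrightarrow> X s \<omega> < 0"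
      unfolding eventually_at by auto
    show "\<exists>\<epsilon>>0. \<forall>s. t \<le> s \<and> s < t + \<epsilon> \<longrightarrow> X s \<omega> < 0"
    proof (intro exI[of _ \<epsilon>] conjI allI impI \<epsilon>(1))
      fix s assume "t \<le> s \<and> s < t + \<epsilon>"
      then show "X s \<omega> < 0" using \<epsilon>(2)[of s] t by (cases "s = t") (auto simp: dist_real_def)
    qed
  qed
  have path': "policy_path x\<^sub>0 (\<lambda>k. if \<tau> k \<omega> \<le> T \<omega> then \<tau> k \<omega> else \<infinity>) (\<lambda>k. Y k \<omega>)
      (\<lambda>t. C (min_time (T \<omega>) t) \<omega>) (\<lambda>t. A (min_time (T \<omega>) t) \<omega>) (\<lambda>t. if T \<omega> \<le> ennreal t then 0 else X t \<omega>)"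
    if \<omega>: "\<omega> \<in> space M" for \<omega>
  proof -
    interpret policy_path x\<^sub>0 "\<lambda>k. \<tau> k \<omega>" "\<lambda>k. Y k \<omega>" "\<lambda>t. C t \<omega>" "\<lambda>t. A t \<omega>" "\<lambda>t. X t \<omega>" by (rule path[OF \<omega>])
    have "T \<omega> = absorption" by (simp add: T_def absorption_def)
    then show ?thesis using absorbed_path by simp
  qed
  have stop': "stopping_time F (\<lambda>\<omega>. if \<tau> k \<omega> \<le> T \<omega> then \<tau> k \<omega> else \<infinity>)" for k
  proof (rule stopping_timeI)
    fix t
    show "Measurable.pred (F t) (\<lambda>\<omega>. (if \<tau> k \<omega> \<le> T \<omega> then \<tau> k \<omega> else \<infinity>) \<le> t)"
    proof (cases "t = \<infinity>")
      case False
      \<comment> \<open>If \<open>T\<close> has occurred by \<open>t\<close>, its comparison with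
        \<open>\<tau> k\<close> is decided at \<open>T\<close>. If not, an order by time
        \<open>t\<close> is automatically earlier than \<open>T\<close>.\<close>
      have "Measurable.pred (pre_sigma T) (\<lambda>\<omega>. \<not> T \<omega> < \<tau> k \<omega>)"
        using stopping_time_less[OF T st] by (intro pred_intros_logic)
      then have 1: "{\<omega>\<in>{\<omega>\<in>space M. \<not> T \<omega> < \<tau> k \<omega>}. T \<omega> \<le> t} \<in> sets (F t)"
        by (intro sets_pre_sigmaD[OF T]) (simp add: pred_def space_pre_sigma)
      have "{\<omega>\<in>space (F t). \<not> T \<omega> \<le> t \<and> \<tau> k \<omega> \<le> t} \<in> sets (F t)"
        using stopping_timeD[OF T, of t] stopping_timeD[OF st, of k t]
        by (subst pred_def[symmetric]) (intro pred_intros_logic)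
      moreover have "{\<omega>\<in>space (F t). (if \<tau> k \<omega> \<le> T \<omega> then \<tau> k \<omega> else \<infinity>) \<le> t} =
          {\<omega>\<in>{\<omega>\<in>space M. \<not> T \<omega> < \<tau> k \<omega>}. T \<omega> \<le> t} \<union> {\<omega>\<in>space (F t). \<not> T \<omega> \<le> t \<and> \<tau> k \<omega> \<le> t}"
        using False by (auto simp: space_F top_unique not_le not_less)
      ultimately show ?thesis using 1 by (simp add: pred_def)
    qed simp
  qed
  have adA: "adapted F (\<lambda>t \<omega>. A (min_time (T \<omega>) t) \<omega>)"
    unfolding adapted_def min_time_def
    using measurable_sample[OF ad(1) T] policy_path.right_continuous_A[OF path] by auto
  \<comment> \<open>Absorption is a rescaling whose factor drops from 1 to 0 by a single jump of -1
    at \<open>T\<close>. The new order term is then \<open>- (X - A)\<close> at \<open>T\<close>,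
    which equals \<open>A\<close> there because the level is 0.\<close>
  define d :: "nat \<Rightarrow> 'a \<Rightarrow> real" where "d n \<omega> = (if n = 0 then - 1 else 0)" for n \<omega>
  have single: "(\<Sum>n. if T \<omega> \<le> ennreal t then d n \<omega> * f n else 0) = (if T \<omega> \<le> ennreal t then - f 0 else 0)"
    for \<omega> t and f :: "nat \<Rightarrow> real"
  proof -
    have "(\<lambda>n. if T \<omega> \<le> ennreal t then d n \<omega> * f n else 0) =
        (\<lambda>n. if n = 0 then if T \<omega> \<le> ennreal t then - f 0 else 0 else 0)"
      by (auto simp: d_def)
    then show ?thesis
      using sums_single[of 0 "\<lambda>_. if T \<omega> \<le> ennreal t then - f 0 else 0"] by (simp add: sums_iff)
  qed
  have "gbm_equation M F W \<mu> \<sigma> x\<^sub>0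
    (\<lambda>t \<omega>. (1 + (\<Sum>n. if T \<omega> \<le> ennreal t then d n \<omega> else 0)) * A t \<omega> + (\<Sum>n. if T \<omega> \<le> ennreal t
        then d n \<omega> * (X (enn2real (T \<omega>)) \<omega> - A (enn2real (T \<omega>)) \<omega>) else 0))
    (\<lambda>t \<omega>. (1 + (\<Sum>n. if T \<omega> \<le> ennreal t then d n \<omega> else 0)) * X t \<omega>)"
  proof (rule gbm_equation_rescale[OF W eq])
    show "AE \<omega> in M. \<forall>t\<ge>0. summable (\<lambda>n. if T \<omega> \<le> ennreal t then \<bar>d n \<omega>\<bar> else 0)"
      by (intro AE_I2 allI impI summable_finite[of "{0}"]) (auto simp: d_def)
  qed (auto simp: T incseq_def d_def[abs_def])
  then have "gbm_equation M F W \<mu> \<sigma> x\<^sub>0 (\<lambda>t \<omega>. A (min_time (T \<omega>) t) \<omega>)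
    (\<lambda>t \<omega>. if T \<omega> \<le> ennreal t then 0 else X t \<omega>)"
  proof (rule gbm_equation_AE_cong)
    have 1: "(1 + (\<Sum>n. if T \<omega> \<le> ennreal t then d n \<omega> else 0)) = (if T \<omega> \<le> ennreal t then 0 else 1)" for t \<omega>
      using single[of \<omega> t "\<lambda>_. 1"] by (cases "T \<omega> \<le> ennreal t") simp_all
    show "AE \<omega> in M. \<forall>t. (1 + (\<Sum>n. if T \<omega> \<le> ennreal t then d n \<omega> else 0)) * X t \<omega> =
        (if T \<omega> \<le> ennreal t then 0 else X t \<omega>)"
      unfolding 1 by simp
    show "AE \<omega> in M. \<forall>t\<ge>0. (1 + (\<Sum>n. if T \<omega> \<le> ennreal t then d n \<omega> else 0)) * A t \<omega> + (\<Sum>n. if T \<omega> \<le> ennreal t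
        then d n \<omega> * (X (enn2real (T \<omega>)) \<omega> - A (enn2real (T \<omega>)) \<omega>) else 0) = A (min_time (T \<omega>) t) \<omega>"
      unfolding 1 single
    proof (intro AE_I2 allI impI)
      fix \<omega> t assume \<omega>: "\<omega> \<in> space M" and t: "(0::real) \<le> t"
      interpret policy_path x\<^sub>0 "\<lambda>k. \<tau> k \<omega>" "\<lambda>k. Y k \<omega>" "\<lambda>t. C t \<omega>" "\<lambda>t. A t \<omega>" "\<lambda>t. X t \<omega>" by (rule path[OF \<omega>])
      have abs: "absorption = T \<omega>" by (simp add: T_def absorption_def)
      have "X (enn2real (T \<omega>)) \<omega> = 0" if "T \<omega> \<le> ennreal t"
      proof (rule zero_at_absorption(1))
        have "T \<omega> < \<top>" using that by (rule order.strict_trans1) simp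
        then show "absorption = ennreal (enn2real (T \<omega>))" by (simp add: abs)
      qed simp
      then show "(if T \<omega> \<le> ennreal t then 0 else 1) * A t \<omega> + (if T \<omega> \<le> ennreal t
        then - (X (enn2real (T \<omega>)) \<omega> - A (enn2real (T \<omega>)) \<omega>) else 0) = A (min_time (T \<omega>) t) \<omega>"
        using t by (simp add: min_time_eq)
    qed
  qed
  then show ?thesis
    unfolding regular_policy_def using stop' adA path' by (auto simp: gbm_equation_def)
qed

end

section \<open>The modified policy\<close>

lemma measurable_update_ratio [measurable]:
  assumes [measurable]: "R \<in> borel_measurable N" "y \<in> borel_measurable N" "z \<in> borel_measurable N"
  shows "(\<lambda>\<omega>. update_ratio a B (R \<omega>) (y \<omega>) (z \<omega>)) \<in> borel_measurable N"
  unfolding update_ratio_def by measurable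

lemma accumulated_cost_eq:
  "accumulated_cost c\<^sub>0 c\<^sub>1 x\<^sub>0 \<tau> X t \<omega> = (\<integral>\<^sup>+ s\<in>{0..t}. ennreal (c\<^sub>0 (X s \<omega>)) \<partial>lborel) +
    (\<Sum>k. if \<tau> k \<omega> \<le> ennreal t then ennreal (c\<^sub>1
      (if enn2real (\<tau> k \<omega>) = 0 then x\<^sub>0 else Lim (at_left (enn2real (\<tau> k \<omega>))) (\<lambda>s. X s \<omega>))
      (X (enn2real (\<tau> k \<omega>)) \<omega>)) else 0)"
  unfolding accumulated_cost_def left_limit_def ..

lemma control_parameters_exist:
  assumes "0 < k\<^sub>1" "0 < k\<^sub>2" "0 < \<eta>" "0 < k\<^sub>3"
  obtains a B where "control_parameters k\<^sub>1 k\<^sub>2 \<eta> a B" "1 \<le> a" "k\<^sub>4 * (- \<beta>) \<le> k\<^sub>3 * a"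
proof -
  \<comment> \<open>The two lower bounds are those of \<open>holding_cost_mono\<close>. Below,
    \<open>B powr \<eta>\<close> is at least \<open>K\<close>, and \<open>K * q\<close> dominates
    the left side of \<open>B_large\<close>; the lower bound 1 on \<open>K\<close> allows its power
    to be undone.\<close>
  define a where "a = max 1 (k\<^sub>4 * (- \<beta>) / k\<^sub>3)"
  define q :: real where "q = 1 - 2 powr (- \<eta>)"
  have q: "0 < q" unfolding q_def using powr_less_mono[of "- \<eta>" 0 2] assms by simp
  define K where "K = max 1 (((2 powr \<eta> - 1) * a powr \<eta> + k\<^sub>1 / k\<^sub>2) / q)"
  define B where "B = max (2 * a) (K powr (1 / \<eta>))"
  have a: "1 \<le> a" by (simp add: a_def)
  have "k\<^sub>4 * (- \<beta>) / k\<^sub>3 \<le> a" unfolding a_def by simp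
  then have ka: "k\<^sub>4 * (- \<beta>) \<le> k\<^sub>3 * a" unfolding pos_divide_le_eq[OF assms(4)] by (simp only: mult.commute)
  have "K = (K powr (1 / \<eta>)) powr \<eta>" using assms by (simp add: powr_powr K_def)
  also have "\<dots> \<le> B powr \<eta>" using assms by (intro powr_mono2) (auto simp: B_def)
  finally have "K * q \<le> B powr \<eta> * q" using q by (intro mult_right_mono) auto
  moreover have "((2 powr \<eta> - 1) * a powr \<eta> + k\<^sub>1 / k\<^sub>2) / q \<le> K" unfolding K_def by simp
  then have "(2 powr \<eta> - 1) * a powr \<eta> + k\<^sub>1 / k\<^sub>2 \<le> K * q" using q by (simp add: divide_le_eq)
  ultimately have "control_parameters k\<^sub>1 k\<^sub>2 \<eta> a B"
    using assms a by unfold_locales (auto simp: q_def B_def)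
  with a ka that show ?thesis by blast
qed

context usual_filtration
begin

text \<open>The induction alternates between times and states: a state known at
  \<open>\<rho> n\<close> makes \<open>\<rho> (Suc n)\<close> a debut, and sampling \<open>A\<close>
  and \<open>X\<close> there determines the next state.\<close>

lemma control_measurable:
  fixes a B :: real
  assumes reg: "regular_policy W \<mu> \<sigma> x\<^sub>0 \<tau> Y C A X"
  defines "\<rho> \<equiv> \<lambda>n \<omega>. control_time a B (\<lambda>t. X t \<omega>) (\<lambda>t. A t \<omega>) n"
    and "L \<equiv> \<lambda>n \<omega>. control_level a B (\<lambda>t. X t \<omega>) (\<lambda>t. A t \<omega>) n"
    and "R \<equiv> \<lambda>n \<omega>. control_ratio a B (\<lambda>t. X t \<omega>) (\<lambda>t. A t \<omega>) n"
  shows "stopping_time F (\<rho> n) \<and> L n \<in> borel_measurable (pre_sigma (\<rho> n)) \<and>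
    R n \<in> borel_measurable (pre_sigma (\<rho> n))"
proof (induction n)
  case 0
  then show ?case
    by (simp add: \<rho>_def L_def R_def stopping_time_const)
next
  case (Suc n)
  then have \<rho>: "stopping_time F (\<rho> n)" and L: "L n \<in> borel_measurable (pre_sigma (\<rho> n))"
    and R: "R n \<in> borel_measurable (pre_sigma (\<rho> n))" by auto
  have ad: "adapted F A" "adapted F X"
    and path: "\<And>\<omega>. \<omega> \<in> space M \<Longrightarrow> policy_path x\<^sub>0 (\<lambda>k. \<tau> k \<omega>) (\<lambda>k. Y k \<omega>) (\<lambda>t. C t \<omega>) (\<lambda>t. A t \<omega>) (\<lambda>t. X t \<omega>)"
    using reg unfolding regular_policy_def by auto
  note rcX = policy_path.right_continuous_X[OF path] and rcA = policy_path.right_continuous_A[OF path]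
  have \<rho>_Suc: "\<rho> (Suc n) = (\<lambda>\<omega>. Inf {ennreal t |t. 0 \<le> t \<and> \<rho> n \<omega> \<le> ennreal t \<and>
      (L n \<omega> < A t \<omega> \<or> R n \<omega> < 1 \<and> R n \<omega> * X t \<omega> < a)})"
    by (simp add: \<rho>_def L_def R_def control_time_Suc next_time_def)
  have \<rho>': "stopping_time F (\<rho> (Suc n))"
    unfolding \<rho>_Suc
  proof (rule stopping_time_debut[OF \<rho>])
    fix t :: real assume t: "0 \<le> t"
    note [measurable] = pre_sigma_measurableD[OF \<rho> L, of "ennreal t"] pre_sigma_measurableD[OF \<rho> R, of "ennreal t"]
      adaptedD[OF ad(1) t order_refl] adaptedD[OF ad(2) t order_refl] stopping_timeD[OF \<rho>, of "ennreal t"]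
    have "Measurable.pred (F (ennreal t)) (\<lambda>\<omega>. \<rho> n \<omega> \<le> ennreal t \<and>
        ((if \<rho> n \<omega> \<le> ennreal t then L n \<omega> else 0) < A t \<omega> \<or>
          (if \<rho> n \<omega> \<le> ennreal t then R n \<omega> else 0) < 1 \<and> (if \<rho> n \<omega> \<le> ennreal t then R n \<omega> else 0) * X t \<omega> < a))"
      by measurable
    also have "(\<lambda>\<omega>. \<rho> n \<omega> \<le> ennreal t \<and>
        ((if \<rho> n \<omega> \<le> ennreal t then L n \<omega> else 0) < A t \<omega> \<or>
          (if \<rho> n \<omega> \<le> ennreal t then R n \<omega> else 0) < 1 \<and> (if \<rho> n \<omega> \<le> ennreal t then R n \<omega> else 0) * X t \<omega> < a)) =
        (\<lambda>\<omega>. \<rho> n \<omega> \<le> ennreal t \<and> (L n \<omega> < A t \<omega> \<or> R n \<omega> < 1 \<and> R n \<omega> * X t \<omega> < a))"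
      by (auto simp: fun_eq_iff)
    finally show "Measurable.pred (F (ennreal t))
        (\<lambda>\<omega>. \<rho> n \<omega> \<le> ennreal t \<and> (L n \<omega> < A t \<omega> \<or> R n \<omega> < 1 \<and> R n \<omega> * X t \<omega> < a))" .
  next
    fix \<omega> t assume \<omega>: "\<omega> \<in> space M" and t: "0 \<le> t"
      and trig: "L n \<omega> < A t \<omega> \<or> R n \<omega> < 1 \<and> R n \<omega> * X t \<omega> < a"
    have lim: "((\<lambda>s. R n \<omega> * X s \<omega>) \<longlongrightarrow> R n \<omega> * X t \<omega>) (at t within {t..})"
      using rcX[OF \<omega> t] by (intro tendsto_intros) (simp add: continuous_within)
    have "eventually (\<lambda>s. L n \<omega> < A s \<omega> \<or> R n \<omega> < 1 \<and> R n \<omega> * X s \<omega> < a) (at t within {t..})"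
      using trig
    proof
      assume "L n \<omega> < A t \<omega>"
      from order_tendstoD(1)[OF rcA[OF \<omega> t, unfolded continuous_within] this] show ?thesis
        by eventually_elim simp
    next
      assume *: "R n \<omega> < 1 \<and> R n \<omega> * X t \<omega> < a"
      from order_tendstoD(2)[OF lim conjunct2[OF *]] show ?thesis
        by eventually_elim (use * in simp)
    qed
    then obtain \<epsilon> where \<epsilon>: "0 < \<epsilon>" "\<And>s. s \<in> {t..} \<Longrightarrow> s \<noteq> t \<Longrightarrow> dist s t < \<epsilon> \<Longrightarrow>
        L n \<omega> < A s \<omega> \<or> R n \<omega> < 1 \<and> R n \<omega> * X s \<omega> < a"
      unfolding eventually_at by auto
    show "\<exists>\<epsilon>>0. \<forall>s. t \<le> s \<and> s < t + \<epsilon> \<longrightarrow> L n \<omega> < A s \<omega> \<or> R n \<omega> < 1 \<and> R n \<omega> * X s \<omega> < a"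
    proof (intro exI[of _ \<epsilon>] conjI allI impI \<epsilon>(1))
      fix s assume "t \<le> s \<and> s < t + \<epsilon>"
      then show "L n \<omega> < A s \<omega> \<or> R n \<omega> < 1 \<and> R n \<omega> * X s \<omega> < a"
        using \<epsilon>(2)[of s] trig by (cases "s = t") (auto simp: dist_real_def)
    qed
  qed
  have le: "\<rho> n \<omega> \<le> \<rho> (Suc n) \<omega>" for \<omega>
    unfolding \<rho>_def by (rule incseqD[OF control_time_mono]) simp
  have L': "L n \<in> borel_measurable (pre_sigma (\<rho> (Suc n)))"
    by (rule measurable_pre_sigma_mono[OF \<rho> \<rho>' le L])
  have R': "R n \<in> borel_measurable (pre_sigma (\<rho> (Suc n)))"
    by (rule measurable_pre_sigma_mono[OF \<rho> \<rho>' le R])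
  have top: "{\<omega> \<in> space (pre_sigma (\<rho> (Suc n))). \<rho> (Suc n) \<omega> = \<infinity>} \<in> sets (pre_sigma (\<rho> (Suc n)))"
    using measurable_stopping_time_pre_sigma[OF \<rho>'] by simp
  have A': "(\<lambda>\<omega>. A (enn2real (\<rho> (Suc n) \<omega>)) \<omega>) \<in> borel_measurable (pre_sigma (\<rho> (Suc n)))"
    by (rule pre_sigma_sample[OF ad(1) \<rho>' rcA])
  have X': "(\<lambda>\<omega>. X (enn2real (\<rho> (Suc n) \<omega>)) \<omega>) \<in> borel_measurable (pre_sigma (\<rho> (Suc n)))"
    by (rule pre_sigma_sample[OF ad(2) \<rho>' rcX])
  have "L (Suc n) = (\<lambda>\<omega>. if \<rho> (Suc n) \<omega> = \<infinity> then L n \<omega> else A (enn2real (\<rho> (Suc n) \<omega>)) \<omega>)"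
    unfolding \<rho>_def L_def by (rule ext) (rule control_level_Suc)
  then have 1: "L (Suc n) \<in> borel_measurable (pre_sigma (\<rho> (Suc n)))"
    using L' A' top by (simp only:) (intro measurable_If)
  have "R (Suc n) = (\<lambda>\<omega>. if \<rho> (Suc n) \<omega> = \<infinity> then R n \<omega> else
      update_ratio a B (R n \<omega>) (X (enn2real (\<rho> (Suc n) \<omega>)) \<omega> - (A (enn2real (\<rho> (Suc n) \<omega>)) \<omega> - L n \<omega>))
        (X (enn2real (\<rho> (Suc n) \<omega>)) \<omega>))"
    unfolding \<rho>_def L_def R_def by (rule ext) (rule control_ratio_Suc[unfolded Let_def])
  then have 2: "R (Suc n) \<in> borel_measurable (pre_sigma (\<rho> (Suc n)))"
    using L' R' A' X' top by (simp only:) (intro measurable_If measurable_update_ratio borel_measurable_diff)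
  from \<rho>' 1 2 show ?case by blast
qed

text \<open>The order sizes are dictated by the equation. Rescaling by the jumps of the ratio
  creates a certain order term, \<open>order_sizes_sums\<close> recognizes it as the sum of the
  sizes \<open>Z n\<close>, and discarding the zero sizes leaves that sum unchanged.\<close>

lemma controlled_policy:
  assumes W: "AE \<omega> in M. continuous_on {0..} (\<lambda>t. W t \<omega>)"
    and reg: "regular_policy W \<mu> \<sigma> x\<^sub>0 \<tau> Y C A X"
    and nonneg: "\<And>\<omega> t. \<omega> \<in> space M \<Longrightarrow> 0 \<le> t \<Longrightarrow> 0 \<le> X t \<omega>"
    and par: "control_parameters k\<^sub>1 k\<^sub>2 \<eta> a B"
    and h: "1 \<le> a" "k\<^sub>4 * (- \<beta>) \<le> k\<^sub>3 * a" "0 \<le> k\<^sub>3" "0 \<le> k\<^sub>4" "\<beta> \<le> 0"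
  obtains \<theta> V X' where "admissible_bounded M F W \<mu> \<sigma> x\<^sub>0 \<theta> V X'"
    and "\<And>\<omega> t. \<omega> \<in> space M \<Longrightarrow> 0 \<le> t \<Longrightarrow>
      accumulated_cost (holding_cost k\<^sub>3 k\<^sub>4 \<beta>) (ordering_cost k\<^sub>1 k\<^sub>2 \<eta>) x\<^sub>0 \<theta> X' t \<omega>
        \<le> accumulated_cost (holding_cost k\<^sub>3 k\<^sub>4 \<beta>) (ordering_cost k\<^sub>1 k\<^sub>2 \<eta>) x\<^sub>0 \<tau> X t \<omega>"
proof -
  define \<rho> where "\<rho> n \<omega> = control_time a B (\<lambda>t. X t \<omega>) (\<lambda>t. A t \<omega>) n" for n \<omega>
  define L where "L n \<omega> = control_level a B (\<lambda>t. X t \<omega>) (\<lambda>t. A t \<omega>) n" for n \<omega>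
  define R where "R n \<omega> = control_ratio a B (\<lambda>t. X t \<omega>) (\<lambda>t. A t \<omega>) n" for n \<omega>
  define Z where "Z n \<omega> = order_size a B (\<lambda>t. X t \<omega>) (\<lambda>t. A t \<omega>) n" for n \<omega>
  define m where "m t \<omega> = ratio_at a B (\<lambda>t. X t \<omega>) (\<lambda>t. A t \<omega>) t" for t \<omega>
  define \<theta> where "\<theta> j \<omega> = thin_time (\<lambda>n. Z n \<omega>) (\<lambda>n. \<rho> (Suc n) \<omega>) j" for j \<omega>
  define V where "V j \<omega> = thin_value (\<lambda>n. Z n \<omega>) j" for j \<omega>
  define X' where "X' t \<omega> = m t \<omega> * X t \<omega>" for t \<omega>
  have ad: "adapted F A" "adapted F X" and eq: "gbm_equation M F W \<mu> \<sigma> x\<^sub>0 A X"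
    and path: "\<And>\<omega>. \<omega> \<in> space M \<Longrightarrow> policy_path x\<^sub>0 (\<lambda>k. \<tau> k \<omega>) (\<lambda>k. Y k \<omega>) (\<lambda>t. C t \<omega>) (\<lambda>t. A t \<omega>) (\<lambda>t. X t \<omega>)"
    using reg unfolding regular_policy_def by auto
  have cpath: "controlled_path x\<^sub>0 (\<lambda>k. \<tau> k \<omega>) (\<lambda>k. Y k \<omega>) (\<lambda>t. C t \<omega>) (\<lambda>t. A t \<omega>) (\<lambda>t. X t \<omega>) k\<^sub>1 k\<^sub>2 \<eta> a B"
    if "\<omega> \<in> space M" for \<omega>
    using path[OF that] par nonneg[OF that] by (intro controlled_path.intro controlled_path_axioms.intro)
  have meas: "stopping_time F (\<rho> n)" "L n \<in> borel_measurable (pre_sigma (\<rho> n))" "R n \<in> borel_measurable (pre_sigma (\<rho> n))" for n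
    using control_measurable[OF reg, where a=a and B=B and n=n] unfolding \<rho>_def[abs_def] L_def[abs_def] R_def[abs_def] by auto
  have mono: "incseq (\<lambda>n. \<rho> n \<omega>)" for \<omega> unfolding \<rho>_def by (rule control_time_mono)
  have mono': "incseq (\<lambda>n. \<rho> (Suc n) \<omega>)" for \<omega> using mono[of \<omega>] by (simp add: incseq_Suc_iff)
  have lift: "f \<in> borel_measurable (pre_sigma (\<rho> (Suc n)))" if "f \<in> borel_measurable (pre_sigma (\<rho> n))" for f n
    by (rule measurable_pre_sigma_mono[OF meas(1) meas(1) _ that]) (rule incseqD[OF mono], simp)
  have d: "(\<lambda>\<omega>. R (Suc n) \<omega> - R n \<omega>) \<in> borel_measurable (pre_sigma (\<rho> (Suc n)))" for n
    by (intro borel_measurable_diff meas(3) lift)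
  have Zm: "Z n \<in> borel_measurable (pre_sigma (\<rho> (Suc n)))" for n
  proof -
    let ?S = "pre_sigma (\<rho> (Suc n))"
    have A': "(\<lambda>\<omega>. A (enn2real (\<rho> (Suc n) \<omega>)) \<omega>) \<in> borel_measurable ?S"
      by (rule pre_sigma_sample[OF ad(1) meas(1) policy_path.right_continuous_A[OF path]])
    have X': "(\<lambda>\<omega>. X (enn2real (\<rho> (Suc n) \<omega>)) \<omega>) \<in> borel_measurable ?S"
      by (rule pre_sigma_sample[OF ad(2) meas(1) policy_path.right_continuous_X[OF path]])
    have top: "{\<omega> \<in> space ?S. \<rho> (Suc n) \<omega> = \<infinity>} \<in> sets ?S"
      using measurable_stopping_time_pre_sigma[OF meas(1)[of "Suc n"]] by simp
    have "Z n = (\<lambda>\<omega>. if \<rho> (Suc n) \<omega> = \<infinity> then 0 else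
        R (Suc n) \<omega> * X (enn2real (\<rho> (Suc n) \<omega>)) \<omega> -
        R n \<omega> * (X (enn2real (\<rho> (Suc n) \<omega>)) \<omega> - (A (enn2real (\<rho> (Suc n) \<omega>)) \<omega> - L n \<omega>)))"
      unfolding Z_def \<rho>_def L_def R_def by (rule ext) (simp only: Z_def order_size_def Let_def)
    then show ?thesis
      using A' X' top meas(3)[of "Suc n"] lift[OF meas(2)[of n]] lift[OF meas(3)[of n]]
      by (simp only:) (intro measurable_If borel_measurable_diff borel_measurable_times borel_measurable_const)
  qed
  have m_eq: "m t \<omega> = 1 + (\<Sum>n. if \<rho> (Suc n) \<omega> \<le> ennreal t then R (Suc n) \<omega> - R n \<omega> else 0)" for t \<omega>
    unfolding m_def ratio_at_def \<rho>_def R_def ..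
  have gbm0: "gbm_equation M F W \<mu> \<sigma> x\<^sub>0
    (\<lambda>t \<omega>. (1 + (\<Sum>n. if \<rho> (Suc n) \<omega> \<le> ennreal t then R (Suc n) \<omega> - R n \<omega> else 0)) * A t \<omega> +
      (\<Sum>n. if \<rho> (Suc n) \<omega> \<le> ennreal t
        then (R (Suc n) \<omega> - R n \<omega>) * (X (enn2real (\<rho> (Suc n) \<omega>)) \<omega> - A (enn2real (\<rho> (Suc n) \<omega>)) \<omega>) else 0))
    (\<lambda>t \<omega>. (1 + (\<Sum>n. if \<rho> (Suc n) \<omega> \<le> ennreal t then R (Suc n) \<omega> - R n \<omega> else 0)) * X t \<omega>)"
  proof (rule gbm_equation_rescale[OF W eq meas(1) mono' d])
    show "AE \<omega> in M. \<forall>t\<ge>0. summable (\<lambda>n. if \<rho> (Suc n) \<omega> \<le> ennreal t then \<bar>R (Suc n) \<omega> - R n \<omega>\<bar> else 0)"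
      unfolding \<rho>_def R_def by (intro AE_I2 allI impI controlled_path.variation_summable[OF cpath])
  qed
  have Z0: "0 \<le> Z n \<omega>" if "\<omega> \<in> space M" for n \<omega>
    unfolding Z_def by (rule controlled_path.Z_nonneg[OF cpath[OF that]])
  have sums: "(\<lambda>j. if \<theta> j \<omega> \<le> ennreal t then V j \<omega> else 0) sums
      (m t \<omega> * A t \<omega> + (\<Sum>n. if \<rho> (Suc n) \<omega> \<le> ennreal t
        then (R (Suc n) \<omega> - R n \<omega>) * (X (enn2real (\<rho> (Suc n) \<omega>)) \<omega> - A (enn2real (\<rho> (Suc n) \<omega>)) \<omega>) else 0))"
    if \<omega>: "\<omega> \<in> space M" and t: "0 \<le> t" for \<omega> t
    unfolding \<theta>_def V_def
  proof (rule sums_thin[OF Z0[OF \<omega>]])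
    show "(\<lambda>n. if \<rho> (Suc n) \<omega> \<le> ennreal t then Z n \<omega> else 0) sums
      (m t \<omega> * A t \<omega> + (\<Sum>n. if \<rho> (Suc n) \<omega> \<le> ennreal t
        then (R (Suc n) \<omega> - R n \<omega>) * (X (enn2real (\<rho> (Suc n) \<omega>)) \<omega> - A (enn2real (\<rho> (Suc n) \<omega>)) \<omega>) else 0))"
      using controlled_path.order_sizes_sums[OF cpath[OF \<omega>] t]
      unfolding Z_def \<rho>_def R_def m_def controlled_path.time_def[OF cpath[OF \<omega>]] .
  qed
  have gbm: "gbm_equation M F W \<mu> \<sigma> x\<^sub>0 (ordered_amount \<theta> V) X'"
  proof (rule gbm_equation_AE_cong[OF gbm0[folded m_eq]])
    show "AE \<omega> in M. \<forall>t. m t \<omega> * X t \<omega> = X' t \<omega>" by (simp add: X'_def)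
    show "AE \<omega> in M. \<forall>t\<ge>0. m t \<omega> * A t \<omega> + (\<Sum>n. if \<rho> (Suc n) \<omega> \<le> ennreal t
        then (R (Suc n) \<omega> - R n \<omega>) * (X (enn2real (\<rho> (Suc n) \<omega>)) \<omega> - A (enn2real (\<rho> (Suc n) \<omega>)) \<omega>) else 0) =
        ordered_amount \<theta> V t \<omega>"
      unfolding ordered_amount_def by (intro AE_I2 allI impI sums_unique sums)
  qed
  have level: "0 < X' (enn2real (\<theta> j \<omega>)) \<omega> \<and> X' (enn2real (\<theta> j \<omega>)) \<omega> \<le> B"
    if \<omega>: "\<omega> \<in> space M" and fin: "\<theta> j \<omega> < \<infinity>" for j \<omega>
  proof -
    interpret controlled_path x\<^sub>0 "\<lambda>k. \<tau> k \<omega>" "\<lambda>k. Y k \<omega>" "\<lambda>t. C t \<omega>" "\<lambda>t. A t \<omega>" "\<lambda>t. X t \<omega>" k\<^sub>1 k\<^sub>2 \<eta> a B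
      by (rule cpath[OF \<omega>])
    show ?thesis
    proof (cases rule: thin_cases[of "\<lambda>n. Z n \<omega>" j])
      case (1 n)
      have \<theta>: "\<theta> j \<omega> = \<rho> (Suc n) \<omega>" unfolding \<theta>_def by (rule 1(2))
      have "0 < Z n \<omega>" using 1(1) by (simp add: selects_def)
      note bounds = order_level_bounds[OF this[unfolded Z_def]]
      show ?thesis
        unfolding X'_def m_def \<theta> \<rho>_def time_def[symmetric] using modified_level[OF bounds(1)] bounds by simp
    next
      case 2
      then show ?thesis using fin by (simp add: \<theta>_def)
    qed
  qed
  show ?thesis
  proof
    show "admissible_bounded M F W \<mu> \<sigma> x\<^sub>0 \<theta> V X'"
      unfolding admissible_bounded_def admissible_def
    proof (intro conjI allI ballI exI[of _ B] gbm)
      show "stopping_time F (\<theta> k)" for k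
        unfolding \<theta>_def by (rule stopping_time_thin[OF meas(1) mono' Zm])
      show "V k \<in> borel_measurable (pre_sigma (\<theta> k))" for k
        unfolding \<theta>_def V_def by (rule measurable_thin_value[OF meas(1) mono' Zm])
      show "incseq (\<lambda>k. \<theta> k \<omega>)" for \<omega>
        unfolding \<theta>_def by (rule incseq_thin_time[OF mono'])
      show "0 \<le> V k \<omega>" for k \<omega> unfolding V_def by (rule thin_value_nonneg)
      show "AE \<omega> in M. \<forall>t\<ge>0. summable (\<lambda>k. if \<theta> k \<omega> \<le> ennreal t then V k \<omega> else 0)"
        using sums by (intro AE_I2 allI impI) (rule sums_summable)
      show "AE \<omega> in M. \<forall>k. \<theta> k \<omega> < \<infinity> \<longrightarrow> 0 < X' (enn2real (\<theta> k \<omega>)) \<omega>"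
        "AE \<omega> in M. \<forall>k. \<theta> k \<omega> < \<infinity> \<longrightarrow> X' (enn2real (\<theta> k \<omega>)) \<omega> \<le> B"
        using level by (auto intro!: AE_I2)
    qed
  next
    fix \<omega> t assume \<omega>: "\<omega> \<in> space M" and t: "(0::real) \<le> t"
    interpret controlled_path x\<^sub>0 "\<lambda>k. \<tau> k \<omega>" "\<lambda>k. Y k \<omega>" "\<lambda>t. C t \<omega>" "\<lambda>t. A t \<omega>" "\<lambda>t. X t \<omega>" k\<^sub>1 k\<^sub>2 \<eta> a B
      by (rule cpath[OF \<omega>])
    let ?g = "\<lambda>r (z::real). if r \<le> ennreal t then ennreal (ordering_cost k\<^sub>1 k\<^sub>2 \<eta>
        (if enn2real r = 0 then x\<^sub>0 else Lim (at_left (enn2real r)) (\<lambda>s. X' s \<omega>)) (X' (enn2real r) \<omega>)) else 0"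
    have "(\<Sum>j. ?g (\<theta> j \<omega>) (V j \<omega>)) = (\<Sum>n. if 0 < Z n \<omega> then ?g (\<rho> (Suc n) \<omega>) (Z n \<omega>) else 0)"
      unfolding \<theta>_def V_def by (rule suminf_thin) (simp add: top_unique)
    also have "\<dots> = (\<Sum>n. if \<rho> (Suc n) \<omega> \<le> ennreal t then ennreal (modified_cost n) else 0)"
    proof (intro arg_cong[where f=suminf] ext)
      fix n
      show "(if 0 < Z n \<omega> then ?g (\<rho> (Suc n) \<omega>) (Z n \<omega>) else 0) =
          (if \<rho> (Suc n) \<omega> \<le> ennreal t then ennreal (modified_cost n) else 0)"
      proof (cases "0 < Z n \<omega>")
        case True
        then have fin: "control_time a B (\<lambda>t. X t \<omega>) (\<lambda>t. A t \<omega>) (Suc n) \<noteq> \<infinity>"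
          unfolding Z_def by (rule order_level_bounds)
        show ?thesis
          unfolding X'_def m_def \<rho>_def time_def[symmetric] modified_left_limit(1)[OF fin] modified_level[OF fin]
          using True by (simp add: modified_cost_def Z_def)
      next
        case False
        then show ?thesis by (simp add: modified_cost_def Z_def)
      qed
    qed
    finally have orders: "(\<Sum>j. ?g (\<theta> j \<omega>) (V j \<omega>)) =
        (\<Sum>n. if \<rho> (Suc n) \<omega> \<le> ennreal t then ennreal (modified_cost n) else 0)" .
    have "(\<integral>\<^sup>+ s\<in>{0..t}. ennreal (holding_cost k\<^sub>3 k\<^sub>4 \<beta> (X' s \<omega>)) \<partial>lborel) +
        (\<Sum>n. if \<rho> (Suc n) \<omega> \<le> ennreal t then ennreal (modified_cost n) else 0) \<le>
        (\<integral>\<^sup>+ s\<in>{0..t}. ennreal (holding_cost k\<^sub>3 k\<^sub>4 \<beta> (X s \<omega>)) \<partial>lborel) +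
        (\<Sum>n. if \<rho> (Suc n) \<omega> \<le> ennreal t then ennreal (original_cost n) else 0)"
      unfolding X'_def m_def \<rho>_def by (rule modified_cheaper[OF t h])
    also have "\<dots> \<le> accumulated_cost (holding_cost k\<^sub>3 k\<^sub>4 \<beta>) (ordering_cost k\<^sub>1 k\<^sub>2 \<eta>) x\<^sub>0 \<tau> X t \<omega>"
      unfolding accumulated_cost_eq \<rho>_def by (intro add_left_mono original_orders_cost)
    finally show "accumulated_cost (holding_cost k\<^sub>3 k\<^sub>4 \<beta>) (ordering_cost k\<^sub>1 k\<^sub>2 \<eta>) x\<^sub>0 \<theta> X' t \<omega>
        \<le> accumulated_cost (holding_cost k\<^sub>3 k\<^sub>4 \<beta>) (ordering_cost k\<^sub>1 k\<^sub>2 \<eta>) x\<^sub>0 \<tau> X t \<omega>"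
      unfolding accumulated_cost_eq[of _ _ _ \<theta>] orders .
  qed
qed

text \<open>The pathwise construction asks for regular, nonnegative paths for every outcome, whereas
  admissibility gives regularity almost surely and positivity at order times. Regularization and
  absorption bridge the gap, and almost surely neither raises the accumulated cost.\<close>

lemma cheaper_bounded_policy:
  assumes W: "AE \<omega> in M. continuous_on {0..} (\<lambda>t. W t \<omega>)" and x\<^sub>0: "0 < x\<^sub>0"
    and k: "0 < k\<^sub>1" "0 < k\<^sub>2" "0 < k\<^sub>3" "0 \<le> k\<^sub>4" "\<beta> \<le> 0" "0 < \<eta>"
    and adm: "admissible M F W \<mu> \<sigma> x\<^sub>0 \<tau> Y X"
  shows "\<exists>\<theta> V X'. admissible_bounded M F W \<mu> \<sigma> x\<^sub>0 \<theta> V X' \<and>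
    (AE \<omega> in M. \<forall>t\<ge>0.
      accumulated_cost (holding_cost k\<^sub>3 k\<^sub>4 \<beta>) (ordering_cost k\<^sub>1 k\<^sub>2 \<eta>) x\<^sub>0 \<theta> X' t \<omega>
        \<le> accumulated_cost (holding_cost k\<^sub>3 k\<^sub>4 \<beta>) (ordering_cost k\<^sub>1 k\<^sub>2 \<eta>) x\<^sub>0 \<tau> X t \<omega>)"
proof -
  obtain \<tau>1 C1 A1 X1 where reg1: "regular_policy W \<mu> \<sigma> x\<^sub>0 \<tau>1 Y C1 A1 X1"
    and eq1: "AE \<omega> in M. (\<forall>k. \<tau>1 k \<omega> = \<tau> k \<omega>) \<and> (\<forall>t. X1 t \<omega> = X t \<omega>)"
    by (rule regularize[OF W x\<^sub>0 adm])
  define T where "T \<omega> = Inf {ennreal t |t. 0 \<le> t \<and> 0 \<le> ennreal t \<and> X1 t \<omega> < 0}" for \<omega>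
  define \<tau>2 where "\<tau>2 k \<omega> = (if \<tau>1 k \<omega> \<le> T \<omega> then \<tau>1 k \<omega> else \<infinity>)" for k \<omega>
  define X2 where "X2 t \<omega> = (if T \<omega> \<le> ennreal t then 0 else X1 t \<omega>)" for t \<omega>
  have reg2: "regular_policy W \<mu> \<sigma> x\<^sub>0 \<tau>2 Y (\<lambda>t \<omega>. C1 (min_time (T \<omega>) t) \<omega>)
      (\<lambda>t \<omega>. A1 (min_time (T \<omega>) t) \<omega>) X2"
    using absorb[OF W reg1] unfolding \<tau>2_def[abs_def] X2_def[abs_def] T_def .
  have path: "policy_path x\<^sub>0 (\<lambda>k. \<tau>1 k \<omega>) (\<lambda>k. Y k \<omega>) (\<lambda>t. C1 t \<omega>) (\<lambda>t. A1 t \<omega>) (\<lambda>t. X1 t \<omega>)"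
    if "\<omega> \<in> space M" for \<omega>
    using reg1 that unfolding regular_policy_def by auto
  have T_eq: "T \<omega> = policy_path.absorption (\<lambda>t. X1 t \<omega>)" if "\<omega> \<in> space M" for \<omega>
    by (simp add: T_def policy_path.absorption_def[OF path[OF that]])
  have nonneg: "0 \<le> X2 t \<omega>" if "\<omega> \<in> space M" "0 \<le> t" for \<omega> t
    unfolding X2_def T_eq[OF that(1)] by (rule policy_path.absorbed_nonneg[OF path[OF that(1)] that(2)])
  have cost2: "AE \<omega> in M. \<forall>t\<ge>0.
      accumulated_cost (holding_cost k\<^sub>3 k\<^sub>4 \<beta>) (ordering_cost k\<^sub>1 k\<^sub>2 \<eta>) x\<^sub>0 \<tau>2 X2 t \<omega>
        \<le> accumulated_cost (holding_cost k\<^sub>3 k\<^sub>4 \<beta>) (ordering_cost k\<^sub>1 k\<^sub>2 \<eta>) x\<^sub>0 \<tau> X t \<omega>"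
  proof -
    have "AE \<omega> in M. \<forall>k. \<tau> k \<omega> < \<infinity> \<longrightarrow> 0 < X (enn2real (\<tau> k \<omega>)) \<omega>"
      using adm unfolding admissible_def by blast
    then show ?thesis
      using eq1 AE_space
    proof eventually_elim
      case (elim \<omega>)
      show ?case
      proof (intro allI impI)
        fix t :: real assume t: "0 \<le> t"
        have "accumulated_cost (holding_cost k\<^sub>3 k\<^sub>4 \<beta>) (ordering_cost k\<^sub>1 k\<^sub>2 \<eta>) x\<^sub>0 \<tau> X t \<omega> =
            accumulated_cost (holding_cost k\<^sub>3 k\<^sub>4 \<beta>) (ordering_cost k\<^sub>1 k\<^sub>2 \<eta>) x\<^sub>0 \<tau>1 X1 t \<omega>"
          using elim(2) by (simp add: accumulated_cost_eq cong: if_cong)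
        moreover have "accumulated_cost (holding_cost k\<^sub>3 k\<^sub>4 \<beta>) (ordering_cost k\<^sub>1 k\<^sub>2 \<eta>) x\<^sub>0 \<tau>2 X2 t \<omega> \<le>
            accumulated_cost (holding_cost k\<^sub>3 k\<^sub>4 \<beta>) (ordering_cost k\<^sub>1 k\<^sub>2 \<eta>) x\<^sub>0 \<tau>1 X1 t \<omega>"
          unfolding accumulated_cost_eq \<tau>2_def X2_def T_eq[OF elim(3)]
          by (rule policy_path.absorbed_cost[OF path[OF elim(3)] _ t]) (use elim in auto)
        ultimately show "accumulated_cost (holding_cost k\<^sub>3 k\<^sub>4 \<beta>) (ordering_cost k\<^sub>1 k\<^sub>2 \<eta>) x\<^sub>0 \<tau>2 X2 t \<omega>
            \<le> accumulated_cost (holding_cost k\<^sub>3 k\<^sub>4 \<beta>) (ordering_cost k\<^sub>1 k\<^sub>2 \<eta>) x\<^sub>0 \<tau> X t \<omega>" by simp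
      qed
    qed
  qed
  obtain a B where par: "control_parameters k\<^sub>1 k\<^sub>2 \<eta> a B" "1 \<le> a" "k\<^sub>4 * (- \<beta>) \<le> k\<^sub>3 * a"
    using control_parameters_exist[OF k(1,2,6,3)] by blast
  obtain \<theta> V X' where bounded: "admissible_bounded M F W \<mu> \<sigma> x\<^sub>0 \<theta> V X'"
    and cheaper: "\<And>\<omega> t. \<omega> \<in> space M \<Longrightarrow> 0 \<le> t \<Longrightarrow>
      accumulated_cost (holding_cost k\<^sub>3 k\<^sub>4 \<beta>) (ordering_cost k\<^sub>1 k\<^sub>2 \<eta>) x\<^sub>0 \<theta> X' t \<omega>
        \<le> accumulated_cost (holding_cost k\<^sub>3 k\<^sub>4 \<beta>) (ordering_cost k\<^sub>1 k\<^sub>2 \<eta>) x\<^sub>0 \<tau>2 X2 t \<omega>"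
    by (rule controlled_policy[OF W reg2 nonneg par(1), of k\<^sub>4 \<beta> k\<^sub>3]) (use par k in auto)
  have "AE \<omega> in M. \<forall>t\<ge>0.
      accumulated_cost (holding_cost k\<^sub>3 k\<^sub>4 \<beta>) (ordering_cost k\<^sub>1 k\<^sub>2 \<eta>) x\<^sub>0 \<theta> X' t \<omega>
        \<le> accumulated_cost (holding_cost k\<^sub>3 k\<^sub>4 \<beta>) (ordering_cost k\<^sub>1 k\<^sub>2 \<eta>) x\<^sub>0 \<tau> X t \<omega>"
    using cost2 AE_space by eventually_elim (use cheaper in \<open>blast intro: order.trans\<close>)
  with bounded show ?thesis by blast
qed

end

section \<open>From accumulated to average costs\<close>

lemma average_cost_mono:
  assumes "AE \<omega> in M. \<forall>t\<ge>0. accumulated_cost c\<^sub>0 c\<^sub>1 x\<^sub>0 \<theta> X' t \<omega> \<le> accumulated_cost c\<^sub>0 c\<^sub>1 x\<^sub>0 \<tau> X t \<omega>"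
  shows "average_cost M c\<^sub>0 c\<^sub>1 x\<^sub>0 \<theta> X' \<le> average_cost M c\<^sub>0 c\<^sub>1 x\<^sub>0 \<tau> X"
  unfolding average_cost_def
proof (rule Limsup_mono, rule eventually_mono[OF eventually_ge_at_top[of 0]])
  fix t :: real assume t: "0 \<le> t"
  show "(\<integral>\<^sup>+ \<omega>. accumulated_cost c\<^sub>0 c\<^sub>1 x\<^sub>0 \<theta> X' t \<omega> \<partial>M) / ennreal t \<le>
      (\<integral>\<^sup>+ \<omega>. accumulated_cost c\<^sub>0 c\<^sub>1 x\<^sub>0 \<tau> X t \<omega> \<partial>M) / ennreal t"
    by (intro divide_right_mono_ennreal nn_integral_mono_AE) (use assms t in \<open>auto elim: eventually_mono\<close>)
qed

theorem proposition4p14: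
  fixes M :: "'a measure"
    and F :: "ennreal \<Rightarrow> 'a measure"
    and W X\<^sub>0 X :: "real \<Rightarrow> 'a \<Rightarrow> real"
    and \<mu> \<sigma> x\<^sub>0 k\<^sub>1 k\<^sub>2 k\<^sub>3 k\<^sub>4 \<beta> \<eta> :: real
    and \<tau> :: "nat \<Rightarrow> 'a \<Rightarrow> ennreal"
    and Y :: "nat \<Rightarrow> 'a \<Rightarrow> real"
  assumes "prob_space M" and "complete_measure M"
    and "\<mu> > 0" and "\<sigma> > 0" and "x\<^sub>0 > 0"
    and "k\<^sub>1 > 0" and "k\<^sub>2 > 0" and "k\<^sub>3 > 0" and "k\<^sub>4 > 0"
    and "\<beta> < 0" and "0 < \<eta>" and "\<eta> \<le> 1"
    and "standard_brownian_motion M W"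
    and "gbm_equation M (augmented_filtration M W) W \<mu> \<sigma> x\<^sub>0 (\<lambda>_ _. 0) X\<^sub>0"
    and "F = augmented_filtration M X\<^sub>0"
    and "admissible M F W \<mu> \<sigma> x\<^sub>0 \<tau> Y X"
  shows "\<exists>\<theta> Z X'. admissible_bounded M F W \<mu> \<sigma> x\<^sub>0 \<theta> Z X' \<and>
      (AE \<omega> in M. \<forall>t\<ge>0.
         accumulated_cost (holding_cost k\<^sub>3 k\<^sub>4 \<beta>) (ordering_cost k\<^sub>1 k\<^sub>2 \<eta>) x\<^sub>0 \<theta> X' t \<omega>
           \<le> accumulated_cost (holding_cost k\<^sub>3 k\<^sub>4 \<beta>) (ordering_cost k\<^sub>1 k\<^sub>2 \<eta>) x\<^sub>0 \<tau> X t \<omega>) \<and>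
      average_cost M (holding_cost k\<^sub>3 k\<^sub>4 \<beta>) (ordering_cost k\<^sub>1 k\<^sub>2 \<eta>) x\<^sub>0 \<theta> X'
        \<le> average_cost M (holding_cost k\<^sub>3 k\<^sub>4 \<beta>) (ordering_cost k\<^sub>1 k\<^sub>2 \<eta>) x\<^sub>0 \<tau> X"
proof -
  interpret usual_filtration M F
    unfolding \<open>F = augmented_filtration M X\<^sub>0\<close> by (rule usual_filtration_augmented) fact
  have W: "AE \<omega> in M. continuous_on {0..} (\<lambda>t. W t \<omega>)"
    using \<open>standard_brownian_motion M W\<close> by (simp add: standard_brownian_motion_def)
  obtain \<theta> Z X' where *: "admissible_bounded M F W \<mu> \<sigma> x\<^sub>0 \<theta> Z X'"
    "AE \<omega> in M. \<forall>t\<ge>0.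
       accumulated_cost (holding_cost k\<^sub>3 k\<^sub>4 \<beta>) (ordering_cost k\<^sub>1 k\<^sub>2 \<eta>) x\<^sub>0 \<theta> X' t \<omega>
         \<le> accumulated_cost (holding_cost k\<^sub>3 k\<^sub>4 \<beta>) (ordering_cost k\<^sub>1 k\<^sub>2 \<eta>) x\<^sub>0 \<tau> X t \<omega>"
    using cheaper_bounded_policy[OF W \<open>x\<^sub>0 > 0\<close> \<open>k\<^sub>1 > 0\<close> \<open>k\<^sub>2 > 0\<close> \<open>k\<^sub>3 > 0\<close> less_imp_le[OF \<open>k\<^sub>4 > 0\<close>]
        less_imp_le[OF \<open>\<beta> < 0\<close>] \<open>0 < \<eta>\<close> \<open>admissible M F W \<mu> \<sigma> x\<^sub>0 \<tau> Y X\<close>] by blast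
  from * average_cost_mono[OF *(2)] show ?thesis by blast
qed

end
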